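(* Let $M$ be a smooth manifold, let $R$ be a field of invertible linear transformations of the tangent spaces of $M$, and put $S:=R-\mathrm{Id}$. Then $$[d_R,d]=0\iff N_R=0\iff d_R=d+[\tau(S),d].$$
   Context: Everything is smooth; $\wedge^*(M)$ is the algebra of smooth real differential forms and $d$ the exterior derivative. $R$ acts on $p$-forms by $(R\alpha)(X_1,\dots,X_p)=\alpha(RX_1,\dots,RX_p)$ (identity on functions), and $d_R:=RdR^{-1}$ as operators on $\wedge^*(M)$. The Nijenhuis tensor of a field of endomorphisms $R$ of $TM$ is $$N_R(X,Y)=[RX,RY]+R^2[X,Y]-R[RX,Y]-R[X,RY].$$ For a field of endomorphisms $L$ of $TM$, $\tau(L)$ is the degree-zero operator on $\wedge^*(M)$ given by $(\tau(L)\alpha)(X_1,\dots,X_p)=\sum_{h=1}^p\alpha(X_1,\dots,L(X_h),\dots,X_p)$ (zero on functions). For homogeneous operators $P,Q$ on $\wedge^*(M)$ of degrees $|P|,|Q|$, $[P,Q]:=P\circ Q-(-1)^{|P||Q|}Q\circ P$ is the graded commutator; so $[d_R,d]=d_Rd+dd_R$ and $[\tau(S),d]=\tau(S)d-d\tau(S)$. *)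

theory Defs
  imports "HOL-Analysis.Analysis" "HOL-Library.Function_Algebras"
begin

section \<open>Smooth maps on open subsets of a finite-dimensional vector space\<close>

text \<open>
  The model space of a manifold is a linear subspace \<open>E\<close> of a Euclidean space, because the types
  of class \<open>euclidean_space\<close> have positive dimension and dimension 0 is to be allowed.
  In \<open>Ck k E U f\<close> the set \<open>U\<close> is relatively open in \<open>E\<close>. A derivative of \<open>f\<close> at a point of \<open>U\<close>
  (within \<open>U\<close>) is then unique on \<open>E\<close>, and only its values in directions \<open>v \<in> E\<close> are used.
\<close>

primrec Ck :: "nat \<Rightarrow> 'b::euclidean_space set \<Rightarrow> 'b set \<Rightarrow> ('b \<Rightarrow> 'c::real_normed_vector) \<Rightarrow> bool" where
  "Ck 0 E U f \<longleftrightarrow> continuous_on U f"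
| "Ck (Suc k) E U f \<longleftrightarrow>
     (\<exists>f'. (\<forall>x\<in>U. (f has_derivative f' x) (at x within U)) \<and> (\<forall>v\<in>E. Ck k E U (\<lambda>x. f' x v)))"

definition smooth_on :: "'b::euclidean_space set \<Rightarrow> 'b set \<Rightarrow> ('b \<Rightarrow> 'c::real_normed_vector) \<Rightarrow> bool" where
  "smooth_on E U f \<longleftrightarrow> (\<forall>k. Ck k E U f)"


section \<open>Smooth manifolds\<close>

text \<open>
  The points of the manifold are all elements of the type \<open>'m\<close>, a Hausdorff second countable
  space. A chart is a pair \<open>(U, \<phi>)\<close>; values of \<open>\<phi>\<close> outside \<open>U\<close> are irrelevant. The atlas need not
  be maximal. The dimension of the manifold is \<open>dim (model_space M)\<close>.
\<close>

record ('m, 'b) smooth_structure =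
  model_space :: "'b set"
  atlas :: "('m set \<times> ('m \<Rightarrow> 'b)) set"

definition smooth_manifold ::
    "('m::{t2_space,second_countable_topology}, 'b::euclidean_space) smooth_structure \<Rightarrow> bool" where
  "smooth_manifold M \<longleftrightarrow>
     subspace (model_space M) \<and>
     (\<Union>(U, \<phi>)\<in>atlas M. U) = UNIV \<and>
     (\<forall>(U, \<phi>)\<in>atlas M. open U \<and> openin (top_of_set (model_space M)) (\<phi> ` U) \<and>
        homeomorphism U (\<phi> ` U) \<phi> (inv_into U \<phi>)) \<and>
     (\<forall>(U, \<phi>)\<in>atlas M. \<forall>(V, \<psi>)\<in>atlas M.
        smooth_on (model_space M) (\<phi> ` (U \<inter> V)) (\<psi> \<circ> inv_into U \<phi>))"

definition smooth_functions ::
    "('m, 'b::euclidean_space) smooth_structure \<Rightarrow> ('m \<Rightarrow> real) set" where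
  "smooth_functions M =
     {f. \<forall>(U, \<phi>)\<in>atlas M. smooth_on (model_space M) (\<phi> ` U) (f \<circ> inv_into U \<phi>)}"


section \<open>Tangent spaces, vector fields, fields of endomorphisms\<close>

text \<open>
  Tangent vectors at \<open>p\<close> are the derivations at \<open>p\<close> of the algebra of smooth functions. They are
  set to 0 on functions that are not smooth, so that equality of functions is equality of tangent
  vectors.
\<close>

type_synonym 'm tangent_vector = "('m \<Rightarrow> real) \<Rightarrow> real"

definition tangent_space ::
    "('m, 'b::euclidean_space) smooth_structure \<Rightarrow> 'm \<Rightarrow> 'm tangent_vector set" where
  "tangent_space M p =
     {v. (\<forall>f. f \<notin> smooth_functions M \<longrightarrow> v f = 0) \<and>
         (\<forall>f\<in>smooth_functions M. \<forall>g\<in>smooth_functions M.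
            v (\<lambda>q. f q + g q) = v f + v g \<and>
            v (\<lambda>q. f q * g q) = f p * v g + g p * v f) \<and>
         (\<forall>c. \<forall>f\<in>smooth_functions M. v (\<lambda>q. c * f q) = c * v f)}"

type_synonym 'm vector_field = "'m \<Rightarrow> 'm tangent_vector"

definition vector_fields ::
    "('m, 'b::euclidean_space) smooth_structure \<Rightarrow> 'm vector_field set" where
  "vector_fields M =
     {X. (\<forall>p. X p \<in> tangent_space M p) \<and>
         (\<forall>f\<in>smooth_functions M. (\<lambda>p. X p f) \<in> smooth_functions M)}"

definition lie_bracket :: "'m vector_field \<Rightarrow> 'm vector_field \<Rightarrow> 'm vector_field" where
  "lie_bracket X Y = (\<lambda>p f. X p (\<lambda>q. Y q f) - Y p (\<lambda>q. X q f))"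

type_synonym 'm endo_field = "'m \<Rightarrow> 'm tangent_vector \<Rightarrow> 'm tangent_vector"

definition apply_field :: "'m endo_field \<Rightarrow> 'm vector_field \<Rightarrow> 'm vector_field" where
  "apply_field L X = (\<lambda>p. L p (X p))"

definition endo_fields :: "('m, 'b::euclidean_space) smooth_structure \<Rightarrow> 'm endo_field set" where
  "endo_fields M =
     {L. (\<forall>p. \<forall>v\<in>tangent_space M p. L p v \<in> tangent_space M p \<and>
            (\<forall>w\<in>tangent_space M p. L p (v + w) = L p v + L p w) \<and>
            (\<forall>c. L p (\<lambda>f. c * v f) = (\<lambda>f. c * L p v f))) \<and>
         (\<forall>X\<in>vector_fields M. apply_field L X \<in> vector_fields M)}"

definition invertible_endo_fields ::
    "('m, 'b::euclidean_space) smooth_structure \<Rightarrow> 'm endo_field set" where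
  "invertible_endo_fields M =
     {L\<in>endo_fields M. \<forall>p. bij_betw (L p) (tangent_space M p) (tangent_space M p)}"

definition inverse_field ::
    "('m, 'b::euclidean_space) smooth_structure \<Rightarrow> 'm endo_field \<Rightarrow> 'm endo_field" where
  "inverse_field M L = (\<lambda>p. inv_into (tangent_space M p) (L p))"

definition nijenhuis ::
    "'m endo_field \<Rightarrow> 'm vector_field \<Rightarrow> 'm vector_field \<Rightarrow> 'm vector_field" where
  "nijenhuis R X Y =
     lie_bracket (apply_field R X) (apply_field R Y)
     + apply_field R (apply_field R (lie_bracket X Y))
     - apply_field R (lie_bracket (apply_field R X) Y)
     - apply_field R (lie_bracket X (apply_field R Y))"


section \<open>Differential forms\<close>

text \<open>
  An element \<open>\<alpha>\<close> of the algebra of all (possibly inhomogeneous) forms maps a point \<open>p\<close> and a list of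
  tangent vectors at \<open>p\<close> to a real number; the restriction of \<open>\<alpha> p\<close> to lists of length \<open>k\<close> is the
  component of degree \<open>k\<close>, and \<open>\<alpha> p []\<close> is the function component. On lists that do not consist
  of tangent vectors at \<open>p\<close> the value is set to 0. Components of degree above the dimension vanish
  because forms are alternating, so no finiteness condition is needed for the direct sum.
\<close>

type_synonym 'm form = "'m \<Rightarrow> 'm tangent_vector list \<Rightarrow> real"

definition eval_form :: "'m form \<Rightarrow> 'm vector_field list \<Rightarrow> 'm \<Rightarrow> real" where
  "eval_form \<alpha> Xs = (\<lambda>p. \<alpha> p (map (\<lambda>X. X p) Xs))"

definition forms :: "('m, 'b::euclidean_space) smooth_structure \<Rightarrow> 'm form set" where
  "forms M =
     {\<alpha>. (\<forall>p vs. \<not> set vs \<subseteq> tangent_space M p \<longrightarrow> \<alpha> p vs = 0) \<and>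
         (\<forall>p vs i. set vs \<subseteq> tangent_space M p \<and> i < length vs \<longrightarrow>
            (\<forall>u\<in>tangent_space M p. \<forall>w\<in>tangent_space M p.
               \<alpha> p (vs[i := u + w]) = \<alpha> p (vs[i := u]) + \<alpha> p (vs[i := w])) \<and>
            (\<forall>c. \<forall>u\<in>tangent_space M p.
               \<alpha> p (vs[i := (\<lambda>f. c * u f)]) = c * \<alpha> p (vs[i := u]))) \<and>
         (\<forall>p vs i j. set vs \<subseteq> tangent_space M p \<and> i < j \<and> j < length vs \<and> vs ! i = vs ! j \<longrightarrow>
            \<alpha> p vs = 0) \<and>
         (\<forall>Xs. set Xs \<subseteq> vector_fields M \<longrightarrow> eval_form \<alpha> Xs \<in> smooth_functions M)}"

text \<open>
  The exterior derivative is given by the invariant formula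
  \<open>d\<alpha>(X\<^sub>0,\<dots>,X\<^sub>k) = \<Sum>\<^sub>i (-1)\<^sup>i X\<^sub>i(\<alpha>(\<dots> omit X\<^sub>i \<dots>))
     + \<Sum>\<^sub>i\<^sub><\<^sub>j (-1)\<^sup>i\<^sup>+\<^sup>j \<alpha>([X\<^sub>i,X\<^sub>j], \<dots> omit X\<^sub>i, X\<^sub>j \<dots>)\<close>.
  Its value at a point depends only on the values of the vector fields there; hence
  \<open>ext_d\<close> evaluates it on an arbitrary choice of smooth vector fields extending the given
  tangent vectors.
\<close>

definition koszul :: "'m form \<Rightarrow> 'm vector_field list \<Rightarrow> 'm \<Rightarrow> real" where
  "koszul \<alpha> Xs p =
     (\<Sum>i<length Xs. (-1) ^ i * (Xs ! i) p (eval_form \<alpha> (nths Xs (- {i}))))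
     + (\<Sum>j<length Xs. \<Sum>i<j. (-1) ^ (i + j) *
          eval_form \<alpha> (lie_bracket (Xs ! i) (Xs ! j) # nths Xs (- {i, j})) p)"

definition ext_d :: "('m, 'b::euclidean_space) smooth_structure \<Rightarrow> 'm form \<Rightarrow> 'm form" where
  "ext_d M \<alpha> = (\<lambda>p vs.
     if vs \<noteq> [] \<and> set vs \<subseteq> tangent_space M p
     then koszul \<alpha> (SOME Xs. set Xs \<subseteq> vector_fields M \<and> map (\<lambda>X. X p) Xs = vs) p
     else 0)"

definition pull_form ::
    "('m, 'b::euclidean_space) smooth_structure \<Rightarrow> 'm endo_field \<Rightarrow> 'm form \<Rightarrow> 'm form" where
  "pull_form M L \<alpha> = (\<lambda>p vs. if set vs \<subseteq> tangent_space M p then \<alpha> p (map (L p) vs) else 0)"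

text \<open>On forms, the operator inverse to \<open>pull_form M R\<close> is \<open>pull_form M (inverse_field M R)\<close>.\<close>

definition d_R :: "('m, 'b::euclidean_space) smooth_structure \<Rightarrow> 'm endo_field \<Rightarrow> 'm form \<Rightarrow> 'm form" where
  "d_R M R = pull_form M R \<circ> ext_d M \<circ> pull_form M (inverse_field M R)"

definition tau :: "('m, 'b::euclidean_space) smooth_structure \<Rightarrow> 'm endo_field \<Rightarrow> 'm form \<Rightarrow> 'm form" where
  "tau M L \<alpha> = (\<lambda>p vs.
     if set vs \<subseteq> tangent_space M p then \<Sum>h<length vs. \<alpha> p (vs[h := L p (vs ! h)]) else 0)"

text \<open>\<open>graded_comm a b P Q\<close> is the graded commutator of \<open>P\<close> of degree \<open>a\<close> and \<open>Q\<close> of degree \<open>b\<close>.\<close>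

definition graded_comm ::
    "nat \<Rightarrow> nat \<Rightarrow> ('m form \<Rightarrow> 'm form) \<Rightarrow> ('m form \<Rightarrow> 'm form) \<Rightarrow> 'm form \<Rightarrow> 'm form" where
  "graded_comm a b P Q \<alpha> = (\<lambda>p vs. P (Q \<alpha>) p vs - (-1) ^ (a * b) * Q (P \<alpha>) p vs)"

end

theory Submission
  imports Defs "HOL-Real_Asymp.Real_Asymp"
begin

text \<open>
  Write \<open>Q = d + [\<tau>(S), d]\<close>. Both \<open>d\<^sub>R\<close> and \<open>Q\<close> are determined by the way in which they pass through the
  contraction \<open>\<iota>\<^sub>X\<close>. Cartan's formula \<open>\<iota>\<^sub>X d = L\<^sub>X - d \<iota>\<^sub>X\<close> gives
  \<open>\<iota>\<^sub>X d\<^sub>R = R L\<^sub>R\<^sub>X R\<^sup>-\<^sup>1 - d\<^sub>R \<iota>\<^sub>X\<close> and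
  \<open>\<iota>\<^sub>X Q = (L\<^sub>X + L\<^sub>S\<^sub>X + [\<tau>(S), L\<^sub>X]) - Q \<iota>\<^sub>X\<close>.
  The two operators of degree zero that occur here are derivations. On functions both act as the
  field \<open>RX\<close>; an argument \<open>Y\<close> of the form is sent by the first to \<open>- R\<^sup>-\<^sup>1[RX, RY]\<close> and by the second
  to \<open>- [RX, Y] - [X, RY] + R[X, Y]\<close>. These differ by \<open>R\<^sup>-\<^sup>1 N\<^sub>R(X, Y)\<close>. Hence \<open>N\<^sub>R = 0\<close> implies
  \<open>d\<^sub>R = Q\<close>, by induction on the number of arguments (lemma \<open>pull_D_pull\<close>), and then
  \<open>[d\<^sub>R, d] = [Q, d] = 0\<close> because \<open>d \<circ> d = 0\<close> (lemma \<open>D_D\<close>). Conversely, for a smooth function \<open>f\<close>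
  both \<open>[d\<^sub>R, d] f\<close> and \<open>(d\<^sub>R - Q) (df)\<close> take the value \<open>- (R\<^sup>-\<^sup>1 N\<^sub>R(X, Y)) f\<close> on \<open>(X, Y)\<close>. A vector field
  that annihilates every function is zero, so either of the two operator identities forces
  \<open>N\<^sub>R = 0\<close>.

  These computations take place in the algebra of alternating maps on lists of vector fields that
  are multilinear over the smooth functions. The passage from this algebra to forms, which are
  evaluated on tangent vectors at a point, rests on one fact about the manifold (lemma
  \<open>local_frame\<close>): for every point \<open>p\<close> there are finitely many smooth functions \<open>g\<^sub>i\<close>, global vector fields
  \<open>X\<^sub>i\<close> and a smooth function \<open>\<rho>\<close> with \<open>\<rho>(p) \<noteq> 0\<close> such that \<open>\<rho> v = \<Sum>\<^sub>i v(g\<^sub>i) X\<^sub>i\<close> for all tangent vectors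
  \<open>v\<close> at all points. It is proved with a bump function and Hadamard's lemma, and it has three
  consequences: every tangent vector extends to a vector field; the value of an alternating
  multilinear map at a point depends only on the values of its arguments there, so that the
  Koszul formula defines a form; and \<open>R\<^sup>-\<^sup>1\<close> maps smooth vector fields to smooth ones, by solving a
  linear system with smooth coefficients.
\<close>

section \<open>Maps of class \<open>C\<^sup>k\<close> on relatively open sets\<close>

text \<open>
  In a relatively open subset of the subspace, every direction of the subspace is the direction of
  a segment through the point, and along a segment the derivative is unique. Off the subspace a
  derivative is arbitrary.
\<close>

lemma has_derivative_in_subspace_unique:
  fixes f :: "'b::euclidean_space \<Rightarrow> 'c::real_normed_vector"
  assumes E: "subspace E" and U: "openin (top_of_set E) U" and x: "x \<in> U" and v: "v \<in> E"
    and f1: "(f has_derivative f1) (at x within U)" and f2: "(f has_derivative f2) (at x within U)"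
  shows "f1 v = f2 v"
proof -
  obtain T where T: "open T" "U = E \<inter> T" using U by (auto simp: openin_open)
  define I where "I = (\<lambda>t::real. x + t *\<^sub>R v) -` T"
  have I: "open I" unfolding I_def by (intro open_vimage T continuous_intros)
  have 0: "0 \<in> I" using x T by (auto simp: I_def)
  have sub: "(\<lambda>t. x + t *\<^sub>R v) ` I \<subseteq> U"
    using x v E T by (auto simp: I_def intro!: subspace_add subspace_scale)
  have line: "((\<lambda>t. x + t *\<^sub>R v) has_derivative (\<lambda>t. t *\<^sub>R v)) (at 0 within I)"
    by (auto intro!: derivative_eq_intros)
  have "(f \<circ> (\<lambda>t. x + t *\<^sub>R v) has_derivative g \<circ> (\<lambda>t. t *\<^sub>R v)) (at 0)"
    if "(f has_derivative g) (at x within U)" for g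
  proof -
    have "(f has_derivative g) (at (x + 0 *\<^sub>R v) within (\<lambda>t. x + t *\<^sub>R v) ` I)"
      using has_derivative_subset[OF that sub] by simp
    from diff_chain_within[OF line this] show ?thesis
      unfolding at_within_open[OF 0 I] .
  qed
  from has_derivative_unique[OF this[OF f1] this[OF f2]]
  have "(f1 \<circ> (\<lambda>t. t *\<^sub>R v)) 1 = (f2 \<circ> (\<lambda>t. t *\<^sub>R v)) 1" by simp
  then show ?thesis by simp
qed

lemma Ck_subset: "Ck k E U f \<Longrightarrow> V \<subseteq> U \<Longrightarrow> Ck k E V f"
proof (induction k arbitrary: f)
  case 0 then show ?case by (auto intro: continuous_on_subset)
next
  case (Suc k)
  then obtain f' where f': "\<forall>x\<in>U. (f has_derivative f' x) (at x within U)" "\<forall>v\<in>E. Ck k E U (\<lambda>x. f' x v)"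
    by auto
  with Suc show ?case by (auto intro!: exI[of _ f'] dest: has_derivative_subset)
qed

lemma Ck_cong: "Ck k E U f \<Longrightarrow> (\<And>x. x \<in> U \<Longrightarrow> f x = g x) \<Longrightarrow> Ck k E U g"
proof (cases k)
  case 0 then show "Ck k E U f \<Longrightarrow> (\<And>x. x \<in> U \<Longrightarrow> f x = g x) \<Longrightarrow> ?thesis"
    using continuous_on_cong[of U U f g] by auto
next
  case (Suc k')
  assume "Ck k E U f" and eq: "\<And>x. x \<in> U \<Longrightarrow> f x = g x"
  with Suc obtain f' where "\<forall>x\<in>U. (f has_derivative f' x) (at x within U)" "\<forall>v\<in>E. Ck k' E U (\<lambda>x. f' x v)"
    by auto
  moreover from this(1) have "\<forall>x\<in>U. (g has_derivative f' x) (at x within U)"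
    using eq by (metis has_derivative_transform)
  ultimately show ?thesis using Suc by auto
qed

lemma Ck_Suc_imp_Ck: "Ck (Suc k) E U f \<Longrightarrow> Ck k E U f"
proof (induction k arbitrary: f)
  case 0
  then show ?case by (auto simp: continuous_on_eq_continuous_within intro: has_derivative_continuous)
next
  case (Suc k)
  from Suc.prems obtain f' where "\<forall>x\<in>U. (f has_derivative f' x) (at x within U)"
     "\<forall>v\<in>E. Ck (Suc k) E U (\<lambda>x. f' x v)" by (auto simp del: Ck.simps(2) simp: Ck.simps(2)[of "Suc k"])
  with Suc.IH show ?case unfolding Ck.simps(2)[of k] by blast
qed

lemma Ck_SucI:
  assumes "\<And>x. x \<in> U \<Longrightarrow> (f has_derivative f' x) (at x within U)" "\<And>v. v \<in> E \<Longrightarrow> Ck k E U (\<lambda>x. f' x v)"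
  shows "Ck (Suc k) E U f"
  using assms by auto

lemma Ck_SucE:
  assumes "Ck (Suc k) E U f"
  obtains f' where "\<And>x. x \<in> U \<Longrightarrow> (f has_derivative f' x) (at x within U)" "\<And>v. v \<in> E \<Longrightarrow> Ck k E U (\<lambda>x. f' x v)"
  using assms by auto

lemma Ck_const: "Ck k E U (\<lambda>x. c)"
proof (induction k arbitrary: c)
  case (Suc k)
  show ?case by (rule Ck_SucI[where f' = "\<lambda>x v. 0"]) (auto intro: Suc)
qed auto

lemma Ck_add: "Ck k E U f \<Longrightarrow> Ck k E U g \<Longrightarrow> Ck k E U (\<lambda>x. f x + g x)"
proof (induction k arbitrary: f g)
  case 0 then show ?case by (auto intro: continuous_intros)
next
  case (Suc k)
  obtain f' where f': "\<And>x. x \<in> U \<Longrightarrow> (f has_derivative f' x) (at x within U)" "\<And>v. v \<in> E \<Longrightarrow> Ck k E U (\<lambda>x. f' x v)"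
    using Suc.prems(1) by (rule Ck_SucE) blast
  obtain g' where g': "\<And>x. x \<in> U \<Longrightarrow> (g has_derivative g' x) (at x within U)" "\<And>v. v \<in> E \<Longrightarrow> Ck k E U (\<lambda>x. g' x v)"
    using Suc.prems(2) by (rule Ck_SucE) blast
  show ?case
    by (rule Ck_SucI[where f' = "\<lambda>x v. f' x v + g' x v"]) (auto intro: f' g' Suc.IH has_derivative_add)
qed

lemma Ck_mult:
  fixes f g :: "'b::euclidean_space \<Rightarrow> real"
  shows "Ck k E U f \<Longrightarrow> Ck k E U g \<Longrightarrow> Ck k E U (\<lambda>x. f x * g x)"
proof (induction k arbitrary: f g)
  case 0 then show ?case by (auto intro: continuous_intros)
next
  case (Suc k)
  obtain f' where f': "\<And>x. x \<in> U \<Longrightarrow> (f has_derivative f' x) (at x within U)" "\<And>v. v \<in> E \<Longrightarrow> Ck k E U (\<lambda>x. f' x v)"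
    using Suc.prems(1) by (rule Ck_SucE) blast
  obtain g' where g': "\<And>x. x \<in> U \<Longrightarrow> (g has_derivative g' x) (at x within U)" "\<And>v. v \<in> E \<Longrightarrow> Ck k E U (\<lambda>x. g' x v)"
    using Suc.prems(2) by (rule Ck_SucE) blast
  note fg = Suc.prems[THEN Ck_Suc_imp_Ck]
  show ?case
    by (rule Ck_SucI[where f' = "\<lambda>x v. f x * g' x v + f' x v * g x"])
      (intro f' g' Suc.IH Ck_add has_derivative_mult fg; assumption)+
qed

lemma Ck_sum:
  fixes f :: "'i \<Rightarrow> 'b::euclidean_space \<Rightarrow> real"
  shows "(\<And>i. i \<in> I \<Longrightarrow> Ck k E U (f i)) \<Longrightarrow> Ck k E U (\<lambda>x. \<Sum>i\<in>I. f i x)"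
  by (induction I rule: infinite_finite_induct) (auto intro: Ck_const Ck_add)

lemma Ck_bounded_linear: "bounded_linear f \<Longrightarrow> Ck k E U f"
proof (cases k)
  case 0 then show "bounded_linear f \<Longrightarrow> ?thesis" by (auto intro: linear_continuous_on)
next
  case (Suc k')
  then show "bounded_linear f \<Longrightarrow> ?thesis"
    using Ck_SucI[of U f "\<lambda>x. f" E k'] by (auto intro: bounded_linear_imp_has_derivative Ck_const)
qed

lemma Ck_inner:
  fixes f :: "'b::euclidean_space \<Rightarrow> 'c::real_inner"
  shows "Ck k E U f \<Longrightarrow> Ck k E U (\<lambda>x. f x \<bullet> b)"
proof (induction k arbitrary: f)
  case 0 then show ?case by (auto intro: continuous_intros)
next
  case (Suc k)
  obtain f' where f': "\<And>x. x \<in> U \<Longrightarrow> (f has_derivative f' x) (at x within U)" "\<And>v. v \<in> E \<Longrightarrow> Ck k E U (\<lambda>x. f' x v)"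
    using Suc.prems(1) by (rule Ck_SucE) blast
  show ?case
    by (rule Ck_SucI[where f' = "\<lambda>x v. f' x v \<bullet> b"]) (auto intro: f' Suc.IH has_derivative_inner_left)
qed

lemma Ck_inverse:
  fixes f :: "'b::euclidean_space \<Rightarrow> real"
  assumes nz: "\<And>x. x \<in> U \<Longrightarrow> f x \<noteq> 0"
  shows "Ck k E U f \<Longrightarrow> Ck k E U (\<lambda>x. inverse (f x))"
proof (induction k)
  case 0 then show ?case using nz by (auto intro: continuous_intros)
next
  case (Suc k)
  obtain f' where f': "\<And>x. x \<in> U \<Longrightarrow> (f has_derivative f' x) (at x within U)" "\<And>v. v \<in> E \<Longrightarrow> Ck k E U (\<lambda>x. f' x v)"
    using Suc.prems(1) by (rule Ck_SucE) blast
  have i: "Ck k E U (\<lambda>x. inverse (f x))" using Suc Ck_Suc_imp_Ck by blast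
  have m: "Ck k E U (\<lambda>x. (-1) * (inverse (f x) * f' x v * inverse (f x)))" if "v \<in> E" for v
    by (intro Ck_mult Ck_const i f'(2) that)
  show ?case
    by (rule Ck_SucI[where f' = "\<lambda>x v. - (inverse (f x) * f' x v * inverse (f x))"])
      (use nz f'(1) m in \<open>auto intro: has_derivative_inverse\<close>)
qed

text \<open>
  The derivatives that witness differentiability near different points may differ off the
  subspace. They are therefore replaced by one choice, the \<open>frechet_derivative\<close>, which agrees with
  each of them in the directions of the subspace.
\<close>

lemma Ck_local:
  fixes f :: "'b::euclidean_space \<Rightarrow> 'c::real_normed_vector"
  assumes E: "subspace E"
  shows "openin (top_of_set E) U \<Longrightarrow> (\<And>x. x \<in> U \<Longrightarrow> \<exists>T. open T \<and> x \<in> T \<and> Ck k E (U \<inter> T) f) \<Longrightarrow> Ck k E U f"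
proof (induction k arbitrary: f)
  case 0
  show ?case unfolding Ck.simps continuous_on_eq_continuous_within
  proof
    fix x assume x: "x \<in> U"
    obtain T where T: "open T" "x \<in> T" "continuous_on (U \<inter> T) f" using 0(2)[OF x] by auto
    then have "continuous (at x within U \<inter> T) f" using x by (auto simp: continuous_on_eq_continuous_within)
    moreover have "at x within U \<inter> T = at x within U"
      using T by (intro at_within_nhd[where S = T]) auto
    ultimately show "continuous (at x within U) f" by simp
  qed
next
  case (Suc k)
  have eqat: "at x within U \<inter> T = at x within U" if "open T" "x \<in> T" for x T
    using that by (intro at_within_nhd[where S = T]) auto
  have ex: "\<exists>T g. open T \<and> x \<in> T \<and> (\<forall>y\<in>U \<inter> T. (f has_derivative g y) (at y within U)) \<and> (\<forall>v\<in>E. Ck k E (U \<inter> T) (\<lambda>y. g y v))"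
    if x: "x \<in> U" for x
  proof -
    obtain T where T: "open T" "x \<in> T" "Ck (Suc k) E (U \<inter> T) f" using Suc.prems(2)[OF x] by blast
    obtain g where g: "\<And>y. y \<in> U \<inter> T \<Longrightarrow> (f has_derivative g y) (at y within U \<inter> T)" "\<And>v. v \<in> E \<Longrightarrow> Ck k E (U \<inter> T) (\<lambda>x. g x v)"
      using T(3) by (rule Ck_SucE) blast
    have "\<forall>y\<in>U \<inter> T. (f has_derivative g y) (at y within U)" using g(1) eqat T by (metis Int_iff)
    with T g show ?thesis by blast
  qed
  define F where "F x = frechet_derivative f (at x within U)" for x
  have F: "(f has_derivative F x) (at x within U)" if x: "x \<in> U" for x
    unfolding F_def using ex[OF x] x by (meson IntI differentiableI frechet_derivative_works[THEN iffD1])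
  show ?case
  proof (rule Ck_SucI[OF F])
    fix v assume v: "v \<in> E"
    show "Ck k E U (\<lambda>x. F x v)"
    proof (rule Suc.IH[OF Suc.prems(1)])
      fix x assume x: "x \<in> U"
      obtain T g where T: "open T" "x \<in> T" and g: "\<forall>y\<in>U \<inter> T. (f has_derivative g y) (at y within U)" "\<forall>v\<in>E. Ck k E (U \<inter> T) (\<lambda>y. g y v)"
        using ex[OF x] by blast
      have "Ck k E (U \<inter> T) (\<lambda>x. F x v)"
        by (rule Ck_cong[of _ _ _ "\<lambda>y. g y v"])
          (use g v F Suc.prems(1) has_derivative_in_subspace_unique[OF E] in blast)+
      with T show "\<exists>T. open T \<and> x \<in> T \<and> Ck k E (U \<inter> T) (\<lambda>x. F x v)" by blast
    qed
  qed
qed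

text \<open>
  Composition with the orthogonal projection onto the subspace turns any derivative into one that
  is a combination of its directional derivatives along the subspace, the only ones about which
  \<open>Ck\<close> gives information.
\<close>

lemma has_derivative_orthonormal_expand:
  fixes f :: "'b::euclidean_space \<Rightarrow> 'c::real_normed_vector"
  assumes B: "\<And>y. y \<in> E \<Longrightarrow> (\<Sum>b\<in>B. (y \<bullet> b) *\<^sub>R b) = y" and V: "V \<subseteq> E" and x: "x \<in> V"
    and f': "(f has_derivative f') (at x within V)"
  shows "(f has_derivative (\<lambda>v. \<Sum>b\<in>B. (v \<bullet> b) *\<^sub>R f' b)) (at x within V)"
proof -
  define P where "P y = (\<Sum>b\<in>B. (y \<bullet> b) *\<^sub>R b)" for y
  have P: "bounded_linear P" unfolding P_def
    by (intro bounded_linear_sum bounded_linear_scaleR_const bounded_linear_inner_left)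
  have PV: "P y = y" if "y \<in> V" for y using that B V by (auto simp: P_def)
  then have "P ` V = V" by force
  then have "(f has_derivative f') (at (P x) within P ` V)" using f' PV[OF x] by simp
  from diff_chain_within[OF bounded_linear_imp_has_derivative[OF P] this]
  have "(f \<circ> P has_derivative f' \<circ> P) (at x within V)" .
  moreover have "f' \<circ> P = (\<lambda>v. \<Sum>b\<in>B. (v \<bullet> b) *\<^sub>R f' b)"
  proof -
    interpret bounded_linear f' using f' by (rule has_derivative_bounded_linear)
    show ?thesis by (auto simp: P_def sum scaleR)
  qed
  ultimately show ?thesis
    using PV has_derivative_transform[OF x, of f "f \<circ> P"] by auto
qed

lemma orthonormal_basis_expansion:
  assumes "subspace (E :: 'b::euclidean_space set)"
  obtains B where "finite B" "B \<subseteq> E" "\<And>y. y \<in> E \<Longrightarrow> (\<Sum>b\<in>B. (y \<bullet> b) *\<^sub>R b) = y"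
proof -
  obtain B where B: "B \<subseteq> E" "pairwise orthogonal B" "\<And>x. x \<in> B \<Longrightarrow> norm x = 1"
      "independent B" "card B = dim E" "span B = E"
    using orthonormal_basis_subspace[OF assms] by blast
  have fin: "finite B" using B(4) by (rule independent_imp_finite)
  have "(\<Sum>b\<in>B. (y \<bullet> b) *\<^sub>R b) = y" if "y \<in> E" for y
    using orthonormal_basis_expand[OF B(2,3) _ fin] that B(6) by blast
  with that fin B show thesis by blast
qed

text \<open>
  The set \<open>B\<close> plays the role of an orthonormal basis of the subspace that contains the domain of
  \<open>f\<close>; in such a basis the chain rule involves only directional derivatives along the subspace.
\<close>

lemma Ck_compose:
  fixes f :: "'b::euclidean_space \<Rightarrow> real" and g :: "'a::euclidean_space \<Rightarrow> 'b"
  assumes B: "finite B" "B \<subseteq> E" "\<And>y. y \<in> E \<Longrightarrow> (\<Sum>b\<in>B. (y \<bullet> b) *\<^sub>R b) = y" and V: "V \<subseteq> E" and gV: "g ` U \<subseteq> V"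
  shows "Ck k E V f \<Longrightarrow> Ck k F U g \<Longrightarrow> Ck k F U (f \<circ> g)"
proof (induction k arbitrary: f)
  case 0 then show ?case using gV by (auto intro: continuous_on_compose2)
next
  case (Suc k)
  obtain f' where f': "\<And>x. x \<in> V \<Longrightarrow> (f has_derivative f' x) (at x within V)" "\<And>v. v \<in> E \<Longrightarrow> Ck k E V (\<lambda>x. f' x v)"
    using Suc.prems(1) by (rule Ck_SucE) blast
  obtain g' where g': "\<And>x. x \<in> U \<Longrightarrow> (g has_derivative g' x) (at x within U)" "\<And>v. v \<in> F \<Longrightarrow> Ck k F U (\<lambda>x. g' x v)"
    using Suc.prems(2) by (rule Ck_SucE) blast
  have gk: "Ck k F U g" using Suc.prems(2) by (rule Ck_Suc_imp_Ck)
  show ?case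
  proof (rule Ck_SucI)
    fix x assume x: "x \<in> U"
    then have "(f has_derivative (\<lambda>v. \<Sum>b\<in>B. (v \<bullet> b) *\<^sub>R f' (g x) b)) (at (g x) within V)"
      using gV by (intro has_derivative_orthonormal_expand[OF B(3) V] f'(1)) auto
    from diff_chain_within[OF g'(1)[OF x] has_derivative_subset[OF this gV]]
    show "(f \<circ> g has_derivative (\<lambda>v. \<Sum>b\<in>B. (g' x v \<bullet> b) * f' (g x) b)) (at x within U)"
      by (simp add: o_def)
  next
    fix v assume v: "v \<in> F"
    have "Ck k F U ((\<lambda>y. f' y b) \<circ> g)" if "b \<in> B" for b
      using that B(2) f'(2) gk Suc.IH by blast
    then show "Ck k F U (\<lambda>x. \<Sum>b\<in>B. (g' x v \<bullet> b) * f' (g x) b)"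
      by (intro Ck_sum Ck_mult Ck_inner g' v) (simp add: o_def)
  qed
qed

section \<open>Hadamard's lemma and bump functions\<close>

text \<open>
  Differentiation under the integral sign reproduces an integral of the same shape: the derivative
  in direction \<open>v\<close> replaces \<open>f\<close> by its derivative in direction \<open>v\<close> and gains a factor \<open>t\<close>. The power of
  \<open>t\<close> is there to make the induction on \<open>k\<close> go through.
\<close>

lemma Ck_integral_along_rays:
  fixes f :: "'b::euclidean_space \<Rightarrow> real"
  assumes B: "finite B" "B \<subseteq> E" "\<And>y. y \<in> E \<Longrightarrow> (\<Sum>b\<in>B. (y \<bullet> b) *\<^sub>R b) = y"
    and W: "convex W" "W \<subseteq> E" "a \<in> W"
  shows "Ck k E W f \<Longrightarrow> Ck k E W (\<lambda>y. integral {0..1} (\<lambda>t. t ^ j * f (a + t *\<^sub>R (y - a))))"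
proof -
  have seg: "a + t *\<^sub>R (y - a) \<in> W" if "y \<in> W" "t \<in> {0..1}" for t y
  proof -
    have "(1 - t) *\<^sub>R a + t *\<^sub>R y \<in> W" using W that by (auto simp: convex_alt)
    then show ?thesis by (simp add: algebra_simps)
  qed
  have cont: "continuous_on (W \<times> cbox 0 1) (\<lambda>(y, t). t ^ j * f (a + t *\<^sub>R (y - a)))"
    if "continuous_on W f" for f :: "'b \<Rightarrow> real" and j
    unfolding case_prod_beta
    by (intro continuous_intros continuous_on_compose2[OF that]) (use seg in auto)
  show "Ck k E W f \<Longrightarrow> Ck k E W (\<lambda>y. integral {0..1} (\<lambda>t. t ^ j * f (a + t *\<^sub>R (y - a))))"
  proof (induction k arbitrary: f j)
    case 0
    then show ?case using integral_continuous_on_param[OF cont] by simp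
  next
    case (Suc k)
    obtain f' where f': "\<And>x. x \<in> W \<Longrightarrow> (f has_derivative f' x) (at x within W)" "\<And>v. v \<in> E \<Longrightarrow> Ck k E W (\<lambda>x. f' x v)"
      using Suc.prems by (rule Ck_SucE) blast
    have f'c: "continuous_on W (\<lambda>x. f' x b)" if "b \<in> B" for b
      using f'(2)[of b] B(2) that Ck.simps(1)
      by (induction k) (auto dest: Ck_Suc_imp_Ck simp del: Ck.simps(2))
    define D where "D y t = (\<Sum>b\<in>B. (t ^ Suc j * f' (a + t *\<^sub>R (y - a)) b) *\<^sub>R blinfun_inner_left b)" for y t
    have D: "blinfun_apply (D y t) = (\<lambda>v. \<Sum>b\<in>B. (v \<bullet> b) * (t ^ Suc j * f' (a + t *\<^sub>R (y - a)) b))" for y t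
      by (auto simp: D_def blinfun.sum_left blinfun.scaleR_left ac_simps inner_commute)
    have fc: "continuous_on W f" using f'(1) by (auto simp: continuous_on_eq_continuous_within intro: has_derivative_continuous)
    have der: "((\<lambda>y. t ^ j * f (a + t *\<^sub>R (y - a))) has_derivative blinfun_apply (D y t)) (at y within W)"
      if y: "y \<in> W" and t: "t \<in> cbox 0 1" for y t
    proof -
      have "((\<lambda>y. a + t *\<^sub>R (y - a)) has_derivative (\<lambda>v. t *\<^sub>R v)) (at y within W)"
        by (auto intro!: derivative_eq_intros)
      moreover have "(f has_derivative (\<lambda>v. \<Sum>b\<in>B. (v \<bullet> b) *\<^sub>R f' (a + t *\<^sub>R (y - a)) b)) (at (a + t *\<^sub>R (y - a)) within W)"
        using y t seg by (intro has_derivative_orthonormal_expand[OF B(3) W(2)] f'(1)) auto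
      ultimately have "(f \<circ> (\<lambda>y. a + t *\<^sub>R (y - a)) has_derivative
          (\<lambda>v. \<Sum>b\<in>B. (v \<bullet> b) *\<^sub>R f' (a + t *\<^sub>R (y - a)) b) \<circ> (\<lambda>v. t *\<^sub>R v)) (at y within W)"
        by (rule diff_chain_within[OF _ has_derivative_subset]) (use seg t in auto)
      from has_derivative_mult_right[OF this, of "t ^ j"] show ?thesis
        unfolding D by (simp add: o_def sum_distrib_left ac_simps)
    qed
    have int: "(\<lambda>t. t ^ j * f (a + t *\<^sub>R (y - a))) integrable_on cbox 0 1" if "y \<in> W" for y
      by (intro integrable_continuous continuous_intros continuous_on_compose2[OF fc]) (use seg that in auto)
    have contD: "continuous_on (W \<times> cbox 0 1) (\<lambda>(y, t). D y t)"
      using cont[OF f'c, where j = "Suc j"] unfolding D_def case_prod_beta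
      by (intro continuous_on_sum continuous_on_scaleR continuous_on_const)
    have fl: "((\<lambda>y. integral {0..1} (\<lambda>t. t ^ j * f (a + t *\<^sub>R (y - a)))) has_derivative
        blinfun_apply (integral {0..1} (D y))) (at y within W)" if "y \<in> W" for y
      using leibniz_rule[OF der int contD that W(1)] by simp
    show ?case
    proof (rule Ck_SucI[OF fl])
      fix v assume v: "v \<in> E"
      have "blinfun_apply (integral {0..1} (D y)) v
         = (\<Sum>b\<in>B. (v \<bullet> b) * integral {0..1} (\<lambda>t. t ^ Suc j * f' (a + t *\<^sub>R (y - a)) b))" if y: "y \<in> W" for y
      proof -
        have i: "(\<lambda>t. t ^ Suc j * f' (a + t *\<^sub>R (y - a)) b) integrable_on {0..1}" if "b \<in> B" for b
          by (intro integrable_continuous_real continuous_intros continuous_on_compose2[OF f'c[OF that]]) (use seg y in auto)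
        have "D y integrable_on {0..1}"
        proof (rule integrable_continuous_real)
          have "continuous_on {0..1} (\<lambda>t. case (y, t) of (y, t) \<Rightarrow> D y t)"
            by (rule continuous_on_compose2[OF contD]) (use y in \<open>auto intro!: continuous_intros\<close>)
          then show "continuous_on {0..1} (D y)" by simp
        qed
        then have "blinfun_apply (integral {0..1} (D y)) v = integral {0..1} (\<lambda>t. blinfun_apply (D y t) v)"
          by (rule blinfun_apply_integral)
        also have "\<dots> = (\<Sum>b\<in>B. integral {0..1} (\<lambda>t. (v \<bullet> b) * (t ^ Suc j * f' (a + t *\<^sub>R (y - a)) b)))"
          unfolding D by (rule integral_sum[OF B(1)]) (use integrable_cmul[OF i, of _ "v \<bullet> _"] in simp)
        finally show ?thesis by simp
      qed
      moreover have "Ck k E W (\<lambda>y. \<Sum>b\<in>B. (v \<bullet> b) * integral {0..1} (\<lambda>t. t ^ Suc j * f' (a + t *\<^sub>R (y - a)) b))"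
        by (intro Ck_sum Ck_mult Ck_const Suc.IH f'(2)) (use B(2) in blast)
      ultimately show "Ck k E W (\<lambda>y. blinfun_apply (integral {0..1} (D y)) v)"
        by (elim Ck_cong) auto
    qed
  qed
qed

lemma smooth_on_derivative:
  fixes f :: "'b::euclidean_space \<Rightarrow> 'c::real_normed_vector"
  assumes f: "smooth_on E U f" and x: "x \<in> U"
  shows "(f has_derivative frechet_derivative f (at x within U)) (at x within U)"
    using f Ck.simps(2)[of 0 E U f] x
    by (auto simp: smooth_on_def simp del: Ck.simps intro!: frechet_derivative_works[THEN iffD1] intro: differentiableI)

lemma smooth_on_directional_derivative:
  fixes f :: "'b::euclidean_space \<Rightarrow> 'c::real_normed_vector"
  assumes E: "subspace E" and U: "openin (top_of_set E) U" and f: "smooth_on E U f" and v: "v \<in> E"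
  shows "smooth_on E U (\<lambda>x. frechet_derivative f (at x within U) v)"
  unfolding smooth_on_def
proof
  fix k
  obtain f' where f': "\<And>x. x \<in> U \<Longrightarrow> (f has_derivative f' x) (at x within U)" "\<And>v. v \<in> E \<Longrightarrow> Ck k E U (\<lambda>x. f' x v)"
    using f unfolding smooth_on_def by (metis Ck_SucE)
  show "Ck k E U (\<lambda>x. frechet_derivative f (at x within U) v)"
    by (rule Ck_cong[OF f'(2)[OF v]])
      (rule has_derivative_in_subspace_unique[OF E U _ v f'(1) smooth_on_derivative[OF f]])
qed

lemma smooth_on_mult:
  fixes f g :: "'b::euclidean_space \<Rightarrow> real"
  shows "smooth_on E U f \<Longrightarrow> smooth_on E U g \<Longrightarrow> smooth_on E U (\<lambda>x. f x * g x)"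
  by (simp add: smooth_on_def Ck_mult)

lemma smooth_on_subset: "smooth_on E U f \<Longrightarrow> V \<subseteq> U \<Longrightarrow> smooth_on E V f"
  by (auto simp: smooth_on_def intro: Ck_subset)

lemma smooth_on_local:
  assumes "subspace E" "openin (top_of_set E) U"
    and "\<And>x. x \<in> U \<Longrightarrow> \<exists>T. open T \<and> x \<in> T \<and> smooth_on E (U \<inter> T) f"
  shows "smooth_on E U f"
  using assms Ck_local unfolding smooth_on_def by meson

text \<open>
  The functions are \<open>h\<^sub>b(y) = \<integral>\<^sub>0\<^sup>1 (\<partial>\<^sub>b f)(a + t (y - a)) dt\<close>, and the identity is the fundamental theorem
  of calculus along the segment from \<open>a\<close> to \<open>y\<close>. This is what makes a derivation of the smooth
  functions depend only on first derivatives.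
\<close>

lemma hadamard:
  fixes f :: "'b::euclidean_space \<Rightarrow> real"
  assumes E: "subspace E" and B: "finite B" "B \<subseteq> E" "\<And>y. y \<in> E \<Longrightarrow> (\<Sum>b\<in>B. (y \<bullet> b) *\<^sub>R b) = y"
    and W: "convex W" "openin (top_of_set E) W" "a \<in> W" and f: "smooth_on E W f"
  obtains h where "\<forall>b\<in>B. smooth_on E W (h b)"
    and "\<forall>b. h b a = frechet_derivative f (at a within W) b"
    and "\<forall>y\<in>W. f y - f a = (\<Sum>b\<in>B. (y \<bullet> b - a \<bullet> b) * h b y)"
proof -
  have WE: "W \<subseteq> E" using W(2) by (auto dest: openin_imp_subset)
  define f' where "f' x = frechet_derivative f (at x within W)" for x
  have f': "(f has_derivative f' x) (at x within W)" if "x \<in> W" for x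
    unfolding f'_def by (rule smooth_on_derivative[OF f that])
  have sf': "smooth_on E W (\<lambda>x. f' x v)" if "v \<in> E" for v
    unfolding f'_def by (rule smooth_on_directional_derivative[OF E W(2) f that])
  define h where "h b y = integral {0..1} (\<lambda>t. f' (a + t *\<^sub>R (y - a)) b)" for b y
  have seg: "a + t *\<^sub>R (y - a) \<in> W" if "y \<in> W" "t \<in> {0..1}" for t y
  proof -
    have "(1 - t) *\<^sub>R a + t *\<^sub>R y \<in> W" using W that by (auto simp: convex_alt)
    then show ?thesis by (simp add: algebra_simps)
  qed
  show thesis
  proof (rule that; intro ballI allI)
    show "smooth_on E W (h b)" if "b \<in> B" for b
      using Ck_integral_along_rays[OF B W(1) WE W(3), of _ "\<lambda>x. f' x b" 0] sf'[of b] that B(2)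
      unfolding smooth_on_def h_def by auto
    show "h b a = frechet_derivative f (at a within W) b" for b
      by (simp add: h_def f'_def)
    fix y assume y: "y \<in> W"
    have ya: "y - a \<in> E" using y W(3) WE E by (auto intro: subspace_diff)
    have lin: "f' z (y - a) = (\<Sum>b\<in>B. (y \<bullet> b - a \<bullet> b) * f' z b)" if "z \<in> W" for z
    proof -
      interpret bounded_linear "f' z" using f'[OF that] by (rule has_derivative_bounded_linear)
      have "f' z (y - a) = f' z (\<Sum>b\<in>B. ((y - a) \<bullet> b) *\<^sub>R b)" using B(3)[OF ya] by simp
      then show ?thesis by (simp add: sum scaleR inner_diff_left)
    qed
    have i: "(\<lambda>t. (y \<bullet> b - a \<bullet> b) * f' (a + t *\<^sub>R (y - a)) b) integrable_on {0..1}" if b: "b \<in> B" for b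
    proof -
      have "continuous_on W (\<lambda>x. f' x b)"
        using sf'[of b] b B(2) Ck.simps(1) unfolding smooth_on_def by blast
      then have "continuous_on {0..1} (\<lambda>t. f' (a + t *\<^sub>R (y - a)) b)"
        by (rule continuous_on_compose2) (use seg y in \<open>auto intro!: continuous_intros\<close>)
      then show ?thesis
        by (intro integrable_on_mult_right integrable_continuous_real)
    qed
    have "((\<lambda>t. f' (a + t *\<^sub>R (y - a)) (y - a)) has_integral (f (a + 1 *\<^sub>R (y - a)) - f (a + 0 *\<^sub>R (y - a)))) {0..1}"
    proof (rule fundamental_theorem_of_calculus)
      fix t :: real assume t: "t \<in> {0..1}"
      have line: "((\<lambda>t. a + t *\<^sub>R (y - a)) has_derivative (\<lambda>s. s *\<^sub>R (y - a))) (at t within {0..1})"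
        by (auto intro!: derivative_eq_intros)
      have sub: "(\<lambda>t. a + t *\<^sub>R (y - a)) ` {0..1} \<subseteq> W" using seg y by blast
      have "(f has_derivative f' (a + t *\<^sub>R (y - a)))
          (at (a + t *\<^sub>R (y - a)) within (\<lambda>t. a + t *\<^sub>R (y - a)) ` {0..1})"
        using f' seg y t sub by (blast intro: has_derivative_subset)
      from diff_chain_within[OF line this]
      have "((\<lambda>t. f (a + t *\<^sub>R (y - a))) has_derivative f' (a + t *\<^sub>R (y - a)) \<circ> (\<lambda>s. s *\<^sub>R (y - a))) (at t within {0..1})"
        by (simp only: o_def)
      moreover have "f' z (s *\<^sub>R w) = s *\<^sub>R f' z w" if "z \<in> W" for z s w
        using f'[OF that] by (intro linear_scale bounded_linear.linear has_derivative_bounded_linear)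
      ultimately show "((\<lambda>t. f (a + t *\<^sub>R (y - a))) has_vector_derivative f' (a + t *\<^sub>R (y - a)) (y - a)) (at t within {0..1})"
        unfolding has_vector_derivative_def using seg[OF y t] by (simp add: o_def)
    qed simp
    then have "f y - f a = integral {0..1} (\<lambda>t. f' (a + t *\<^sub>R (y - a)) (y - a))"
      by (simp add: integral_unique)
    also have "\<dots> = integral {0..1} (\<lambda>t. \<Sum>b\<in>B. (y \<bullet> b - a \<bullet> b) * f' (a + t *\<^sub>R (y - a)) b)"
      by (intro integral_cong lin seg y)
    also have "\<dots> = (\<Sum>b\<in>B. (y \<bullet> b - a \<bullet> b) * h b y)"
      unfolding h_def by (subst integral_sum[OF B(1) i]) auto
    finally show "f y - f a = (\<Sum>b\<in>B. (y \<bullet> b - a \<bullet> b) * h b y)" .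
  qed
qed

text \<open>
  These functions contain the standard flat function \<open>e\<^sup>-\<^sup>1\<^sup>/\<^sup>t\<close> (for \<open>n = 0\<close>), and the derivative of each
  of them is a combination of two others; hence all of them are smooth.
\<close>

definition flat_exp :: "nat \<Rightarrow> real \<Rightarrow> real" where
  "flat_exp n t = (if t > 0 then inverse t ^ n * exp (- inverse t) else 0)"

lemma flat_exp_has_derivative:
  "(flat_exp n has_real_derivative flat_exp (n + 2) t - n * flat_exp (n + 1) t) (at t)"
proof (cases t "0::real" rule: linorder_cases)
  case greater
  have inv: "(inverse has_real_derivative - (inverse t * inverse t)) (at t)"
    using DERIV_inverse[of t] greater by simp
  have "((\<lambda>t. inverse t ^ n) has_real_derivative real n * (- (inverse t * inverse t) * inverse t ^ (n - 1))) (at t)"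
    using DERIV_power[OF inv, of n] by simp
  moreover have "real n * (- (inverse t * inverse t) * inverse t ^ (n - 1)) = - real n * inverse t ^ (n + 1)"
    by (cases n) (auto simp: algebra_simps)
  ultimately have "((\<lambda>t. inverse t ^ n) has_real_derivative - real n * inverse t ^ (n + 1)) (at t)"
    by (simp only:)
  moreover have "((\<lambda>t. exp (- inverse t)) has_real_derivative exp (- inverse t) * (inverse t * inverse t)) (at t)"
    using DERIV_chain2[OF DERIV_exp DERIV_minus[OF inv]] by simp
  ultimately have "((\<lambda>t. inverse t ^ n * exp (- inverse t)) has_real_derivative
      - real n * inverse t ^ (n + 1) * exp (- inverse t) + exp (- inverse t) * (inverse t * inverse t) * inverse t ^ n) (at t)"
    by (rule DERIV_mult)
  moreover have "- real n * inverse t ^ (n + 1) * exp (- inverse t) + exp (- inverse t) * (inverse t * inverse t) * inverse t ^ n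
      = flat_exp (n + 2) t - n * flat_exp (n + 1) t"
    using greater by (simp add: flat_exp_def mult_ac)
  ultimately have "((\<lambda>t. inverse t ^ n * exp (- inverse t)) has_real_derivative flat_exp (n + 2) t - n * flat_exp (n + 1) t) (at t)"
    by simp
  then show ?thesis
    by (rule has_field_derivative_transform_within_open[of _ _ _ "{0<..}"]) (use greater in \<open>auto simp: flat_exp_def\<close>)
next
  case less
  have "((\<lambda>t. 0) has_real_derivative flat_exp (n + 2) t - n * flat_exp (n + 1) t) (at t)"
    using less by (auto simp: flat_exp_def)
  then show ?thesis
    by (rule has_field_derivative_transform_within_open[of _ _ _ "{..<0}"]) (use less in \<open>auto simp: flat_exp_def\<close>)
next
  case equal
  have "((\<lambda>h. flat_exp n h / h) \<longlongrightarrow> 0) (at_right 0)"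
  proof (rule Lim_transform_eventually)
    show "((\<lambda>h::real. inverse h ^ n * exp (- inverse h) / h) \<longlongrightarrow> 0) (at_right 0)" by real_asymp
    show "\<forall>\<^sub>F h in at_right 0. inverse h ^ n * exp (- inverse h) / h = flat_exp n h / h"
      unfolding eventually_at_right_field by (auto simp: flat_exp_def intro: exI[of _ 1])
  qed
  moreover have "((\<lambda>h. flat_exp n h / h) \<longlongrightarrow> 0) (at_left 0)"
  proof (rule Lim_transform_eventually)
    show "((\<lambda>h::real. 0::real) \<longlongrightarrow> 0) (at_left 0)" by simp
    show "\<forall>\<^sub>F h in at_left 0. 0 = flat_exp n h / h"
      unfolding eventually_at_left_field by (auto simp: flat_exp_def intro: exI[of _ "-1"])
  qed
  ultimately have "((\<lambda>h. flat_exp n h / h) \<longlongrightarrow> 0) (at 0)"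
    by (intro filterlim_split_at)
  with equal show ?thesis by (simp add: DERIV_def flat_exp_def)
qed

lemma Ck_flat_exp_compose:
  fixes u :: "'b::euclidean_space \<Rightarrow> real"
  assumes u: "\<And>k. Ck k E U u"
  shows "Ck k E U (\<lambda>x. flat_exp n (u x))"
proof (induction k arbitrary: n)
  case 0
  have "continuous_on UNIV (flat_exp n)"
    using flat_exp_has_derivative DERIV_isCont continuous_at_imp_continuous_on by blast
  then show ?case using u[of 0] by (auto intro: continuous_on_compose2)
next
  case (Suc k)
  obtain u' where u': "\<And>x. x \<in> U \<Longrightarrow> (u has_derivative u' x) (at x within U)" "\<And>v. v \<in> E \<Longrightarrow> Ck k E U (\<lambda>x. u' x v)"
    using u[of "Suc k"] by (rule Ck_SucE) blast
  show ?case
  proof (rule Ck_SucI)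
    fix x assume "x \<in> U"
    then show "((\<lambda>x. flat_exp n (u x)) has_derivative
        (\<lambda>v. u' x v * (flat_exp (n + 2) (u x) + (- real n) * flat_exp (n + 1) (u x)))) (at x within U)"
      using DERIV_compose_FDERIV[OF flat_exp_has_derivative u'(1)] by simp
  qed (intro Ck_mult Ck_add Ck_const u' Suc)
qed

text \<open>
  The function is \<open>e\<^sup>-\<^sup>1\<^sup>/\<^sup>u\<close> with \<open>u = r\<^sup>2 - \<bar>x - a\<bar>\<^sup>2\<close>, extended by zero to the region where \<open>u\<close> is not
  positive.
\<close>

lemma smooth_bump:
  fixes a :: "'b::euclidean_space"
  assumes r: "r > 0"
  obtains \<beta> :: "'b \<Rightarrow> real" where "\<And>E U. smooth_on E U \<beta>" "\<beta> a \<noteq> 0" "\<And>x. x \<notin> cball a r \<Longrightarrow> \<beta> x = 0"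
proof
  define \<beta> where "\<beta> x = flat_exp 0 (r\<^sup>2 + (-1) * ((x \<bullet> x) + (-2) * (x \<bullet> a) + a \<bullet> a))" for x
  have s: "Ck k E U (\<lambda>x. x \<bullet> x)" for k E and U :: "'b set"
  proof -
    have "Ck k E U (\<lambda>x. \<Sum>b\<in>Basis. (x \<bullet> b) * (x \<bullet> b))"
      by (intro Ck_sum Ck_mult Ck_bounded_linear bounded_linear_inner_left)
    then show ?thesis by (simp add: euclidean_inner[symmetric])
  qed
  show "smooth_on E U \<beta>" for E U
    unfolding smooth_on_def \<beta>_def
    by (intro allI Ck_flat_exp_compose Ck_add Ck_mult Ck_const s Ck_bounded_linear bounded_linear_inner_left)
  have \<beta>: "\<beta> x = flat_exp 0 (r\<^sup>2 - (dist a x)\<^sup>2)" for x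
    by (simp add: \<beta>_def dist_norm power2_norm_eq_inner inner_diff_left inner_diff_right inner_commute algebra_simps)
  show "\<beta> a \<noteq> 0" using r by (simp add: \<beta> flat_exp_def)
  show "\<beta> x = 0" if "x \<notin> cball a r" for x
  proof -
    have "r\<^sup>2 < (dist a x)\<^sup>2" using that r by (intro power_strict_mono) auto
    then show ?thesis by (simp add: \<beta> flat_exp_def)
  qed
qed

section \<open>Charts and the algebra of smooth functions\<close>

locale manifold =
  fixes M :: "('m::{t2_space,second_countable_topology}, 'b::euclidean_space) smooth_structure"
  assumes smooth_manifold: "smooth_manifold M"
begin

abbreviation "C \<equiv> smooth_functions M"
abbreviation "T \<equiv> tangent_space M"
abbreviation "VF \<equiv> vector_fields M"
abbreviation "E \<equiv> model_space M"

lemma subspace_E: "subspace E"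
  using smooth_manifold by (simp add: smooth_manifold_def)

lemma ex_chart: "\<exists>U \<phi>. (U, \<phi>) \<in> atlas M \<and> p \<in> U"
proof -
  have "p \<in> (\<Union>(U, \<phi>)\<in>atlas M. U)" using smooth_manifold by (simp add: smooth_manifold_def)
  then show ?thesis by auto
qed

lemma chart:
  assumes "(U, \<phi>) \<in> atlas M"
  shows "open U" "openin (top_of_set E) (\<phi> ` U)" "homeomorphism U (\<phi> ` U) \<phi> (inv_into U \<phi>)"
  using smooth_manifold assms by (auto simp: smooth_manifold_def)

lemma chart_inv: "(U, \<phi>) \<in> atlas M \<Longrightarrow> q \<in> U \<Longrightarrow> inv_into U \<phi> (\<phi> q) = q"
  using chart(3) homeomorphism_apply1 by blast

lemma chart_transition:
  "(U, \<phi>) \<in> atlas M \<Longrightarrow> (V, \<psi>) \<in> atlas M \<Longrightarrow> smooth_on E (\<phi> ` (U \<inter> V)) (\<psi> \<circ> inv_into U \<phi>)"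
  using smooth_manifold unfolding smooth_manifold_def by blast

lemma chart_image_open:
  assumes c: "(U, \<phi>) \<in> atlas M" and G: "open G"
  obtains S where "open S" "\<phi> ` (U \<inter> G) = E \<inter> S" "\<phi> ` U \<inter> S = \<phi> ` (U \<inter> G)"
proof -
  have "openin (top_of_set (\<phi> ` U)) (\<phi> ` (U \<inter> G))"
    by (rule homeomorphism_imp_open_map[OF chart(3)[OF c]]) (use G in auto)
  then have "openin (top_of_set E) (\<phi> ` (U \<inter> G))"
    using chart(2)[OF c] openin_trans by blast
  then obtain S where S: "open S" "\<phi> ` (U \<inter> G) = E \<inter> S" by (auto simp: openin_open)
  moreover have "\<phi> ` U \<subseteq> E" using chart(2)[OF c] by (auto dest: openin_imp_subset)
  then have "\<phi> ` U \<inter> S = \<phi> ` (U \<inter> G)" using S(2) by auto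
  ultimately show thesis by (rule that)
qed

lemma CI: "(\<And>U \<phi>. (U, \<phi>) \<in> atlas M \<Longrightarrow> smooth_on E (\<phi> ` U) (f \<circ> inv_into U \<phi>)) \<Longrightarrow> f \<in> C"
  by (auto simp: smooth_functions_def)

lemma CD: "f \<in> C \<Longrightarrow> (U, \<phi>) \<in> atlas M \<Longrightarrow> smooth_on E (\<phi> ` U) (f \<circ> inv_into U \<phi>)"
  by (auto simp: smooth_functions_def)

lemma C_const: "(\<lambda>p. c) \<in> C"
  by (rule CI) (simp add: smooth_on_def o_def Ck_const)

lemma C_add: "f \<in> C \<Longrightarrow> g \<in> C \<Longrightarrow> (\<lambda>p. f p + g p) \<in> C"
  by (rule CI) (auto dest!: CD simp: smooth_on_def o_def intro: Ck_add)

lemma C_mult: "f \<in> C \<Longrightarrow> g \<in> C \<Longrightarrow> (\<lambda>p. f p * g p) \<in> C"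
  by (rule CI) (auto dest!: CD simp: smooth_on_def o_def intro: Ck_mult)

lemma C_minus: "f \<in> C \<Longrightarrow> (\<lambda>p. - f p) \<in> C"
  using C_mult[OF C_const[of "-1"]] by simp

lemma C_diff: "f \<in> C \<Longrightarrow> g \<in> C \<Longrightarrow> (\<lambda>p. f p - g p) \<in> C"
  using C_add[OF _ C_minus] by simp

lemma C_sum: "(\<And>i. i \<in> I \<Longrightarrow> f i \<in> C) \<Longrightarrow> (\<lambda>p. \<Sum>i\<in>I. f i p) \<in> C"
  by (induction I rule: infinite_finite_induct) (auto intro: C_const C_add)

lemmas C_intros = C_const C_add C_mult C_minus C_diff C_sum

text \<open>
  Smoothness can be tested after multiplication by a smooth function that does not vanish at the
  point in question. In this form the local nature of smoothness can be used without charts.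
\<close>

lemma C_local_quotient:
  assumes "\<And>p. \<exists>s\<in>C. s p \<noteq> 0 \<and> (\<lambda>q. s q * h q) \<in> C"
  shows "h \<in> C"
proof (rule CI)
  fix U \<phi> assume c: "(U, \<phi>) \<in> atlas M"
  let ?i = "inv_into U \<phi>"
  show "smooth_on E (\<phi> ` U) (h \<circ> ?i)"
  proof (rule smooth_on_local[OF subspace_E chart(2)[OF c]])
    fix x assume x: "x \<in> \<phi> ` U"
    obtain s where s: "s \<in> C" "s (?i x) \<noteq> 0" "(\<lambda>q. s q * h q) \<in> C" using assms by blast
    have "continuous_on (\<phi> ` U) (s \<circ> ?i)"
      using CD[OF s(1) c] Ck.simps(1) unfolding smooth_on_def by blast
    then have "openin (top_of_set (\<phi> ` U)) (\<phi> ` U \<inter> (s \<circ> ?i) -` (- {0}))"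
      by (rule continuous_openin_preimage_gen) auto
    then obtain S where S: "open S" "\<phi> ` U \<inter> (s \<circ> ?i) -` (- {0}) = \<phi> ` U \<inter> S"
      by (auto simp: openin_open)
    have nz: "(s \<circ> ?i) y \<noteq> 0" if "y \<in> \<phi> ` U \<inter> S" for y using that S(2) by blast
    have "Ck k E (\<phi> ` U \<inter> S) (h \<circ> ?i)" for k
    proof (rule Ck_cong)
      show "Ck k E (\<phi> ` U \<inter> S) (\<lambda>y. ((\<lambda>q. s q * h q) \<circ> ?i) y * inverse ((s \<circ> ?i) y))"
        using CD[OF s(1) c] CD[OF s(3) c] nz unfolding smooth_on_def
        by (intro Ck_mult Ck_inverse) (blast intro: Ck_subset)+
    qed (use nz in auto)
    moreover have "x \<in> S" using S(2) x s(2) by auto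
    ultimately show "\<exists>S. open S \<and> x \<in> S \<and> smooth_on E (\<phi> ` U \<inter> S) (h \<circ> ?i)"
      using S(1) unfolding smooth_on_def by blast
  qed
qed

text \<open>
  Near a point of the set \<open>W\<close>, read in the chart, the function is a smooth function of the
  coordinates. All other points lie in the complement of the compact set that corresponds to \<open>K\<close>;
  this complement is open because the manifold is Hausdorff, and the function vanishes on it.
\<close>

lemma C_extend_by_zero:
  assumes c: "(U, \<phi>) \<in> atlas M" and W: "openin (top_of_set E) W" "W \<subseteq> \<phi> ` U"
    and h: "smooth_on E W h" and K: "compact K" "K \<subseteq> W" "\<And>x. x \<in> W - K \<Longrightarrow> h x = 0"
  shows "(\<lambda>q. if q \<in> U \<and> \<phi> q \<in> W then h (\<phi> q) else 0) \<in> C"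
proof (rule CI)
  let ?F = "\<lambda>q. if q \<in> U \<and> \<phi> q \<in> W then h (\<phi> q) else 0"
  let ?i = "inv_into U \<phi>"
  note hom = chart(3)[OF c]
  have WE: "W \<subseteq> E" using W(1) by (auto dest: openin_imp_subset)
  obtain B where B: "finite B" "B \<subseteq> E" "\<And>y. y \<in> E \<Longrightarrow> (\<Sum>b\<in>B. (y \<bullet> b) *\<^sub>R b) = y"
    using orthonormal_basis_expansion[OF subspace_E] by blast
  have iW: "?i ` W = {q \<in> U. \<phi> q \<in> W}"
    using W(2) chart_inv[OF c] by force
  have "openin (top_of_set (\<phi> ` U)) W"
    using W openin_subset_trans chart(2)[OF c] openin_imp_subset by metis
  then have "openin (top_of_set U) (?i ` W)"
    by (rule homeomorphism_imp_open_map[OF homeomorphism_symD[OF hom]])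
  then have opW: "open (?i ` W)" using chart(1)[OF c] openin_open_eq by blast
  have "continuous_on K ?i"
    using hom K(2) W(2) unfolding homeomorphism_def by (meson continuous_on_subset order_trans)
  then have clK: "closed (?i ` K)" using K(1) by (intro compact_imp_closed compact_continuous_image)
  fix V \<psi> assume d: "(V, \<psi>) \<in> atlas M"
  let ?j = "inv_into V \<psi>"
  show "smooth_on E (\<psi> ` V) (?F \<circ> ?j)"
  proof (rule smooth_on_local[OF subspace_E chart(2)[OF d]])
    fix x assume "x \<in> \<psi> ` V"
    then obtain q where q: "q \<in> V" "x = \<psi> q" by blast
    show "\<exists>S. open S \<and> x \<in> S \<and> smooth_on E (\<psi> ` V \<inter> S) (?F \<circ> ?j)"
    proof (cases "q \<in> ?i ` W")
      case True
      obtain S where S: "open S" "\<psi> ` (V \<inter> ?i ` W) = E \<inter> S" "\<psi> ` V \<inter> S = \<psi> ` (V \<inter> ?i ` W)"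
        using chart_image_open[OF d opW] by blast
      have "Ck k E (\<psi> ` V \<inter> S) (?F \<circ> ?j)" for k
      proof (rule Ck_cong)
        have "\<psi> ` (V \<inter> ?i ` W) \<subseteq> \<psi> ` (V \<inter> U)" unfolding iW by auto
        then have "Ck k E (\<psi> ` (V \<inter> ?i ` W)) (\<phi> \<circ> ?j)"
          using chart_transition[OF d c] Ck_subset unfolding smooth_on_def by blast
        moreover have "(\<phi> \<circ> ?j) ` \<psi> ` (V \<inter> ?i ` W) \<subseteq> W"
          unfolding iW using chart_inv[OF d] by auto
        ultimately show "Ck k E (\<psi> ` V \<inter> S) (h \<circ> (\<phi> \<circ> ?j))"
          unfolding S(3) using h unfolding smooth_on_def by (intro Ck_compose[OF B WE]) auto
        show "(h \<circ> (\<phi> \<circ> ?j)) y = (?F \<circ> ?j) y" if "y \<in> \<psi> ` V \<inter> S" for y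
          using that unfolding S(3) unfolding iW using chart_inv[OF d] by auto
      qed
      moreover have "x \<in> S" using S(2) q True by blast
      ultimately show ?thesis using S(1) unfolding smooth_on_def by blast
    next
      case False
      obtain S where S: "open S" "\<psi> ` (V \<inter> - ?i ` K) = E \<inter> S" "\<psi> ` V \<inter> S = \<psi> ` (V \<inter> - ?i ` K)"
        using chart_image_open[OF d, of "- ?i ` K"] clK by blast
      have "Ck k E (\<psi> ` V \<inter> S) (?F \<circ> ?j)" for k
      proof (rule Ck_cong[OF Ck_const])
        show "0 = (?F \<circ> ?j) y" if y: "y \<in> \<psi> ` V \<inter> S" for y
        proof -
          obtain r where r: "r \<in> V" "r \<notin> ?i ` K" "y = \<psi> r" using y unfolding S(3) by auto
          then have "\<phi> r \<notin> K" if "r \<in> U" using chart_inv[OF c that] by force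
          then show ?thesis using r K(3) chart_inv[OF d r(1)] by auto
        qed
      qed
      moreover have "x \<in> S" using S(2) q False K(2) by blast
      ultimately show ?thesis using S(1) unfolding smooth_on_def by blast
    qed
  qed
qed

section \<open>Tangent vectors, vector fields and local frames\<close>

lemma T_zero_outside: "v \<in> T p \<Longrightarrow> f \<notin> C \<Longrightarrow> v f = 0"
  by (auto simp: tangent_space_def)

lemma T_add: "v \<in> T p \<Longrightarrow> f \<in> C \<Longrightarrow> g \<in> C \<Longrightarrow> v (\<lambda>q. f q + g q) = v f + v g"
  by (auto simp: tangent_space_def)

lemma T_mult: "v \<in> T p \<Longrightarrow> f \<in> C \<Longrightarrow> g \<in> C \<Longrightarrow> v (\<lambda>q. f q * g q) = f p * v g + g p * v f"
  by (auto simp: tangent_space_def)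

lemma T_cmult: "v \<in> T p \<Longrightarrow> f \<in> C \<Longrightarrow> v (\<lambda>q. c * f q) = c * v f"
  by (auto simp: tangent_space_def)

lemma T_zero: "v \<in> T p \<Longrightarrow> v (\<lambda>q. 0) = 0"
  using T_cmult[OF _ C_const[of 0], of v p 0] by simp

lemma T_const: "v \<in> T p \<Longrightarrow> v (\<lambda>q. c) = 0"
  using T_mult[OF _ C_const[of 1] C_const[of 1], of v p] T_cmult[OF _ C_const[of 1], of v p c] by simp

lemma T_minus: "v \<in> T p \<Longrightarrow> f \<in> C \<Longrightarrow> v (\<lambda>q. - f q) = - v f"
  using T_cmult[of v p f "-1"] by simp

lemma T_diff: "v \<in> T p \<Longrightarrow> f \<in> C \<Longrightarrow> g \<in> C \<Longrightarrow> v (\<lambda>q. f q - g q) = v f - v g"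
  using T_add[of v p f "\<lambda>q. - g q"] T_minus[of v p g] by (auto intro: C_minus)

lemma T_sum: "v \<in> T p \<Longrightarrow> (\<And>i. i \<in> I \<Longrightarrow> f i \<in> C) \<Longrightarrow> v (\<lambda>q. \<Sum>i\<in>I. f i q) = (\<Sum>i\<in>I. v (f i))"
proof (induction I rule: infinite_finite_induct)
  case (insert x F)
  then show ?case using T_add[of v p "f x" "\<lambda>q. \<Sum>i\<in>F. f i q"] by (simp add: C_sum)
qed (auto simp: T_zero)

lemma TI:
  assumes "\<And>f. f \<notin> C \<Longrightarrow> v f = 0" "\<And>f g. f \<in> C \<Longrightarrow> g \<in> C \<Longrightarrow> v (\<lambda>q. f q + g q) = v f + v g"
    "\<And>f g. f \<in> C \<Longrightarrow> g \<in> C \<Longrightarrow> v (\<lambda>q. f q * g q) = f p * v g + g p * v f"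
    "\<And>c f. f \<in> C \<Longrightarrow> v (\<lambda>q. c * f q) = c * v f"
  shows "v \<in> T p"
  using assms by (auto simp: tangent_space_def)

lemma T_plus: "v \<in> T p \<Longrightarrow> w \<in> T p \<Longrightarrow> v + w \<in> T p"
  by (auto intro!: TI simp: T_zero_outside T_add T_mult T_cmult algebra_simps)

lemma T_scale: "v \<in> T p \<Longrightarrow> (\<lambda>f. c * v f) \<in> T p"
  by (auto intro!: TI simp: T_zero_outside T_add T_mult T_cmult algebra_simps)

lemma T_0: "(\<lambda>f. 0) \<in> T p"
  by (auto intro!: TI)

lemma T_uminus: "v \<in> T p \<Longrightarrow> - v \<in> T p"
  using T_scale[of v p "-1"] by (simp add: fun_Compl_def)

lemma VFI: "(\<And>p. X p \<in> T p) \<Longrightarrow> (\<And>f. f \<in> C \<Longrightarrow> (\<lambda>p. X p f) \<in> C) \<Longrightarrow> X \<in> VF"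
  by (auto simp: vector_fields_def)

lemma VF_T: "X \<in> VF \<Longrightarrow> X p \<in> T p"
  by (auto simp: vector_fields_def)

lemma VF_C: "X \<in> VF \<Longrightarrow> (\<lambda>p. X p f) \<in> C"
  using T_zero_outside[OF VF_T, of X f] by (cases "f \<in> C") (auto simp: vector_fields_def C_const)

definition smul :: "('m \<Rightarrow> real) \<Rightarrow> 'm vector_field \<Rightarrow> 'm vector_field" where
  "smul f X = (\<lambda>p g. f p * X p g)"

lemma VF_add: "X \<in> VF \<Longrightarrow> Y \<in> VF \<Longrightarrow> X + Y \<in> VF"
  by (rule VFI) (auto intro: T_plus VF_T C_add VF_C)

lemma VF_smul: "f \<in> C \<Longrightarrow> X \<in> VF \<Longrightarrow> smul f X \<in> VF"
  unfolding smul_def by (rule VFI) (auto intro: T_scale VF_T C_mult VF_C)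

lemma VF_0: "0 \<in> VF"
  by (rule VFI) (auto simp: zero_fun_def intro: T_0 C_const)

lemma VF_uminus: "X \<in> VF \<Longrightarrow> - X \<in> VF"
  by (rule VFI) (auto intro: T_uminus VF_T C_minus VF_C)

lemma VF_diff: "X \<in> VF \<Longrightarrow> Y \<in> VF \<Longrightarrow> X - Y \<in> VF"
  using VF_add[OF _ VF_uminus] by (metis diff_conv_add_uminus)

lemma VF_sum: "(\<And>i. i \<in> I \<Longrightarrow> X i \<in> VF) \<Longrightarrow> (\<Sum>i\<in>I. X i) \<in> VF"
  by (induction I rule: infinite_finite_induct) (auto intro: VF_0 VF_add)

lemma sum_field_apply: "(\<Sum>i\<in>I. X i) p g = (\<Sum>i\<in>I. (X i :: 'm vector_field) p g)"
  by (induction I rule: infinite_finite_induct) auto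

text \<open>
  Let \<open>\<beta>\<close> be a bump function around \<open>p\<close>, supported in a chart with coordinates \<open>x\<^sub>b\<close>. For a tangent
  vector \<open>v\<close> at \<open>q\<close>, Hadamard's lemma writes \<open>\<beta>\<^sup>2 f\<close> as \<open>\<beta>\<^sup>2 f(q) + \<Sum>\<^sub>b (\<beta> x\<^sub>b - x\<^sub>b(q) \<beta>) (\<beta> h\<^sub>b)\<close>, an identity
  between globally defined smooth functions. Applying \<open>v\<close> expresses \<open>\<beta>(q)\<^sup>2 v(f)\<close> through the numbers
  \<open>v(\<beta> x\<^sub>b)\<close> and \<open>v(\<beta>)\<close> and the partial derivatives of \<open>f\<close> at \<open>q\<close>. The index \<open>Some b\<close> belongs to the
  function \<open>\<beta> x\<^sub>b\<close> and the field \<open>\<beta>\<^sup>2 \<partial>\<^sub>b\<close>. A second bump function, equal to 1 on the support of \<open>\<beta>\<close>, would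
  remove the terms with \<open>v(\<beta>)\<close>; here they are kept under the additional index \<open>None\<close>.
\<close>

lemma local_frame:
  obtains \<rho> and I :: "'b option set" and g X where
    "\<rho> \<in> C" "\<rho> p \<noteq> 0" "finite I" "\<forall>i\<in>I. g i \<in> C \<and> X i \<in> VF"
    "\<forall>q f. \<forall>v\<in>T q. \<rho> q * v f = (\<Sum>i\<in>I. v (g i) * X i q f)"
proof -
  obtain U \<phi> where c: "(U, \<phi>) \<in> atlas M" and pU: "p \<in> U" using ex_chart by blast
  let ?i = "inv_into U \<phi>"
  obtain B where B: "finite B" "B \<subseteq> E" "\<And>y. y \<in> E \<Longrightarrow> (\<Sum>b\<in>B. (y \<bullet> b) *\<^sub>R b) = y"
    using orthonormal_basis_expansion[OF subspace_E] by blast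
  obtain S where S: "open S" "\<phi> ` U = E \<inter> S" using chart(2)[OF c] by (auto simp: openin_open)
  then obtain r where r: "r > 0" "cball (\<phi> p) r \<subseteq> S"
    using pU by (metis IntE imageI open_contains_cball)
  define W where "W = E \<inter> ball (\<phi> p) r"
  define K where "K = E \<inter> cball (\<phi> p) (r / 2)"
  have W: "openin (top_of_set E) W" "W \<subseteq> \<phi> ` U" "convex W"
    using r(2) S(2) subspace_imp_convex[OF subspace_E]
    by (auto simp: W_def openin_open intro!: convex_Int)
  have K: "compact K" "K \<subseteq> W"
    using r(1) closed_subspace[OF subspace_E] by (auto simp: K_def W_def intro: closed_Int_compact)
  obtain \<beta> :: "'b \<Rightarrow> real" where \<beta>: "\<And>E U. smooth_on E U \<beta>" "\<beta> (\<phi> p) \<noteq> 0"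
      "\<And>x. x \<notin> cball (\<phi> p) (r / 2) \<Longrightarrow> \<beta> x = 0"
    using smooth_bump[of "r / 2" "\<phi> p"] r(1) by auto
  define ext where "ext h q = (if q \<in> U \<and> \<phi> q \<in> W then \<beta> (\<phi> q) * h (\<phi> q) else (0::real))" for h q
  have ext: "ext h \<in> C" if "smooth_on E W h" for h
    unfolding ext_def
    by (rule C_extend_by_zero[OF c W(1,2) smooth_on_mult[OF \<beta>(1) that] K]) (auto simp: K_def W_def \<beta>(3))
  let ?D = "\<lambda>f q. frechet_derivative (f \<circ> ?i) (at (\<phi> q) within W)"
  have sm: "smooth_on E W (f \<circ> ?i)" if "f \<in> C" for f
    using CD[OF that c] W(2) by (rule smooth_on_subset)
  have D: "(f \<circ> ?i has_derivative ?D f q) (at (\<phi> q) within W)" if "f \<in> C" "\<phi> q \<in> W" for f q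
    using smooth_on_derivative[OF sm] that by blast
  have D_eq: "?D f q b = f' b" if "f \<in> C" "\<phi> q \<in> W" "b \<in> E" "(f \<circ> ?i has_derivative f') (at (\<phi> q) within W)" for f q b f'
    using has_derivative_in_subspace_unique[OF subspace_E W(1) that(2,3) D[OF that(1,2)] that(4)] .
  define dd where "dd b q f = (if f \<in> C \<and> q \<in> U \<and> \<phi> q \<in> W then \<beta> (\<phi> q) * ?D f q b else 0)" for b q f
  have dd: "dd b \<in> VF" if b: "b \<in> E" for b
  proof (rule VFI)
    fix q
    show "dd b q \<in> T q"
    proof (cases "q \<in> U \<and> \<phi> q \<in> W")
      case False then show ?thesis by (intro TI) (auto simp: dd_def)
    next
      case True
      note i = chart_inv[OF c conjunct1[OF True]]
      have add: "?D (\<lambda>q. f q + g q) q b = ?D f q b + ?D g q b" if "f \<in> C" "g \<in> C" for f g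
        using D_eq[of "\<lambda>p. f p + g p" q b "\<lambda>v. ?D f q v + ?D g q v"] True
          has_derivative_add[OF D[of f q] D[of g q]] that b by (auto simp: o_def C_intros)
      have mult: "?D (\<lambda>q. f q * g q) q b = f q * ?D g q b + ?D f q b * g q" if "f \<in> C" "g \<in> C" for f g
        using D_eq[of "\<lambda>p. f p * g p" q b "\<lambda>v. f q * ?D g q v + ?D f q v * g q"] True
          has_derivative_mult[OF D[of f q] D[of g q]] that i b by (auto simp: o_def C_mult)
      have cmult: "?D (\<lambda>q. k * f q) q b = k * ?D f q b" if "f \<in> C" for f k
        using D_eq[of "\<lambda>p. k * f p" q b "\<lambda>v. k * ?D f q v"] True
          has_derivative_mult_right[OF D[of f q], of k] that b by (auto simp: o_def C_intros)
      show ?thesis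
      proof (rule TI)
        show "dd b q (\<lambda>q. f q + g q) = dd b q f + dd b q g" if "f \<in> C" "g \<in> C" for f g
          using True that add[OF that] by (simp only: dd_def C_add simp_thms if_True distrib_left)
        show "dd b q (\<lambda>q. f q * g q) = f q * dd b q g + g q * dd b q f" if "f \<in> C" "g \<in> C" for f g
          using True that mult[OF that] by (simp only: dd_def C_mult simp_thms if_True) (simp add: algebra_simps)
        show "dd b q (\<lambda>q. k * f q) = k * dd b q f" if "f \<in> C" for f k
          using True that cmult[OF that] by (simp only: dd_def C_mult C_const simp_thms if_True) simp
      qed (simp add: dd_def)
    qed
    fix f assume f: "f \<in> C"
    have "(\<lambda>q. dd b q f) = ext (\<lambda>y. frechet_derivative (f \<circ> ?i) (at y within W) b)"
      using f by (auto simp: ext_def dd_def)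
    then show "(\<lambda>q. dd b q f) \<in> C"
      using ext[OF smooth_on_directional_derivative[OF subspace_E W(1) sm[OF f] b]] by simp
  qed
  define \<beta>M where "\<beta>M = ext (\<lambda>x. 1)"
  define xM where "xM b = ext (\<lambda>x. x \<bullet> b)" for b
  have \<beta>M: "\<beta>M \<in> C" unfolding \<beta>M_def by (rule ext) (simp add: smooth_on_def Ck_const)
  have xM: "xM b \<in> C" for b
    unfolding xM_def by (rule ext) (simp add: smooth_on_def Ck_bounded_linear bounded_linear_inner_left)
  \<comment> \<open>Here \<open>\<beta>M\<close> is \<open>\<beta>\<close>, \<open>xM b\<close> is \<open>\<beta> x\<^sub>b\<close> and \<open>dd b\<close> is \<open>\<beta> \<partial>\<^sub>b\<close>, all on the manifold; a third factor \<open>\<beta>\<close>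
    turns the coefficient \<open>x\<^sub>b(q)\<close> into a value of the globally defined function \<open>\<beta> x\<^sub>b\<close>.\<close>
  have key: "\<beta>M q ^ 3 * v f = (\<Sum>b\<in>B. v (xM b) * (\<beta>M q * dd b q f)) - v \<beta>M * (\<Sum>b\<in>B. xM b q * dd b q f)"
    if v: "v \<in> T q" for q v f
  proof (cases "f \<in> C \<and> q \<in> U \<and> \<phi> q \<in> W")
    case False then show ?thesis
      using v by (auto simp: T_zero_outside dd_def \<beta>M_def ext_def)
  next
    case True
    then have f: "f \<in> C" and q: "q \<in> U" "\<phi> q \<in> W" by auto
    obtain h where h: "\<forall>b\<in>B. smooth_on E W (h b)" "\<forall>b. h b (\<phi> q) = ?D f q b"
      "\<forall>y\<in>W. (f \<circ> ?i) y - (f \<circ> ?i) (\<phi> q) = (\<Sum>b\<in>B. (y \<bullet> b - \<phi> q \<bullet> b) * h b y)"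
      by (rule hadamard[OF subspace_E B W(3,1) q(2) sm[OF f]])
    have hC: "ext (h b) \<in> C" if "b \<in> B" for b using ext h(1) that by blast
    have "(\<lambda>r. (\<beta>M r * \<beta>M r) * f r)
        = (\<lambda>r. f q * (\<beta>M r * \<beta>M r) + (\<Sum>b\<in>B. (xM b r - (\<phi> q \<bullet> b) * \<beta>M r) * ext (h b) r))"
    proof
      fix r
      show "(\<beta>M r * \<beta>M r) * f r = f q * (\<beta>M r * \<beta>M r) + (\<Sum>b\<in>B. (xM b r - (\<phi> q \<bullet> b) * \<beta>M r) * ext (h b) r)"
      proof (cases "r \<in> U \<and> \<phi> r \<in> W")
        case False then show ?thesis by (auto simp: \<beta>M_def xM_def ext_def)
      next
        case True
        have "f r = f q + (\<Sum>b\<in>B. (\<phi> r \<bullet> b - \<phi> q \<bullet> b) * h b (\<phi> r))"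
          using h(3)[THEN bspec, of "\<phi> r"] True q chart_inv[OF c] by simp
        then show ?thesis
          using True by (simp add: \<beta>M_def xM_def ext_def sum_distrib_left algebra_simps)
      qed
    qed
    then have "v (\<lambda>r. (\<beta>M r * \<beta>M r) * f r)
        = v (\<lambda>r. f q * (\<beta>M r * \<beta>M r) + (\<Sum>b\<in>B. (xM b r - (\<phi> q \<bullet> b) * \<beta>M r) * ext (h b) r))" by simp
    also have "\<dots> = f q * v (\<lambda>r. \<beta>M r * \<beta>M r)
        + (\<Sum>b\<in>B. (xM b q - (\<phi> q \<bullet> b) * \<beta>M q) * v (ext (h b)) + ext (h b) q * (v (xM b) - (\<phi> q \<bullet> b) * v \<beta>M))"
      using v hC xM \<beta>M
      by (simp add: T_add[OF v] T_sum[OF v] T_mult[OF v] T_cmult[OF v] T_diff[OF v] T_const[OF v] C_intros)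
    also have "\<dots> = f q * v (\<lambda>r. \<beta>M r * \<beta>M r)
        + (\<Sum>b\<in>B. dd b q f * (v (xM b) - (\<phi> q \<bullet> b) * v \<beta>M))"
      using q f by (simp add: xM_def \<beta>M_def ext_def dd_def h(2))
    finally have "\<beta>M q * \<beta>M q * v f = (\<Sum>b\<in>B. dd b q f * (v (xM b) - (\<phi> q \<bullet> b) * v \<beta>M))"
      by (simp add: T_mult[OF v] C_mult \<beta>M f)
    then have "\<beta>M q ^ 3 * v f = \<beta>M q * (\<Sum>b\<in>B. dd b q f * (v (xM b) - (\<phi> q \<bullet> b) * v \<beta>M))"
      by (simp add: power3_eq_cube)
    moreover have "xM b q = (\<phi> q \<bullet> b) * \<beta>M q" for b using q by (simp add: xM_def \<beta>M_def ext_def)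
    ultimately show ?thesis
      by (simp add: sum_distrib_left sum_subtractf algebra_simps)
  qed
  define g where "g i = (case i of None \<Rightarrow> \<beta>M | Some b \<Rightarrow> xM b)" for i
  define X where "X i = (case i of None \<Rightarrow> - (\<Sum>b\<in>B. smul (xM b) (dd b)) | Some b \<Rightarrow> smul \<beta>M (dd b))" for i
  show thesis
  proof (rule that; (intro ballI allI conjI)?)
    show "(\<lambda>q. \<beta>M q ^ 3) \<in> C" unfolding power3_eq_cube by (intro C_mult \<beta>M)
    show "\<beta>M p ^ 3 \<noteq> 0" using pU W S(2) r(1) \<beta>(2) by (auto simp: \<beta>M_def ext_def W_def)
    show "finite (insert None (Some ` B))" using B(1) by simp
    show "g i \<in> C" for i by (cases i) (auto simp: g_def \<beta>M xM)
    show "X i \<in> VF" if "i \<in> insert None (Some ` B)" for i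
      using that B(2) unfolding X_def by (auto intro!: VF_uminus VF_sum VF_smul \<beta>M xM dd split: option.split)
    show "\<beta>M q ^ 3 * v f = (\<Sum>i\<in>insert None (Some ` B). v (g i) * X i q f)" if "v \<in> T q" for q v f
      using key[OF that, of f] B(1)
      by (simp add: sum.reindex g_def X_def smul_def sum_field_apply)
  qed
qed

section \<open>The Lie algebra of vector fields\<close>

text \<open>
  Functions, vector fields and maps on lists of vector fields are added and multiplied as elements
  of rings and modules; unfolding these operations at a point would destroy this structure.
\<close>

declare plus_fun_apply [simp del] times_fun_apply [simp del] minus_apply [simp del] uminus_apply [simp del] zero_fun_apply [simp del]

lemmas fun_apply = plus_fun_apply times_fun_apply minus_apply uminus_apply zero_fun_apply

lemma form_apply [simp]:
  fixes \<omega> \<eta> :: "'m vector_field list \<Rightarrow> 'm \<Rightarrow> real"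
  shows "(\<omega> + \<eta>) Xs = \<omega> Xs + \<eta> Xs" "(\<omega> - \<eta>) Xs = \<omega> Xs - \<eta> Xs"
    "(- \<omega>) Xs = - \<omega> Xs" "(0 :: 'm vector_field list \<Rightarrow> 'm \<Rightarrow> real) Xs = 0"
  by (simp_all only: fun_apply)

definition act :: "'m vector_field \<Rightarrow> ('m \<Rightarrow> real) \<Rightarrow> 'm \<Rightarrow> real" where
  "act X f = (\<lambda>p. X p f)"

lemma field_eqI: "(\<And>f. act X f = act Y f) \<Longrightarrow> X = Y"
  unfolding act_def by (metis ext)

lemma act_C: "X \<in> VF \<Longrightarrow> act X f \<in> C"
  unfolding act_def by (rule VF_C)

lemma C_plus: "f \<in> C \<Longrightarrow> g \<in> C \<Longrightarrow> f + g \<in> C"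
  using C_add by (simp add: plus_fun_def)

lemma C_times: "f \<in> C \<Longrightarrow> g \<in> C \<Longrightarrow> f * g \<in> C"
  using C_mult by (simp add: times_fun_def)

lemma C_uminus: "f \<in> C \<Longrightarrow> - f \<in> C"
  using C_minus by (simp add: fun_Compl_def)

lemma C_subtract: "f \<in> C \<Longrightarrow> g \<in> C \<Longrightarrow> f - g \<in> C"
  using C_diff by (simp add: fun_diff_def)

lemma C_0: "0 \<in> C"
  using C_const by (simp add: zero_fun_def)

lemmas C_closed = C_plus C_times C_uminus C_subtract C_0 act_C

lemma act_plus: "X \<in> VF \<Longrightarrow> f \<in> C \<Longrightarrow> g \<in> C \<Longrightarrow> act X (f + g) = act X f + act X g"
  by (auto simp: act_def plus_fun_def T_add[OF VF_T])

lemma act_times: "X \<in> VF \<Longrightarrow> f \<in> C \<Longrightarrow> g \<in> C \<Longrightarrow> act X (f * g) = f * act X g + g * act X f"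
  by (auto simp: act_def plus_fun_def times_fun_def T_mult[OF VF_T])

lemma act_subtract: "X \<in> VF \<Longrightarrow> f \<in> C \<Longrightarrow> g \<in> C \<Longrightarrow> act X (f - g) = act X f - act X g"
  by (auto simp: act_def fun_diff_def T_diff[OF VF_T])

lemma act_field_plus: "act (X + Y) f = act X f + act Y f"
  and act_field_uminus: "act (- X) f = - act X f"
  and act_field_diff: "act (X - Y) f = act X f - act Y f"
  and act_smul: "act (smul g X) f = g * act X f"
  and act_bracket: "act (lie_bracket X Y) f = act X (act Y f) - act Y (act X f)"
  by (simp_all add: act_def smul_def lie_bracket_def fun_eq_iff fun_apply)

lemma bracket_VF:
  assumes X: "X \<in> VF" and Y: "Y \<in> VF"
  shows "lie_bracket X Y \<in> VF"
proof (rule VFI)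
  fix p
  note CC = VF_C[OF X] VF_C[OF Y]
  note T = VF_T[OF X, of p] VF_T[OF Y, of p]
  show "lie_bracket X Y p \<in> T p"
  proof (rule TI)
    show "lie_bracket X Y p f = 0" if "f \<notin> C" for f
      using T_zero_outside[OF VF_T[OF X] that] T_zero_outside[OF VF_T[OF Y] that] T[THEN T_zero]
      by (simp add: lie_bracket_def)
    show "lie_bracket X Y p (\<lambda>q. f q + g q) = lie_bracket X Y p f + lie_bracket X Y p g"
      if "f \<in> C" "g \<in> C" for f g
      using that by (simp add: lie_bracket_def T_add[OF VF_T[OF X]] T_add[OF VF_T[OF Y]] CC)
    show "lie_bracket X Y p (\<lambda>q. f q * g q) = f p * lie_bracket X Y p g + g p * lie_bracket X Y p f"
      if "f \<in> C" "g \<in> C" for f g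
      using that
      by (simp add: lie_bracket_def T_mult[OF VF_T[OF X]] T_mult[OF VF_T[OF Y]]
          T_add[OF VF_T[OF X]] T_add[OF VF_T[OF Y]] CC C_mult algebra_simps)
    show "lie_bracket X Y p (\<lambda>q. c * f q) = c * lie_bracket X Y p f" if "f \<in> C" for f c
      using that by (simp add: lie_bracket_def T_cmult[OF VF_T[OF X]] T_cmult[OF VF_T[OF Y]] CC algebra_simps)
  qed
next
  fix f
  have "act X (act Y f) - act Y (act X f) \<in> C" using X Y by (intro C_closed)
  then show "(\<lambda>p. lie_bracket X Y p f) \<in> C" using act_bracket[of X Y f] by (simp add: act_def)
qed

lemmas VF_closed = VF_add VF_diff VF_uminus VF_0 VF_smul bracket_VF

lemma bracket_plus_right:
  "X \<in> VF \<Longrightarrow> Y \<in> VF \<Longrightarrow> Z \<in> VF \<Longrightarrow> lie_bracket X (Y + Z) = lie_bracket X Y + lie_bracket X Z"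
  by (rule field_eqI) (simp add: act_bracket act_field_plus act_plus act_C)

lemma bracket_plus_left:
  "X \<in> VF \<Longrightarrow> Y \<in> VF \<Longrightarrow> Z \<in> VF \<Longrightarrow> lie_bracket (X + Y) Z = lie_bracket X Z + lie_bracket Y Z"
  by (rule field_eqI) (simp add: act_bracket act_field_plus act_plus act_C)

lemma bracket_skew: "lie_bracket X Y = - lie_bracket Y X" for X Y :: "'m vector_field"
  by (rule field_eqI) (simp add: act_bracket act_field_uminus)

lemma bracket_smul_right:
  "X \<in> VF \<Longrightarrow> Y \<in> VF \<Longrightarrow> f \<in> C \<Longrightarrow> lie_bracket X (smul f Y) = smul f (lie_bracket X Y) + smul (act X f) Y"
  by (rule field_eqI) (simp add: act_bracket act_field_plus act_smul act_times act_C algebra_simps)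

lemma jacobi:
  "X \<in> VF \<Longrightarrow> Y \<in> VF \<Longrightarrow> Z \<in> VF \<Longrightarrow>
    lie_bracket (lie_bracket X Y) Z = lie_bracket X (lie_bracket Y Z) - lie_bracket Y (lie_bracket X Z)"
  by (rule field_eqI) (simp add: act_bracket act_field_diff act_subtract act_C)

section \<open>Alternating multilinear maps and their derivations\<close>

text \<open>
  The contraction \<open>\<iota>\<^sub>X\<close>.
\<close>

definition ins :: "'m vector_field \<Rightarrow> ('m vector_field list \<Rightarrow> 'm \<Rightarrow> real) \<Rightarrow> 'm vector_field list \<Rightarrow> 'm \<Rightarrow> real" where
  "ins X \<omega> = (\<lambda>Xs. \<omega> (X # Xs))"

lemma ins_plus [simp]: "ins X (\<omega> + \<eta>) = ins X \<omega> + ins X \<eta>"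
  and ins_0 [simp]: "ins X 0 = 0"
  by (simp_all add: ins_def fun_eq_iff)

text \<open>
  Linearity over the smooth functions is required in the first argument only, and the alternating
  property for the first two. Requiring this after any initial segment of arguments has been fixed
  gives all alternating multilinear maps, and proofs by recursion on the list never have to look
  beyond its first two elements.
\<close>

definition front :: "('m vector_field list \<Rightarrow> 'm \<Rightarrow> real) \<Rightarrow> bool" where
  "front \<omega> \<longleftrightarrow> (\<forall>Xs\<in>lists VF. \<omega> Xs \<in> C) \<and>
     (\<forall>X\<in>VF. \<forall>Zs\<in>lists VF.
        (\<forall>Y\<in>VF. \<omega> ((X + Y) # Zs) = \<omega> (X # Zs) + \<omega> (Y # Zs)) \<and>
        (\<forall>f\<in>C. \<omega> (smul f X # Zs) = f * \<omega> (X # Zs)) \<and>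
        \<omega> (X # X # Zs) = 0)"

definition alt :: "('m vector_field list \<Rightarrow> 'm \<Rightarrow> real) \<Rightarrow> bool" where
  "alt \<omega> \<longleftrightarrow> (\<forall>Ys\<in>lists VF. front (\<lambda>Xs. \<omega> (Ys @ Xs)))"

lemma front_cong: "front \<omega> \<Longrightarrow> (\<And>Xs. Xs \<in> lists VF \<Longrightarrow> \<omega> Xs = \<eta> Xs) \<Longrightarrow> front \<eta>"
  unfolding front_def by (simp add: VF_closed)

lemma alt_cong:
  assumes "alt \<omega>" "\<And>Xs. Xs \<in> lists VF \<Longrightarrow> \<omega> Xs = \<eta> Xs"
  shows "alt \<eta>"
  unfolding alt_def
proof
  fix Ys assume Ys: "Ys \<in> lists VF"
  have "front (\<lambda>Xs. \<omega> (Ys @ Xs))" using assms(1) Ys unfolding alt_def by blast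
  then show "front (\<lambda>Xs. \<eta> (Ys @ Xs))"
    by (rule front_cong) (use Ys in \<open>simp add: assms(2)\<close>)
qed

lemma altD: "alt \<omega> \<Longrightarrow> Ys \<in> lists VF \<Longrightarrow> front (\<lambda>Xs. \<omega> (Ys @ Xs))"
  unfolding alt_def by blast

lemma altI: "(\<And>Ys. Ys \<in> lists VF \<Longrightarrow> front (\<lambda>Xs. \<omega> (Ys @ Xs))) \<Longrightarrow> alt \<omega>"
  unfolding alt_def by blast

lemma front_plus: "front \<omega> \<Longrightarrow> front \<eta> \<Longrightarrow> front (\<omega> + \<eta>)"
  unfolding front_def by (simp add: C_closed algebra_simps)

lemma front_uminus: "front \<omega> \<Longrightarrow> front (- \<omega>)"
  unfolding front_def by (simp add: C_closed algebra_simps)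

lemma front_diff: "front \<omega> \<Longrightarrow> front \<eta> \<Longrightarrow> front (\<omega> - \<eta>)"
  using front_plus[OF _ front_uminus] by (metis diff_conv_add_uminus)

lemma alt_front: "alt \<omega> \<Longrightarrow> front \<omega>"
  using altD[of \<omega> "[]"] by simp

lemma alt_ins: "alt \<omega> \<Longrightarrow> X \<in> VF \<Longrightarrow> alt (ins X \<omega>)"
  using altD[of \<omega> "X # _"] by (intro altI) (simp add: ins_def)

lemma alt_plus: "alt \<omega> \<Longrightarrow> alt \<eta> \<Longrightarrow> alt (\<omega> + \<eta>)"
  using front_plus[OF altD altD] by (intro altI) (simp add: plus_fun_def)

lemma alt_uminus: "alt \<omega> \<Longrightarrow> alt (- \<omega>)"
  using front_uminus[OF altD] by (intro altI) (simp add: fun_Compl_def)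

lemma alt_C: "alt \<omega> \<Longrightarrow> Xs \<in> lists VF \<Longrightarrow> \<omega> Xs \<in> C"
  using alt_front unfolding front_def by blast

lemma alt_add: "alt \<omega> \<Longrightarrow> X \<in> VF \<Longrightarrow> Y \<in> VF \<Longrightarrow> Zs \<in> lists VF \<Longrightarrow> \<omega> ((X + Y) # Zs) = \<omega> (X # Zs) + \<omega> (Y # Zs)"
  using alt_front unfolding front_def by blast

lemma alt_smul: "alt \<omega> \<Longrightarrow> X \<in> VF \<Longrightarrow> f \<in> C \<Longrightarrow> Zs \<in> lists VF \<Longrightarrow> \<omega> (smul f X # Zs) = f * \<omega> (X # Zs)"
  using alt_front unfolding front_def by blast

lemma alt_eq: "alt \<omega> \<Longrightarrow> X \<in> VF \<Longrightarrow> Zs \<in> lists VF \<Longrightarrow> \<omega> (X # X # Zs) = 0"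
  using alt_front unfolding front_def by blast

lemma alt_uminus_arg:
  assumes "alt \<omega>" "X \<in> VF" "Zs \<in> lists VF"
  shows "\<omega> (- X # Zs) = - \<omega> (X # Zs)"
proof -
  have "- X = smul (\<lambda>p. -1) X" by (rule field_eqI) (simp add: act_smul act_field_uminus fun_eq_iff fun_apply)
  moreover have "(\<lambda>p. - 1) * f = - f" for f :: "'m \<Rightarrow> real" by (simp add: fun_eq_iff fun_apply)
  ultimately show ?thesis using alt_smul[OF assms(1,2) C_const[of "-1"] assms(3)] by simp
qed

lemma alt_diff_arg:
  "alt \<omega> \<Longrightarrow> X \<in> VF \<Longrightarrow> Y \<in> VF \<Longrightarrow> Zs \<in> lists VF \<Longrightarrow> \<omega> ((X - Y) # Zs) = \<omega> (X # Zs) - \<omega> (Y # Zs)"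
  using alt_add[of \<omega> X "- Y" Zs] alt_uminus_arg[of \<omega> Y Zs] by (simp add: VF_closed)

lemma alt_0_arg: "alt \<omega> \<Longrightarrow> Zs \<in> lists VF \<Longrightarrow> \<omega> (0 # Zs) = 0"
  using alt_diff_arg[of \<omega> 0 0 Zs] by (simp add: VF_closed)

lemma alt_swap:
  assumes \<omega>: "alt \<omega>" and X: "X \<in> VF" and Y: "Y \<in> VF" and Zs: "Zs \<in> lists VF"
  shows "\<omega> (X # Y # Zs) = - \<omega> (Y # X # Zs)"
proof -
  have i: "\<omega> (Z # (X + Y) # Zs) = \<omega> (Z # X # Zs) + \<omega> (Z # Y # Zs)" if "Z \<in> VF" for Z
    using alt_add[OF alt_ins[OF \<omega> that] X Y Zs] by (simp add: ins_def)
  have "0 = \<omega> ((X + Y) # (X + Y) # Zs)" using alt_eq[OF \<omega>, of "X + Y" Zs] X Y Zs by (simp add: VF_closed)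
  also have "\<dots> = \<omega> (X # Y # Zs) + \<omega> (Y # X # Zs)"
    using X Y Zs by (simp add: alt_add[OF \<omega>] VF_closed i alt_eq[OF \<omega> X] alt_eq[OF \<omega> Y])
  finally have "\<omega> (X # Y # Zs) + \<omega> (Y # X # Zs) = 0" by (rule sym)
  then show ?thesis by (simp add: eq_neg_iff_add_eq_0)
qed

text \<open>
  The extension of an operator \<open>c\<close> on functions and an operator \<open>A\<close> on vector fields to maps on
  lists: \<open>c\<close> is applied to the value, and \<open>A\<close> to each argument in turn. The Lie derivative
  \<open>L\<^sub>X\<close> comes from \<open>c = X\<close> and \<open>A = - [X, _]\<close>, the operator \<open>\<tau>(S)\<close> from \<open>c = 0\<close> and \<open>A = S\<close>.
\<close>

fun Der :: "(('m \<Rightarrow> real) \<Rightarrow> 'm \<Rightarrow> real) \<Rightarrow> ('m vector_field \<Rightarrow> 'm vector_field) \<Rightarrow>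
    ('m vector_field list \<Rightarrow> 'm \<Rightarrow> real) \<Rightarrow> 'm vector_field list \<Rightarrow> 'm \<Rightarrow> real" where
  "Der c A \<omega> [] = c (\<omega> [])"
| "Der c A \<omega> (X # Xs) = Der c A (ins X \<omega>) Xs + \<omega> (A X # Xs)"

lemma Der_Nil: "Der c A \<omega> [] = c (\<omega> [])"
  and Der_Cons: "Der c A \<omega> (X # Xs) = Der c A (ins X \<omega>) Xs + \<omega> (A X # Xs)"
  by (rule Der.simps)+

declare Der.simps [simp del] Der_Nil [simp] Der_Cons [simp]

text \<open>
  The sign in the last condition makes the terms with \<open>c f\<close> cancel in \<open>Der c A \<omega>\<close> applied to a list
  that contains \<open>f X\<close>, so that \<open>Der c A\<close> preserves linearity over the smooth functions.
\<close>

definition derivation :: "(('m \<Rightarrow> real) \<Rightarrow> 'm \<Rightarrow> real) \<Rightarrow> ('m vector_field \<Rightarrow> 'm vector_field) \<Rightarrow> bool" where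
  "derivation c A \<longleftrightarrow>
    (\<forall>f\<in>C. c f \<in> C \<and> (\<forall>g\<in>C. c (f + g) = c f + c g \<and> c (f * g) = f * c g + g * c f)) \<and>
    (\<forall>X\<in>VF. A X \<in> VF \<and> (\<forall>Y\<in>VF. A (X + Y) = A X + A Y) \<and>
      (\<forall>f\<in>C. A (smul f X) = smul f (A X) - smul (c f) X))"

lemma derivationD:
  assumes "derivation c A"
  shows "f \<in> C \<Longrightarrow> c f \<in> C" "f \<in> C \<Longrightarrow> g \<in> C \<Longrightarrow> c (f + g) = c f + c g"
    "f \<in> C \<Longrightarrow> g \<in> C \<Longrightarrow> c (f * g) = f * c g + g * c f" "X \<in> VF \<Longrightarrow> A X \<in> VF"
    "X \<in> VF \<Longrightarrow> Y \<in> VF \<Longrightarrow> A (X + Y) = A X + A Y"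
    "X \<in> VF \<Longrightarrow> f \<in> C \<Longrightarrow> A (smul f X) = smul f (A X) - smul (c f) X"
  using assms by (auto simp: derivation_def)

lemma derivation_0: "derivation c A \<Longrightarrow> c 0 = 0"
  using derivationD(2)[of c A 0 0] by (simp add: C_0)

lemma ins_Der: "ins X (Der c A \<omega>) = Der c A (ins X \<omega>) + ins (A X) \<omega>"
  by (rule ext) (simp add: ins_def[of _ "Der c A \<omega>"] ins_def[of "A X"])

lemma Der_cong:
  assumes "derivation c A"
  shows "(\<And>Xs. Xs \<in> lists VF \<Longrightarrow> \<omega> Xs = \<eta> Xs) \<Longrightarrow> Xs \<in> lists VF \<Longrightarrow> Der c A \<omega> Xs = Der c A \<eta> Xs"
proof (induction Xs arbitrary: \<omega> \<eta>)
  case (Cons X Xs)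
  have "Der c A (ins X \<omega>) Xs = Der c A (ins X \<eta>) Xs"
    by (rule Cons.IH) (use Cons.prems in \<open>auto simp: ins_def\<close>)
  moreover have "\<omega> (A X # Xs) = \<eta> (A X # Xs)" using Cons.prems derivationD(4)[OF assms] by auto
  ultimately show ?case by simp
qed simp

lemma Der_plus:
  assumes "derivation c A"
  shows "\<forall>Xs\<in>lists VF. \<omega> Xs \<in> C \<Longrightarrow> \<forall>Xs\<in>lists VF. \<eta> Xs \<in> C \<Longrightarrow> Xs \<in> lists VF \<Longrightarrow>
    Der c A (\<omega> + \<eta>) Xs = Der c A \<omega> Xs + Der c A \<eta> Xs"
proof (induction Xs arbitrary: \<omega> \<eta>)
  case Nil
  then show "Der c A (\<omega> + \<eta>) [] = Der c A \<omega> [] + Der c A \<eta> []"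
    unfolding Der_Nil plus_fun_apply[of \<omega> \<eta> "[]"] by (intro derivationD(2)[OF assms]) auto
next
  case (Cons X Xs)
  have "Der c A (ins X \<omega> + ins X \<eta>) Xs = Der c A (ins X \<omega>) Xs + Der c A (ins X \<eta>) Xs"
    by (rule Cons.IH) (use Cons.prems in \<open>auto simp: ins_def\<close>)
  then show "Der c A (\<omega> + \<eta>) (X # Xs) = Der c A \<omega> (X # Xs) + Der c A \<eta> (X # Xs)"
    unfolding Der_Cons ins_plus form_apply by (simp add: ac_simps)
qed

lemma Der_scale:
  assumes "derivation c A" and f: "f \<in> C"
  shows "\<forall>Xs\<in>lists VF. \<omega> Xs \<in> C \<Longrightarrow> Xs \<in> lists VF \<Longrightarrow>
    Der c A (\<lambda>Xs. f * \<omega> Xs) Xs = f * Der c A \<omega> Xs + c f * \<omega> Xs"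
proof (induction Xs arbitrary: \<omega>)
  case Nil
  then show "Der c A (\<lambda>Xs. f * \<omega> Xs) [] = f * Der c A \<omega> [] + c f * \<omega> []"
    unfolding Der_Nil using derivationD(3)[OF assms(1) f, of "\<omega> []"] by (simp only: lists.Nil mult.commute simp_thms)
next
  case (Cons X Xs)
  have "Der c A (\<lambda>Xs. f * ins X \<omega> Xs) Xs = f * Der c A (ins X \<omega>) Xs + c f * ins X \<omega> Xs"
    by (rule Cons.IH) (use Cons.prems in \<open>auto simp: ins_def\<close>)
  moreover have "ins X (\<lambda>Xs. f * \<omega> Xs) = (\<lambda>Xs. f * ins X \<omega> Xs)" by (simp add: ins_def)
  ultimately show ?case by (simp add: ins_def[of X \<omega>] algebra_simps)
qed

lemma Der_0: "derivation c A \<Longrightarrow> Der c A 0 Xs = 0"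
  by (induction Xs) (auto simp: derivation_0)

lemma Der_C:
  assumes "derivation c A"
  shows "\<forall>Xs\<in>lists VF. \<omega> Xs \<in> C \<Longrightarrow> Xs \<in> lists VF \<Longrightarrow> Der c A \<omega> Xs \<in> C"
proof (induction Xs arbitrary: \<omega>)
  case (Cons X Xs)
  have "Der c A (ins X \<omega>) Xs \<in> C" by (rule Cons.IH) (use Cons.prems in \<open>auto simp: ins_def\<close>)
  moreover have "\<omega> (A X # Xs) \<in> C" using Cons.prems derivationD(4)[OF assms] by simp
  ultimately show ?case unfolding Der_Cons by (rule C_plus)
qed (auto intro: derivationD[OF assms])

lemma front_Der:
  assumes dA: "derivation c A" and \<omega>: "alt \<omega>"
  shows "front (Der c A \<omega>)"
  unfolding front_def
proof (intro conjI ballI)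
  note AV = derivationD(4)[OF dA]
  have C: "\<forall>Xs\<in>lists VF. \<omega> Xs \<in> C" using alt_C[OF \<omega>] by blast
  show "Der c A \<omega> Xs \<in> C" if "Xs \<in> lists VF" for Xs by (rule Der_C[OF dA C that])
  fix X Zs assume X: "X \<in> VF" and Zs: "Zs \<in> lists VF"
  have CX: "\<forall>Xs\<in>lists VF. ins Y \<omega> Xs \<in> C" if "Y \<in> VF" for Y
    using alt_C[OF alt_ins[OF \<omega> that]] by blast
  show "Der c A \<omega> ((X + Y) # Zs) = Der c A \<omega> (X # Zs) + Der c A \<omega> (Y # Zs)" if Y: "Y \<in> VF" for Y
  proof -
    have "Der c A (ins (X + Y) \<omega>) Zs = Der c A (ins X \<omega> + ins Y \<omega>) Zs"
      by (rule Der_cong[OF dA _ Zs]) (simp add: ins_def alt_add[OF \<omega> X Y])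
    then show ?thesis
      using X Y Zs by (simp add: Der_plus[OF dA CX CX] derivationD[OF dA] alt_add[OF \<omega>])
  qed
  show "Der c A \<omega> (smul f X # Zs) = f * Der c A \<omega> (X # Zs)" if f: "f \<in> C" for f
  proof -
    have "Der c A (ins (smul f X) \<omega>) Zs = Der c A (\<lambda>Zs. f * ins X \<omega> Zs) Zs"
      by (rule Der_cong[OF dA _ Zs]) (simp add: ins_def alt_smul[OF \<omega> X f])
    also have "\<dots> = f * Der c A (ins X \<omega>) Zs + c f * ins X \<omega> Zs"
      by (rule Der_scale[OF dA f CX[OF X] Zs])
    finally show ?thesis
      using X f Zs
      by (simp add: derivationD[OF dA] alt_diff_arg[OF \<omega>] alt_smul[OF \<omega>] VF_closed ins_def[of X \<omega>] algebra_simps)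
  qed
  show "Der c A \<omega> (X # X # Zs) = 0"
  proof -
    have "Der c A (ins X (ins X \<omega>)) Zs = Der c A 0 Zs"
      by (rule Der_cong[OF dA _ Zs]) (simp add: ins_def alt_eq[OF \<omega> X])
    moreover have "ins X \<omega> (A X # Zs) + \<omega> (A X # X # Zs) = 0"
      using alt_swap[OF \<omega> X AV[OF X] Zs] by (simp add: ins_def)
    ultimately show ?thesis using Der_0[OF dA] by (simp add: add.assoc)
  qed
qed

lemma alt_Der:
  assumes dA: "derivation c A" and \<omega>: "alt \<omega>"
  shows "alt (Der c A \<omega>)"
proof (rule altI)
  fix Ys assume "Ys \<in> lists VF"
  then show "front (\<lambda>Xs. Der c A \<omega> (Ys @ Xs))" using \<omega>
  proof (induction Ys arbitrary: \<omega>)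
    case Nil then show ?case using front_Der[OF dA] by simp
  next
    case (Cons Y Ys)
    then have "front (\<lambda>Xs. Der c A (ins Y \<omega>) (Ys @ Xs))" by (auto intro: alt_ins)
    moreover have "front (\<lambda>Xs. \<omega> ((A Y # Ys) @ Xs))"
      using Cons.hyps(1,2) Cons.prems derivationD(4)[OF dA, of Y] by (intro altD) simp_all
    ultimately have "front ((\<lambda>Xs. Der c A (ins Y \<omega>) (Ys @ Xs)) + (\<lambda>Xs. \<omega> ((A Y # Ys) @ Xs)))"
      by (rule front_plus)
    then show ?case by (simp add: plus_fun_def)
  qed
qed

text \<open>
  The order of the operators on vector fields is reversed because they act on the arguments.
\<close>

lemma Der_commutator:
  assumes d1: "derivation c1 A1" and d2: "derivation c2 A2"
    and c: "\<And>f. f \<in> C \<Longrightarrow> c1 (c2 f) - c2 (c1 f) = c3 f"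
    and A: "\<And>X. X \<in> VF \<Longrightarrow> A2 (A1 X) - A1 (A2 X) = A3 X"
  shows "alt \<omega> \<Longrightarrow> Xs \<in> lists VF \<Longrightarrow>
    Der c1 A1 (Der c2 A2 \<omega>) Xs - Der c2 A2 (Der c1 A1 \<omega>) Xs = Der c3 A3 \<omega> Xs"
proof (induction Xs arbitrary: \<omega>)
  case Nil then show ?case using c alt_C by auto
next
  case (Cons X Xs)
  then have X: "X \<in> VF" and Xs: "Xs \<in> lists VF" by auto
  have i: "alt (ins Y \<omega>)" if "Y \<in> VF" for Y by (rule alt_ins[OF Cons.prems(1) that])
  note a1 = derivationD(4)[OF d1] and a2 = derivationD(4)[OF d2]
  have p1: "Der c1 A1 (Der c2 A2 (ins X \<omega>) + ins (A2 X) \<omega>) Xs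
      = Der c1 A1 (Der c2 A2 (ins X \<omega>)) Xs + Der c1 A1 (ins (A2 X) \<omega>) Xs"
    using alt_C[OF alt_Der[OF d2 i[OF X]]] alt_C[OF i[OF a2[OF X]]] Xs by (intro Der_plus[OF d1]) auto
  have p2: "Der c2 A2 (Der c1 A1 (ins X \<omega>) + ins (A1 X) \<omega>) Xs
      = Der c2 A2 (Der c1 A1 (ins X \<omega>)) Xs + Der c2 A2 (ins (A1 X) \<omega>) Xs"
    using alt_C[OF alt_Der[OF d1 i[OF X]]] alt_C[OF i[OF a1[OF X]]] Xs by (intro Der_plus[OF d2]) auto
  have "\<omega> (A3 X # Xs) = \<omega> (A2 (A1 X) # Xs) - \<omega> (A1 (A2 X) # Xs)"
    using X Xs a1 a2 by (simp add: A[symmetric] alt_diff_arg[OF Cons.prems(1)])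
  moreover have "Der c1 A1 (Der c2 A2 (ins X \<omega>)) Xs - Der c2 A2 (Der c1 A1 (ins X \<omega>)) Xs = Der c3 A3 (ins X \<omega>) Xs"
    by (rule Cons.IH[OF i[OF X] Xs])
  ultimately show "Der c1 A1 (Der c2 A2 \<omega>) (X # Xs) - Der c2 A2 (Der c1 A1 \<omega>) (X # Xs) = Der c3 A3 \<omega> (X # Xs)"
    unfolding Der_Cons ins_Der p1 p2 by (simp add: ins_Der algebra_simps)
qed


lemma Der_uminus:
  assumes dA: "derivation c A" and C: "\<forall>Xs\<in>lists VF. \<omega> Xs \<in> C" and Xs: "Xs \<in> lists VF"
  shows "Der c A (- \<omega>) Xs = - Der c A \<omega> Xs"
proof -
  have "Der c A (- \<omega> + \<omega>) Xs = Der c A (- \<omega>) Xs + Der c A \<omega> Xs"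
    by (rule Der_plus[OF dA _ C Xs]) (use C in \<open>simp add: C_uminus\<close>)
  then show ?thesis using Der_0[OF dA] by (simp add: eq_neg_iff_add_eq_0)
qed

lemma Der_diff:
  assumes dA: "derivation c A" and C: "\<forall>Xs\<in>lists VF. \<omega> Xs \<in> C" "\<forall>Xs\<in>lists VF. \<eta> Xs \<in> C" and Xs: "Xs \<in> lists VF"
  shows "Der c A (\<omega> - \<eta>) Xs = Der c A \<omega> Xs - Der c A \<eta> Xs"
proof -
  have "Der c A (\<omega> + - \<eta>) Xs = Der c A \<omega> Xs + Der c A (- \<eta>) Xs"
    by (rule Der_plus[OF dA C(1) _ Xs]) (use C in \<open>simp add: C_uminus\<close>)
  then show ?thesis using Der_uminus[OF dA C(2) Xs] by simp
qed

lemma Der_eq: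
  assumes "\<And>f. f \<in> C \<Longrightarrow> c f = c' f" "\<And>X. X \<in> VF \<Longrightarrow> A X = A' X"
  shows "alt \<omega> \<Longrightarrow> Xs \<in> lists VF \<Longrightarrow> Der c A \<omega> Xs = Der c' A' \<omega> Xs"
proof (induction Xs arbitrary: \<omega>)
  case Nil then show ?case using assms alt_C by simp
next
  case (Cons X Xs)
  then have "Der c A (ins X \<omega>) Xs = Der c' A' (ins X \<omega>) Xs" using alt_ins by simp
  with Cons.prems show "Der c A \<omega> (X # Xs) = Der c' A' \<omega> (X # Xs)"
    unfolding Der_Cons using assms(2) by simp
qed

lemma Der_sum:
  assumes "\<And>X. X \<in> VF \<Longrightarrow> A X \<in> VF" "\<And>X. X \<in> VF \<Longrightarrow> A' X \<in> VF"
  shows "alt \<omega> \<Longrightarrow> Xs \<in> lists VF \<Longrightarrow>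
    Der (\<lambda>f. c f + c' f) (\<lambda>X. A X + A' X) \<omega> Xs = Der c A \<omega> Xs + Der c' A' \<omega> Xs"
proof (induction Xs arbitrary: \<omega>)
  case Nil
  show "Der (\<lambda>f. c f + c' f) (\<lambda>X. A X + A' X) \<omega> [] = Der c A \<omega> [] + Der c' A' \<omega> []"
    unfolding Der_Nil by (rule refl)
next
  case (Cons X Xs)
  then have "Der (\<lambda>f. c f + c' f) (\<lambda>X. A X + A' X) (ins X \<omega>) Xs = Der c A (ins X \<omega>) Xs + Der c' A' (ins X \<omega>) Xs"
    using alt_ins by simp
  moreover have "\<omega> ((A X + A' X) # Xs) = \<omega> (A X # Xs) + \<omega> (A' X # Xs)"
    using Cons.prems assms by (simp add: alt_add)
  ultimately show "Der (\<lambda>f. c f + c' f) (\<lambda>X. A X + A' X) \<omega> (X # Xs) = Der c A \<omega> (X # Xs) + Der c' A' \<omega> (X # Xs)"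
    unfolding Der_Cons by (simp add: ac_simps)
qed

lemma Der_neg:
  assumes "\<And>X. X \<in> VF \<Longrightarrow> A X \<in> VF"
  shows "alt \<omega> \<Longrightarrow> Xs \<in> lists VF \<Longrightarrow> Der (\<lambda>f. - c f) (\<lambda>X. - A X) \<omega> Xs = - Der c A \<omega> Xs"
proof (induction Xs arbitrary: \<omega>)
  case Nil
  show "Der (\<lambda>f. - c f) (\<lambda>X. - A X) \<omega> [] = - Der c A \<omega> []"
    unfolding Der_Nil by (rule refl)
next
  case (Cons X Xs)
  then have "Der (\<lambda>f. - c f) (\<lambda>X. - A X) (ins X \<omega>) Xs = - Der c A (ins X \<omega>) Xs"
    using alt_ins by simp
  moreover have "\<omega> (- A X # Xs) = - \<omega> (A X # Xs)"
    using Cons.prems assms by (simp add: alt_uminus_arg)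
  ultimately show "Der (\<lambda>f. - c f) (\<lambda>X. - A X) \<omega> (X # Xs) = - Der c A \<omega> (X # Xs)"
    unfolding Der_Cons by simp
qed

definition Lie :: "'m vector_field \<Rightarrow> ('m vector_field list \<Rightarrow> 'm \<Rightarrow> real) \<Rightarrow> 'm vector_field list \<Rightarrow> 'm \<Rightarrow> real" where
  "Lie X = Der (act X) (\<lambda>Y. - lie_bracket X Y)"

lemma act_uminus: "X \<in> VF \<Longrightarrow> f \<in> C \<Longrightarrow> act X (- f) = - act X f"
  using act_subtract[of X 0 f] act_subtract[of X 0 0] by (simp add: C_0)

lemma bracket_uminus_right: "X \<in> VF \<Longrightarrow> Y \<in> VF \<Longrightarrow> lie_bracket X (- Y) = - lie_bracket X Y"
  by (rule field_eqI) (simp add: act_bracket act_field_uminus act_uminus act_C)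

lemma bracket_uminus_left: "X \<in> VF \<Longrightarrow> Y \<in> VF \<Longrightarrow> lie_bracket (- X) Y = - lie_bracket X Y"
  by (rule field_eqI) (simp add: act_bracket act_field_uminus act_uminus act_C)

lemma derivation_Lie: "X \<in> VF \<Longrightarrow> derivation (act X) (\<lambda>Y. - lie_bracket X Y)"
proof -
  assume X: "X \<in> VF"
  have "- lie_bracket X (smul f Y) = smul f (- lie_bracket X Y) - smul (act X f) Y" if "Y \<in> VF" "f \<in> C" for f Y
    using X that
    by (intro field_eqI) (simp add: bracket_smul_right act_field_plus act_field_uminus act_field_diff act_smul algebra_simps)
  then show ?thesis
    unfolding derivation_def using X
    by (simp add: act_C act_plus act_times VF_closed bracket_plus_right)
qed

lemma Lie_Nil: "Lie X \<omega> [] = act X (\<omega> [])"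
  and Lie_Cons: "Lie X \<omega> (Y # Ys) = Lie X (ins Y \<omega>) Ys + \<omega> (- lie_bracket X Y # Ys)"
  unfolding Lie_def by simp_all

lemma ins_Lie: "ins Y (Lie X \<omega>) = Lie X (ins Y \<omega>) + ins (- lie_bracket X Y) \<omega>"
  unfolding Lie_def by (rule ins_Der)

lemma alt_Lie: "X \<in> VF \<Longrightarrow> alt \<omega> \<Longrightarrow> alt (Lie X \<omega>)"
  unfolding Lie_def by (rule alt_Der[OF derivation_Lie])

lemma Lie_field_plus:
  assumes "X \<in> VF" "Y \<in> VF" "alt \<omega>" "Xs \<in> lists VF"
  shows "Lie (X + Y) \<omega> Xs = Lie X \<omega> Xs + Lie Y \<omega> Xs"
proof -
  have "Lie (X + Y) \<omega> Xs = Der (\<lambda>f. act X f + act Y f) (\<lambda>Z. - lie_bracket X Z + - lie_bracket Y Z) \<omega> Xs"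
    unfolding Lie_def by (rule Der_eq) (use assms in \<open>simp_all add: act_field_plus bracket_plus_left\<close>)
  also have "\<dots> = Lie X \<omega> Xs + Lie Y \<omega> Xs"
    unfolding Lie_def using assms by (intro Der_sum) (simp_all add: VF_closed)
  finally show ?thesis .
qed

lemma Lie_field_uminus:
  assumes "X \<in> VF" "alt \<omega>" "Xs \<in> lists VF"
  shows "Lie (- X) \<omega> Xs = - Lie X \<omega> Xs"
proof -
  have "Lie (- X) \<omega> Xs = Der (\<lambda>f. - act X f) (\<lambda>Z. - (- lie_bracket X Z)) \<omega> Xs"
    unfolding Lie_def by (rule Der_eq) (use assms in \<open>simp_all add: act_field_uminus bracket_uminus_left\<close>)
  also have "\<dots> = - Lie X \<omega> Xs"
    unfolding Lie_def using assms by (intro Der_neg) (simp_all add: VF_closed)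
  finally show ?thesis .
qed

text \<open>
  On functions this is the definition of the bracket, on arguments the Jacobi identity.
\<close>

lemma Lie_bracket:
  assumes X: "X \<in> VF" and Y: "Y \<in> VF" and \<omega>: "alt \<omega>" "Xs \<in> lists VF"
  shows "Lie X (Lie Y \<omega>) Xs - Lie Y (Lie X \<omega>) Xs = Lie (lie_bracket X Y) \<omega> Xs"
  unfolding Lie_def
proof (rule Der_commutator[OF derivation_Lie[OF X] derivation_Lie[OF Y] _ _ \<omega>])
  show "act X (act Y f) - act Y (act X f) = act (lie_bracket X Y) f" for f
    by (simp add: act_bracket)
  show "- lie_bracket Y (- lie_bracket X Z) - - lie_bracket X (- lie_bracket Y Z) = - lie_bracket (lie_bracket X Y) Z"
    if "Z \<in> VF" for Z
    using X Y that by (simp add: bracket_uminus_right bracket_VF jacobi)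
qed

section \<open>The exterior derivative of alternating multilinear maps\<close>

text \<open>
  The exterior derivative, defined by Cartan's formula \<open>\<iota>\<^sub>X d = L\<^sub>X - d \<iota>\<^sub>X\<close>. On a smooth function \<open>f\<close>,
  the value on the empty list, this gives \<open>df(X) = X f\<close>.
\<close>

fun D :: "('m vector_field list \<Rightarrow> 'm \<Rightarrow> real) \<Rightarrow> 'm vector_field list \<Rightarrow> 'm \<Rightarrow> real" where
  "D \<omega> [] = 0"
| "D \<omega> (X # Xs) = Lie X \<omega> Xs - D (ins X \<omega>) Xs"

lemma D_Nil: "D \<omega> [] = 0"
  and D_Cons: "D \<omega> (X # Xs) = Lie X \<omega> Xs - D (ins X \<omega>) Xs"
  by (rule D.simps)+

declare D.simps [simp del]

lemma ins_D: "ins X (D \<omega>) = Lie X \<omega> - D (ins X \<omega>)"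
  by (rule ext) (simp add: ins_def[of _ "D \<omega>"] D_Cons)

lemma D_cong:
  "(\<And>Xs. Xs \<in> lists VF \<Longrightarrow> \<omega> Xs = \<eta> Xs) \<Longrightarrow> Xs \<in> lists VF \<Longrightarrow> D \<omega> Xs = D \<eta> Xs"
proof (induction Xs arbitrary: \<omega> \<eta>)
  case (Cons X Xs)
  have "D (ins X \<omega>) Xs = D (ins X \<eta>) Xs"
    by (rule Cons.IH) (use Cons.prems in \<open>auto simp: ins_def\<close>)
  moreover have "Lie X \<omega> Xs = Lie X \<eta> Xs" unfolding Lie_def
    by (rule Der_cong[OF derivation_Lie]) (use Cons.prems in auto)
  ultimately show ?case unfolding D_Cons by simp
qed (simp add: D_Nil)

lemma D_plus:
  "\<forall>Xs\<in>lists VF. \<omega> Xs \<in> C \<Longrightarrow> \<forall>Xs\<in>lists VF. \<eta> Xs \<in> C \<Longrightarrow> Xs \<in> lists VF \<Longrightarrow>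
    D (\<omega> + \<eta>) Xs = D \<omega> Xs + D \<eta> Xs"
proof (induction Xs arbitrary: \<omega> \<eta>)
  case Nil
  show "D (\<omega> + \<eta>) [] = D \<omega> [] + D \<eta> []" by (simp add: D_Nil)
next
  case (Cons X Xs)
  have "D (ins X \<omega> + ins X \<eta>) Xs = D (ins X \<omega>) Xs + D (ins X \<eta>) Xs"
    by (rule Cons.IH) (use Cons.prems in \<open>auto simp: ins_def\<close>)
  moreover have "Lie X (\<omega> + \<eta>) Xs = Lie X \<omega> Xs + Lie X \<eta> Xs" unfolding Lie_def
    by (rule Der_plus[OF derivation_Lie]) (use Cons.prems in auto)
  ultimately show "D (\<omega> + \<eta>) (X # Xs) = D \<omega> (X # Xs) + D \<eta> (X # Xs)"
    unfolding D_Cons ins_plus by (simp add: algebra_simps)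
qed

lemma D_0: "Xs \<in> lists VF \<Longrightarrow> D 0 Xs = 0"
proof (induction Xs)
  case (Cons X Xs)
  have "Lie X 0 Xs = 0" unfolding Lie_def by (rule Der_0[OF derivation_Lie]) (use Cons.prems in auto)
  moreover have "D 0 Xs = 0" by (rule Cons.IH) (use Cons.prems in auto)
  ultimately show "D 0 (X # Xs) = 0" unfolding D_Cons ins_0 by simp
qed (simp add: D_Nil)

lemma D_uminus:
  assumes C: "\<forall>Xs\<in>lists VF. \<omega> Xs \<in> C" and Xs: "Xs \<in> lists VF"
  shows "D (- \<omega>) Xs = - D \<omega> Xs"
proof -
  have "D (- \<omega> + \<omega>) Xs = D (- \<omega>) Xs + D \<omega> Xs"
    by (rule D_plus[OF _ C Xs]) (use C in \<open>simp add: C_uminus\<close>)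
  then show ?thesis using D_0[OF Xs] by (simp add: eq_neg_iff_add_eq_0)
qed

lemma D_C: "alt \<omega> \<Longrightarrow> Xs \<in> lists VF \<Longrightarrow> D \<omega> Xs \<in> C"
proof (induction Xs arbitrary: \<omega>)
  case (Cons X Xs)
  then show ?case unfolding D_Cons using alt_ins alt_Lie alt_C by (simp add: C_subtract)
qed (simp add: D_Nil C_0)

text \<open>
  \<open>\<iota>\<^sub>Y \<iota>\<^sub>X d = \<iota>\<^sub>Y L\<^sub>X - L\<^sub>Y \<iota>\<^sub>X + d \<iota>\<^sub>Y \<iota>\<^sub>X\<close>, and \<open>\<iota>\<^sub>Y L\<^sub>X = L\<^sub>X \<iota>\<^sub>Y - \<iota>\<^sub>[\<^sub>X\<^sub>,\<^sub>Y\<^sub>]\<close>; the sum is antisymmetric in \<open>X\<close> and \<open>Y\<close>.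
\<close>

lemma D_swap:
  assumes \<omega>: "alt \<omega>" and X: "X \<in> VF" and Y: "Y \<in> VF" and Zs: "Zs \<in> lists VF"
  shows "D \<omega> (X # Y # Zs) = - D \<omega> (Y # X # Zs)"
proof -
  have i: "alt (ins X (ins Y \<omega>))" using \<omega> X Y alt_ins by blast
  have "D (ins Y (ins X \<omega>)) Zs = D (- ins X (ins Y \<omega>)) Zs"
    by (rule D_cong[OF _ Zs]) (use alt_swap[OF \<omega> X Y] in \<open>simp add: ins_def\<close>)
  also have "\<dots> = - D (ins X (ins Y \<omega>)) Zs"
    using alt_C[OF i] by (intro D_uminus Zs) blast
  finally have 1: "D (ins Y (ins X \<omega>)) Zs = - D (ins X (ins Y \<omega>)) Zs" .
  have 2: "\<omega> (- lie_bracket Y X # Zs) = - \<omega> (- lie_bracket X Y # Zs)"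
    using alt_uminus_arg[OF \<omega>, of "lie_bracket X Y" Zs] X Y Zs bracket_skew[of Y X] by (simp add: VF_closed)
  show ?thesis
    unfolding D_Cons Lie_Cons ins_D by (simp add: 1 2)
qed

lemma D_field_plus:
  assumes \<omega>: "alt \<omega>" and X: "X \<in> VF" and Y: "Y \<in> VF" and Zs: "Zs \<in> lists VF"
  shows "D \<omega> ((X + Y) # Zs) = D \<omega> (X # Zs) + D \<omega> (Y # Zs)"
proof -
  have i: "\<forall>Xs\<in>lists VF. ins Z \<omega> Xs \<in> C" if "Z \<in> VF" for Z using alt_C alt_ins[OF \<omega> that] by blast
  have "D (ins (X + Y) \<omega>) Zs = D (ins X \<omega> + ins Y \<omega>) Zs"
    by (rule D_cong[OF _ Zs]) (use alt_add[OF \<omega> X Y] in \<open>simp add: ins_def\<close>)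
  also have "\<dots> = D (ins X \<omega>) Zs + D (ins Y \<omega>) Zs" by (rule D_plus[OF i[OF X] i[OF Y] Zs])
  finally show ?thesis
    unfolding D_Cons using Lie_field_plus[OF X Y \<omega> Zs] by (simp add: algebra_simps)
qed

text \<open>
  The first argument is the only one in which the Leibniz rule would produce a derivative of \<open>f\<close>.
  This is avoided by exchanging it with the second argument: \<open>\<iota>\<^sub>Y d = L\<^sub>Y - d \<iota>\<^sub>Y\<close>, where \<open>L\<^sub>Y \<omega>\<close> is linear
  over the smooth functions and \<open>d \<iota>\<^sub>Y \<omega>\<close> is covered by the induction hypothesis.
\<close>

lemma D_field_smul:
  assumes X: "X \<in> VF" and f: "f \<in> C"
  shows "alt \<omega> \<Longrightarrow> Zs \<in> lists VF \<Longrightarrow> D \<omega> (smul f X # Zs) = f * D \<omega> (X # Zs)"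
proof (induction Zs arbitrary: \<omega>)
  case Nil
  show "D \<omega> [smul f X] = f * D \<omega> [X]" unfolding D_Cons D_Nil Lie_Nil by (simp add: act_smul)
next
  case (Cons Y Ys)
  then have Y: "Y \<in> VF" and Ys: "Ys \<in> lists VF" and \<omega>: "alt \<omega>" by auto
  have fX: "smul f X \<in> VF" using X f by (simp add: VF_smul)
  have "D \<omega> (smul f X # Y # Ys) = - (Lie Y \<omega> (smul f X # Ys) - D (ins Y \<omega>) (smul f X # Ys))"
    unfolding D_swap[OF \<omega> fX Y Ys] D_Cons[of _ Y] by (rule refl)
  also have "\<dots> = f * - (Lie Y \<omega> (X # Ys) - D (ins Y \<omega>) (X # Ys))"
    using Cons.IH[OF alt_ins[OF \<omega> Y] Ys] alt_smul[OF alt_Lie[OF Y \<omega>] X f Ys] by (simp add: algebra_simps)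
  also have "- (Lie Y \<omega> (X # Ys) - D (ins Y \<omega>) (X # Ys)) = D \<omega> (X # Y # Ys)"
    unfolding D_swap[OF \<omega> X Y Ys] D_Cons[of _ Y] by (rule refl)
  finally show ?case .
qed

lemma front_D:
  assumes \<omega>: "alt \<omega>"
  shows "front (D \<omega>)"
  unfolding front_def
proof (intro conjI ballI)
  fix X Zs assume XZ: "X \<in> VF" "Zs \<in> lists VF"
  have "D \<omega> (X # X # Zs) = - D \<omega> (X # X # Zs)" by (rule D_swap[OF \<omega> XZ(1,1,2)])
  then show "D \<omega> (X # X # Zs) = 0" by (simp add: fun_eq_iff fun_apply)
qed (use \<omega> in \<open>simp_all add: D_C D_field_plus D_field_smul\<close>)

lemma alt_D:
  assumes \<omega>: "alt \<omega>"
  shows "alt (D \<omega>)"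
proof (rule altI)
  fix Ys
  show "Ys \<in> lists VF \<Longrightarrow> front (\<lambda>Xs. D \<omega> (Ys @ Xs))" using \<omega>
  proof (induction Ys arbitrary: \<omega>)
    case Nil then show ?case using front_D by simp
  next
    case (Cons Y Ys)
    then have "front (\<lambda>Xs. D (ins Y \<omega>) (Ys @ Xs))" by (simp add: alt_ins)
    moreover have "front (\<lambda>Xs. Lie Y \<omega> (Ys @ Xs))"
      using Cons.prems by (intro altD alt_Lie) simp_all
    ultimately have "front ((\<lambda>Xs. Lie Y \<omega> (Ys @ Xs)) - (\<lambda>Xs. D (ins Y \<omega>) (Ys @ Xs)))"
      by (intro front_diff)
    moreover have "(\<lambda>Xs. Lie Y \<omega> (Ys @ Xs)) - (\<lambda>Xs. D (ins Y \<omega>) (Ys @ Xs)) = (\<lambda>Xs. D \<omega> ((Y # Ys) @ Xs))"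
      by (simp add: D_Cons fun_diff_def)
    ultimately show ?case by simp
  qed
qed

text \<open>
  The commutator anticommutes with contractions:
  \<open>\<iota>\<^sub>Y [L\<^sub>X, d] = [L\<^sub>X, L\<^sub>Y] - L\<^sub>[\<^sub>X\<^sub>,\<^sub>Y\<^sub>] - [L\<^sub>X, d] \<iota>\<^sub>Y = - [L\<^sub>X, d] \<iota>\<^sub>Y\<close>. So it vanishes by induction on the
  number of arguments.
\<close>

lemma Lie_D_commute:
  assumes X: "X \<in> VF"
  shows "alt \<omega> \<Longrightarrow> Xs \<in> lists VF \<Longrightarrow> Lie X (D \<omega>) Xs = D (Lie X \<omega>) Xs"
proof (induction Xs arbitrary: \<omega>)
  case Nil
  show "Lie X (D \<omega>) [] = D (Lie X \<omega>) []"
    unfolding Lie_Nil D_Nil using derivation_0[OF derivation_Lie[OF X]] .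
next
  case (Cons Y Ys)
  then have Y: "Y \<in> VF" and Ys: "Ys \<in> lists VF" and \<omega>: "alt \<omega>" by auto
  note i = alt_ins[OF \<omega> Y]
  have B: "lie_bracket X Y \<in> VF" "- lie_bracket X Y \<in> VF" using X Y by (simp_all add: VF_closed)
  have 1: "Lie X (Lie Y \<omega> - D (ins Y \<omega>)) Ys = Lie X (Lie Y \<omega>) Ys - Lie X (D (ins Y \<omega>)) Ys"
    unfolding Lie_def[of X]
    using alt_C[OF alt_Lie[OF Y \<omega>]] alt_C[OF alt_D[OF i]] by (intro Der_diff[OF derivation_Lie[OF X]] Ys) blast+
  have 2: "D (Lie X (ins Y \<omega>) + ins (- lie_bracket X Y) \<omega>) Ys = D (Lie X (ins Y \<omega>)) Ys + D (ins (- lie_bracket X Y) \<omega>) Ys"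
    using alt_C[OF alt_Lie[OF X i]] alt_C[OF alt_ins[OF \<omega> B(2)]] by (intro D_plus Ys) blast+
  have 3: "Lie X (D (ins Y \<omega>)) Ys = D (Lie X (ins Y \<omega>)) Ys" by (rule Cons.IH[OF i Ys])
  have 4: "Lie X (Lie Y \<omega>) Ys - Lie Y (Lie X \<omega>) Ys = - Lie (- lie_bracket X Y) \<omega> Ys"
    using Lie_bracket[OF X Y \<omega> Ys] Lie_field_uminus[OF B(1) \<omega> Ys] by simp
  show "Lie X (D \<omega>) (Y # Ys) = D (Lie X \<omega>) (Y # Ys)"
    unfolding Lie_Cons[of X "D \<omega>"] D_Cons ins_D ins_Lie 1 2 3 using 4 by (simp add: algebra_simps)
qed

text \<open>
  \<open>\<iota>\<^sub>X d d = L\<^sub>X d - d L\<^sub>X + d d \<iota>\<^sub>X = d d \<iota>\<^sub>X\<close>, and the number of arguments decreases.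
\<close>

lemma D_D: "alt \<omega> \<Longrightarrow> Xs \<in> lists VF \<Longrightarrow> D (D \<omega>) Xs = 0"
proof (induction Xs arbitrary: \<omega>)
  case (Cons X Xs)
  then have X: "X \<in> VF" and Xs: "Xs \<in> lists VF" and \<omega>: "alt \<omega>" by auto
  note i = alt_ins[OF \<omega> X]
  have "D (Lie X \<omega> + - D (ins X \<omega>)) Xs = D (Lie X \<omega>) Xs + D (- D (ins X \<omega>)) Xs"
    using alt_C[OF alt_Lie[OF X \<omega>]] alt_C[OF alt_uminus[OF alt_D[OF i]]] by (intro D_plus Xs) blast+
  moreover have "D (- D (ins X \<omega>)) Xs = 0"
    using D_uminus[of "D (ins X \<omega>)" Xs] Xs alt_C[OF alt_D[OF i]] Cons.IH[OF i Xs] by simp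
  ultimately show "D (D \<omega>) (X # Xs) = 0"
    unfolding D_Cons[of "D \<omega>"] ins_D using Lie_D_commute[OF X \<omega> Xs] by simp
qed (simp add: D_Nil)

section \<open>Conjugating the exterior derivative by an invertible operator\<close>

definition linear_op :: "('m vector_field \<Rightarrow> 'm vector_field) \<Rightarrow> bool" where
  "linear_op A \<longleftrightarrow> (\<forall>X\<in>VF. A X \<in> VF \<and> (\<forall>Y\<in>VF. A (X + Y) = A X + A Y) \<and> (\<forall>f\<in>C. A (smul f X) = smul f (A X)))"

lemma linear_opD:
  assumes "linear_op A"
  shows "X \<in> VF \<Longrightarrow> A X \<in> VF" "X \<in> VF \<Longrightarrow> Y \<in> VF \<Longrightarrow> A (X + Y) = A X + A Y"
    "X \<in> VF \<Longrightarrow> f \<in> C \<Longrightarrow> A (smul f X) = smul f (A X)"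
  using assms by (auto simp: linear_op_def)

lemma linear_op_uminus:
  assumes "linear_op A" "X \<in> VF"
  shows "A (- X) = - A X"
proof -
  have "A (0 + 0) = A 0 + A 0" by (rule linear_opD(2)[OF assms(1) VF_0 VF_0])
  then have "A 0 = 0" by simp
  moreover have "A (- X + X) = A (- X) + A X"
    by (rule linear_opD(2)[OF assms(1) VF_uminus]) (rule assms(2))+
  ultimately show ?thesis by (simp add: eq_neg_iff_add_eq_0)
qed

lemma linear_op_diff:
  "linear_op A \<Longrightarrow> X \<in> VF \<Longrightarrow> Y \<in> VF \<Longrightarrow> A (X - Y) = A X - A Y"
  using linear_opD(2)[of A X "- Y"] linear_op_uminus[of A Y] by (simp add: VF_uminus)

lemma derivation_linear_op:
  assumes "linear_op A"
  shows "derivation (\<lambda>f. 0) A"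
proof -
  have "smul 0 X = 0" for X by (rule field_eqI) (simp add: act_smul, simp add: act_def fun_eq_iff fun_apply)
  then show ?thesis using assms unfolding derivation_def linear_op_def by (simp add: C_0)
qed

definition pull :: "('m vector_field \<Rightarrow> 'm vector_field) \<Rightarrow> ('m vector_field list \<Rightarrow> 'm \<Rightarrow> real) \<Rightarrow> 'm vector_field list \<Rightarrow> 'm \<Rightarrow> real" where
  "pull A \<omega> = (\<lambda>Xs. \<omega> (map A Xs))"

lemma ins_pull: "ins X (pull A \<omega>) = pull A (ins (A X) \<omega>)"
  by (simp add: ins_def pull_def)

lemma alt_pull:
  assumes A: "linear_op A" and \<omega>: "alt \<omega>"
  shows "alt (pull A \<omega>)"
proof (rule altI)
  fix Ys assume "Ys \<in> lists VF"
  then have "map A Ys \<in> lists VF" using linear_opD(1)[OF A] by auto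
  from altD[OF \<omega> this] have f: "front (\<lambda>Xs. \<omega> (map A Ys @ Xs))" .
  have l: "map A Xs \<in> lists VF" if "Xs \<in> lists VF" for Xs using that linear_opD(1)[OF A] by auto
  show "front (\<lambda>Xs. pull A \<omega> (Ys @ Xs))"
    using f l unfolding front_def pull_def by (simp add: linear_opD[OF A])
qed

text \<open>
  Conjugation by a pullback keeps the action on functions and conjugates the action on the
  arguments.
\<close>

lemma pull_Der_pull:
  assumes inv: "\<And>X. X \<in> VF \<Longrightarrow> A' (A X) = X"
  shows "Xs \<in> lists VF \<Longrightarrow> pull A (Der c B (pull A' \<omega>)) Xs = Der c (\<lambda>X. A' (B (A X))) \<omega> Xs"
proof (induction Xs arbitrary: \<omega>)
  case Nil
  show "pull A (Der c B (pull A' \<omega>)) [] = Der c (\<lambda>X. A' (B (A X))) \<omega> []"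
    by (simp add: pull_def)
next
  case (Cons X Xs)
  have m: "map A' (map A Xs) = Xs" using Cons.prems inv by (simp add: in_lists_conv_set map_idI)
  have "Der c B (ins (A X) (pull A' \<omega>)) (map A Xs) = Der c (\<lambda>X. A' (B (A X))) (ins X \<omega>) Xs"
    using Cons.IH[of "ins X \<omega>"] Cons.prems inv[of X] by (simp add: ins_pull pull_def[of A])
  then show "pull A (Der c B (pull A' \<omega>)) (X # Xs) = Der c (\<lambda>X. A' (B (A X))) \<omega> (X # Xs)"
    unfolding pull_def[of A] list.map Der_Cons using m by (simp add: pull_def)
qed

text \<open>
  The main identity. Contraction with \<open>X\<close> turns each side into a derivation minus the same side for
  \<open>\<iota>\<^sub>X \<omega>\<close>, and the last hypothesis, which says that the Nijenhuis tensor of \<open>A\<close> vanishes, makes the two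
  derivations equal.
\<close>

lemma pull_D_pull:
  assumes A: "linear_op A" and A': "linear_op A'"
    and inv: "\<And>X. X \<in> VF \<Longrightarrow> A' (A X) = X"
    and S: "linear_op S" "\<And>X. X \<in> VF \<Longrightarrow> S X = A X - X"
    and N: "\<And>X Y. X \<in> VF \<Longrightarrow> Y \<in> VF \<Longrightarrow>
      A' (lie_bracket (A X) (A Y)) = lie_bracket (A X) Y + lie_bracket X (A Y) - A (lie_bracket X Y)"
  shows "alt \<omega> \<Longrightarrow> Xs \<in> lists VF \<Longrightarrow> pull A (D (pull A' \<omega>)) Xs
    = D \<omega> Xs + (Der (\<lambda>f. 0) S (D \<omega>) Xs - D (Der (\<lambda>f. 0) S \<omega>) Xs)"
proof (induction Xs arbitrary: \<omega>)
  case Nil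
  show "pull A (D (pull A' \<omega>)) [] = D \<omega> [] + (Der (\<lambda>f. 0) S (D \<omega>) [] - D (Der (\<lambda>f. 0) S \<omega>) [])"
    by (simp add: pull_def D_Nil)
next
  case (Cons X Xs)
  then have X: "X \<in> VF" and Xs: "Xs \<in> lists VF" and \<omega>: "alt \<omega>" by auto
  note dS = derivation_linear_op[OF S(1)]
  have SX: "S X \<in> VF" and AX: "A X \<in> VF" using X linear_opD(1)[OF S(1)] linear_opD(1)[OF A] by auto
  note i = alt_ins[OF \<omega> X]
  have L: "pull A (Lie (A X) (pull A' \<omega>)) Xs
     = Lie X \<omega> Xs + Lie (S X) \<omega> Xs + (Der (\<lambda>f. 0) S (Lie X \<omega>) Xs - Lie X (Der (\<lambda>f. 0) S \<omega>) Xs)"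
  proof -
    let ?B = "\<lambda>Y. - lie_bracket X (S Y) - S (- lie_bracket X Y)"
    have "Der (\<lambda>f. 0) S (Lie X \<omega>) Xs - Lie X (Der (\<lambda>f. 0) S \<omega>) Xs = Der (\<lambda>f. 0) ?B \<omega> Xs"
      unfolding Lie_def
      by (rule Der_commutator[OF dS derivation_Lie[OF X] _ _ \<omega> Xs, where ?c3.0 = "\<lambda>f. 0" and ?A3.0 = ?B]) (simp_all add: derivation_0[OF derivation_Lie[OF X]])
    moreover have "Lie X \<omega> Xs + Lie (S X) \<omega> Xs
        = Der (\<lambda>f. act X f + act (S X) f) (\<lambda>Y. - lie_bracket X Y + - lie_bracket (S X) Y) \<omega> Xs"
      unfolding Lie_def using X SX \<omega> Xs by (intro Der_sum[symmetric]) (simp_all add: VF_closed)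
    moreover have "\<dots> + Der (\<lambda>f. 0) ?B \<omega> Xs
        = Der (\<lambda>f. act X f + act (S X) f + 0) (\<lambda>Y. - lie_bracket X Y + - lie_bracket (S X) Y + ?B Y) \<omega> Xs"
      using X SX \<omega> Xs linear_opD(1)[OF S(1)] by (intro Der_sum[symmetric]) (simp_all add: VF_closed)
    moreover have "pull A (Lie (A X) (pull A' \<omega>)) Xs = Der (act (A X)) (\<lambda>Y. A' (- lie_bracket (A X) (A Y))) \<omega> Xs"
      unfolding Lie_def
      using pull_Der_pull[where A = A and A' = A' and c = "act (A X)" and B = "\<lambda>Y. - lie_bracket (A X) Y" and \<omega> = \<omega>, OF inv Xs] .
    moreover have "\<dots> = Der (\<lambda>f. act X f + act (S X) f + 0) (\<lambda>Y. - lie_bracket X Y + - lie_bracket (S X) Y + ?B Y) \<omega> Xs"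
    proof (rule Der_eq[OF _ _ \<omega> Xs])
      show "act (A X) f = act X f + act (S X) f + 0" for f
        using S(2)[OF X] by (simp add: act_field_diff)
      fix Y assume Y: "Y \<in> VF"
      have AY: "A Y \<in> VF" using Y linear_opD(1)[OF A] by auto
      have B: "lie_bracket (A X) (A Y) \<in> VF" "lie_bracket X Y \<in> VF" using X Y AX AY by (simp_all add: VF_closed)
      have a: "lie_bracket (S X) Y = lie_bracket (A X) Y - lie_bracket X Y"
        using bracket_plus_left[OF AX VF_uminus[OF X] Y] bracket_uminus_left[OF X Y] S(2)[OF X] by simp
      have b: "lie_bracket X (S Y) = lie_bracket X (A Y) - lie_bracket X Y"
        using bracket_plus_right[OF X AY VF_uminus[OF Y]] bracket_uminus_right[OF X Y] S(2)[OF Y] by simp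
      have c: "S (- lie_bracket X Y) = - A (lie_bracket X Y) + lie_bracket X Y"
        using linear_op_uminus[OF S(1) B(2)] S(2)[OF B(2)] by simp
      show "A' (- lie_bracket (A X) (A Y)) = - lie_bracket X Y + - lie_bracket (S X) Y + ?B Y"
        unfolding a b c linear_op_uminus[OF A' B(1)] N[OF X Y] by simp
    qed
    ultimately show ?thesis by simp
  qed
  have 1: "Der (\<lambda>f. 0) S (Lie X \<omega> - D (ins X \<omega>)) Xs = Der (\<lambda>f. 0) S (Lie X \<omega>) Xs - Der (\<lambda>f. 0) S (D (ins X \<omega>)) Xs"
    using alt_C[OF alt_Lie[OF X \<omega>]] alt_C[OF alt_D[OF i]] by (intro Der_diff[OF dS] Xs) blast+
  have 2: "D (Der (\<lambda>f. 0) S (ins X \<omega>) + ins (S X) \<omega>) Xs = D (Der (\<lambda>f. 0) S (ins X \<omega>)) Xs + D (ins (S X) \<omega>) Xs"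
    using alt_C[OF alt_Der[OF dS i]] alt_C[OF alt_ins[OF \<omega> SX]] by (intro D_plus Xs) blast+
  have 3: "pull A (D (pull A' (ins X \<omega>))) Xs
    = D (ins X \<omega>) Xs + (Der (\<lambda>f. 0) S (D (ins X \<omega>)) Xs - D (Der (\<lambda>f. 0) S (ins X \<omega>)) Xs)"
    by (rule Cons.IH[OF i Xs])
  have 4: "pull A (D (pull A' \<omega>)) (X # Xs) = pull A (Lie (A X) (pull A' \<omega>)) Xs - pull A (D (pull A' (ins X \<omega>))) Xs"
    unfolding pull_def[of A] list.map D_Cons ins_pull inv[OF X] by (rule refl)
  show "pull A (D (pull A' \<omega>)) (X # Xs)
    = D \<omega> (X # Xs) + (Der (\<lambda>f. 0) S (D \<omega>) (X # Xs) - D (Der (\<lambda>f. 0) S \<omega>) (X # Xs))"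
    unfolding 4 L 3 D_Cons Der_Cons ins_D ins_Der 1 2 by (simp add: algebra_simps)
qed

section \<open>Values at a point\<close>

lemma alt_sum:
  assumes \<omega>: "alt \<omega>" and Zs: "Zs \<in> lists VF"
  shows "finite I \<Longrightarrow> (\<And>i. i \<in> I \<Longrightarrow> X i \<in> VF) \<Longrightarrow> \<omega> ((\<Sum>i\<in>I. X i) # Zs) p = (\<Sum>i\<in>I. \<omega> (X i # Zs) p)"
proof (induction I rule: finite_induct)
  case empty
  have "\<omega> (0 # Zs) p = 0" unfolding alt_0_arg[OF \<omega> Zs] by (rule zero_fun_apply)
  then show ?case by simp
next
  case (insert x F)
  then have "\<omega> ((X x + (\<Sum>i\<in>F. X i)) # Zs) = \<omega> (X x # Zs) + \<omega> ((\<Sum>i\<in>F. X i) # Zs)"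
    by (intro alt_add[OF \<omega> _ _ Zs] VF_sum) auto
  then have "\<omega> ((X x + (\<Sum>i\<in>F. X i)) # Zs) p = \<omega> (X x # Zs) p + \<omega> ((\<Sum>i\<in>F. X i) # Zs) p"
    by (simp only: plus_fun_apply)
  with insert show ?case by simp
qed

text \<open>
  Multiplied by \<open>\<rho>\<close>, the field \<open>X\<close> becomes a combination of fixed fields with coefficients \<open>X(g\<^sub>i)\<close>,
  whose values at \<open>p\<close> depend on \<open>X p\<close> only.
\<close>

lemma alt_pointwise_front:
  assumes \<omega>: "alt \<omega>" and X: "X \<in> VF" and Y: "Y \<in> VF" and Zs: "Zs \<in> lists VF" and eq: "X p = Y p"
  shows "\<omega> (X # Zs) p = \<omega> (Y # Zs) p"
proof -
  obtain \<rho> and I :: "'b option set" and g F where fr: "\<rho> \<in> C" "\<rho> p \<noteq> 0" "finite I"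
    "\<forall>i\<in>I. g i \<in> C \<and> F i \<in> VF" and fr': "\<forall>q f. \<forall>v\<in>T q. \<rho> q * v f = (\<Sum>i\<in>I. v (g i) * F i q f)"
    using local_frame[of p] .
  have F: "F i \<in> VF" if "i \<in> I" for i using fr(4) that by blast
  have *: "\<rho> p * \<omega> (Z # Zs) p = (\<Sum>i\<in>I. Z p (g i) * \<omega> (F i # Zs) p)" if Z: "Z \<in> VF" for Z
  proof -
    have sm: "smul (act Z (g i)) (F i) \<in> VF" if "i \<in> I" for i
      using F[OF that] Z by (simp add: VF_smul act_C)
    have "smul \<rho> Z = (\<Sum>i\<in>I. smul (act Z (g i)) (F i))"
      by (intro ext) (simp add: smul_def sum_field_apply act_def fr'[rule_format, OF VF_T[OF Z]])
    then have "\<omega> (smul \<rho> Z # Zs) p = (\<Sum>i\<in>I. \<omega> (smul (act Z (g i)) (F i) # Zs) p)"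
      using alt_sum[OF \<omega> Zs fr(3) sm] by simp
    also have "\<dots> = (\<Sum>i\<in>I. Z p (g i) * \<omega> (F i # Zs) p)"
      by (intro sum.cong refl) (subst alt_smul[OF \<omega> F act_C[OF Z] Zs], assumption, simp add: fun_apply act_def)
    finally show ?thesis by (simp add: alt_smul[OF \<omega> Z fr(1) Zs] fun_apply)
  qed
  have "\<rho> p * \<omega> (X # Zs) p = \<rho> p * \<omega> (Y # Zs) p" unfolding *[OF X] *[OF Y] eq ..
  then show ?thesis using fr(2) by simp
qed

lemma alt_pointwise:
  "alt \<omega> \<Longrightarrow> Xs \<in> lists VF \<Longrightarrow> Ys \<in> lists VF \<Longrightarrow> map (\<lambda>X. X p) Xs = map (\<lambda>X. X p) Ys \<Longrightarrow> \<omega> Xs p = \<omega> Ys p"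
proof (induction Xs arbitrary: \<omega> Ys)
  case (Cons X Xs)
  then obtain Y Ys' where Y: "Ys = Y # Ys'" "X p = Y p" "map (\<lambda>X. X p) Xs = map (\<lambda>X. X p) Ys'"
    by (cases Ys) auto
  have "\<omega> (X # Xs) p = \<omega> (Y # Xs) p"
    using Cons.prems Y by (intro alt_pointwise_front) auto
  also have "\<dots> = ins Y \<omega> Xs p" by (simp add: ins_def)
  also have "\<dots> = ins Y \<omega> Ys' p"
    using Cons.prems Y by (intro Cons.IH alt_ins) auto
  finally show ?case by (simp add: ins_def Y)
qed simp

lemma ex_field_through:
  assumes v: "v \<in> T p"
  shows "\<exists>X\<in>VF. X p = v"
proof -
  obtain \<rho> and I :: "'b option set" and g F where fr: "\<rho> \<in> C" "\<rho> p \<noteq> 0" "finite I"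
    "\<forall>i\<in>I. g i \<in> C \<and> F i \<in> VF" and fr': "\<forall>q f. \<forall>v\<in>T q. \<rho> q * v f = (\<Sum>i\<in>I. v (g i) * F i q f)"
    using local_frame[of p] .
  have F: "F i \<in> VF" if "i \<in> I" for i using fr(4) that by blast
  let ?X = "\<Sum>i\<in>I. smul (\<lambda>q. v (g i) / \<rho> p) (F i)"
  have "?X \<in> VF" by (intro VF_sum VF_smul C_const F)
  moreover have "?X p f = v f" for f
    using fr'[rule_format, OF v, of f] fr(2)
    by (simp add: sum_field_apply smul_def sum_divide_distrib[symmetric] field_simps)
  ultimately show ?thesis by blast
qed

lemma ex_fields_through:
  "set vs \<subseteq> T p \<Longrightarrow> \<exists>Xs\<in>lists VF. map (\<lambda>X. X p) Xs = vs"
proof (induction vs)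
  case (Cons v vs)
  then obtain X Xs where "X \<in> VF" "X p = v" "Xs \<in> lists VF" "map (\<lambda>X. X p) Xs = vs"
    using ex_field_through[of v p] by auto
  then show ?case by (intro bexI[of _ "X # Xs"]) auto
qed (auto intro: bexI[of _ "[]"])

section \<open>The Koszul formula\<close>

lemma nths_omit:
  "nths (x # xs) (- {0}) = xs" "nths (x # xs) (- {Suc i}) = x # nths xs (- {i})"
  "nths (x # xs) (- {0, Suc i}) = nths xs (- {i})" "nths (x # xs) (- {Suc i, Suc j}) = x # nths xs (- {i, j})"
proof -
  have e: "{j. Suc j \<in> - {0}} = UNIV" "{j. Suc j \<in> - {Suc i}} = - {i}" "{k. Suc k \<in> - {Suc i, Suc j}} = - {i, j}"
        "{j. Suc j \<in> - {0, Suc i}} = - {i}" by auto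
  show "nths (x # xs) (- {0}) = xs" "nths (x # xs) (- {Suc i}) = x # nths xs (- {i})"
    "nths (x # xs) (- {0, Suc i}) = nths xs (- {i})" "nths (x # xs) (- {Suc i, Suc j}) = x # nths xs (- {i, j})"
    unfolding nths_Cons e by (simp_all add: nths_all)
qed

lemma Lie_formula:
  assumes X: "X \<in> VF"
  shows "alt \<omega> \<Longrightarrow> Xs \<in> lists VF \<Longrightarrow> Lie X \<omega> Xs p = X p (\<omega> Xs)
     - (\<Sum>j<length Xs. (-1) ^ j * \<omega> (lie_bracket X (Xs ! j) # nths Xs (- {j})) p)"
proof (induction Xs arbitrary: \<omega>)
  case Nil show ?case by (simp add: Lie_Nil act_def)
next
  case (Cons Y Ys)
  then have Y: "Y \<in> VF" and Ys: "Ys \<in> lists VF" and \<omega>: "alt \<omega>" by auto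
  have n: "nths Ys A \<in> lists VF" for A using Ys set_nths_subset[of Ys A] by auto
  have sw: "\<omega> (lie_bracket X (Ys ! j) # Y # nths Ys (- {j})) p = - \<omega> (Y # lie_bracket X (Ys ! j) # nths Ys (- {j})) p"
    if "j < length Ys" for j
  proof -
    have "Ys ! j \<in> VF" using that Ys by (simp add: in_lists_conv_set)
    then show ?thesis using alt_swap[OF \<omega> bracket_VF[OF X] Y n] by (simp add: fun_apply)
  qed
  have "Lie X \<omega> (Y # Ys) p = Lie X (ins Y \<omega>) Ys p - \<omega> (lie_bracket X Y # Ys) p"
    using alt_uminus_arg[OF \<omega> bracket_VF[OF X Y] Ys] by (simp add: Lie_Cons fun_apply)
  also have "Lie X (ins Y \<omega>) Ys p = X p (\<omega> (Y # Ys))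
     - (\<Sum>j<length Ys. (-1) ^ j * \<omega> (Y # lie_bracket X (Ys ! j) # nths Ys (- {j})) p)"
    using Cons.IH[OF alt_ins[OF \<omega> Y] Ys] by (simp add: ins_def)
  finally show ?case
    by (simp add: sum.lessThan_Suc_shift nths_omit sw sum_negf del: sum.lessThan_Suc)
qed

text \<open>
  The double sum splits according to whether the first argument is omitted. The terms in which it
  is omitted make up \<open>L\<^sub>X\<close>, by the preceding formula; in the others \<open>X\<close> is moved to the front, which
  costs a sign and leaves the Koszul formula for \<open>\<iota>\<^sub>X\<close>.
\<close>

lemma koszul_eq_D:
  assumes "alt (eval_form \<alpha>)" and "Xs \<in> lists VF"
  shows "koszul \<alpha> Xs p = D (eval_form \<alpha>) Xs p"
proof -
  let ?K = "\<lambda>\<omega> Xs. (\<Sum>i<length Xs. (-1) ^ i * (Xs ! i) p (\<omega> (nths Xs (- {i}))))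
     + (\<Sum>j<length Xs. \<Sum>i<j. (-1) ^ (i + j) * \<omega> (lie_bracket (Xs ! i) (Xs ! j) # nths Xs (- {i, j})) p)"
  \<comment> \<open>The recursion passes to contractions, which need not come from forms; hence the generalization.\<close>
  have "?K \<omega> Xs = D \<omega> Xs p" if "alt \<omega>" "Xs \<in> lists VF" for \<omega> Xs
    using that
  proof (induction Xs arbitrary: \<omega>)
    case Nil show ?case by (simp add: D_Nil fun_apply)
  next
    case (Cons X Xs)
    then have X: "X \<in> VF" and Xs: "Xs \<in> lists VF" and \<omega>: "alt \<omega>" by auto
    have n: "nths Xs A \<in> lists VF" for A using Xs set_nths_subset[of Xs A] by auto
    have sw: "\<omega> (lie_bracket (Xs ! i) (Xs ! j) # X # nths Xs A) p = - \<omega> (X # lie_bracket (Xs ! i) (Xs ! j) # nths Xs A) p"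
      if "i < length Xs" "j < length Xs" for i j A
    proof -
      have "Xs ! j \<in> VF" "Xs ! i \<in> VF" using that Xs by (simp_all add: in_lists_conv_set)
      then show ?thesis using alt_swap[OF \<omega> bracket_VF X n] by (simp add: fun_apply)
    qed
    have first: "(\<Sum>i<length (X # Xs). (-1) ^ i * ((X # Xs) ! i) p (\<omega> (nths (X # Xs) (- {i}))))
       = X p (\<omega> Xs) - (\<Sum>i<length Xs. (-1) ^ i * (Xs ! i) p (ins X \<omega> (nths Xs (- {i}))))"
      by (simp add: sum.lessThan_Suc_shift nths_omit sum_negf ins_def del: sum.lessThan_Suc)
    have second: "(\<Sum>j<length (X # Xs). \<Sum>i<j. (-1) ^ (i + j) * \<omega> (lie_bracket ((X # Xs) ! i) ((X # Xs) ! j) # nths (X # Xs) (- {i, j})) p)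
      = - (\<Sum>j<length Xs. (-1) ^ j * \<omega> (lie_bracket X (Xs ! j) # nths Xs (- {j})) p)
        - (\<Sum>j<length Xs. \<Sum>i<j. (-1) ^ (i + j) * ins X \<omega> (lie_bracket (Xs ! i) (Xs ! j) # nths Xs (- {i, j})) p)"
    proof -
      have "(\<Sum>j<length (X # Xs). \<Sum>i<j. (-1) ^ (i + j) * \<omega> (lie_bracket ((X # Xs) ! i) ((X # Xs) ! j) # nths (X # Xs) (- {i, j})) p)
        = (\<Sum>j<length Xs. - ((-1) ^ j * \<omega> (lie_bracket X (Xs ! j) # nths Xs (- {j})) p)
           - (\<Sum>i<j. (-1) ^ (i + j) * ins X \<omega> (lie_bracket (Xs ! i) (Xs ! j) # nths Xs (- {i, j})) p))"
        unfolding list.size add_0_right add_Suc_right sum.lessThan_Suc_shift[of _ "length Xs"]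
          lessThan_0 sum.empty add_0_left
      proof (rule sum.cong[OF refl])
        fix j assume j: "j \<in> {..<length Xs}"
        have "(\<Sum>i<j. (-1) ^ (i + j) * \<omega> (lie_bracket (Xs ! i) (Xs ! j) # X # nths Xs (- {i, j})) p)
          = (\<Sum>i<j. - ((-1) ^ (i + j) * ins X \<omega> (lie_bracket (Xs ! i) (Xs ! j) # nths Xs (- {i, j})) p))"
          using j by (intro sum.cong refl) (simp add: sw ins_def)
        then show "(\<Sum>i<Suc j. (-1) ^ Suc (i + j) * \<omega> (lie_bracket ((X # Xs) ! i) ((X # Xs) ! Suc j) # nths (X # Xs) (- {i, Suc j})) p)
          = - ((-1) ^ j * \<omega> (lie_bracket X (Xs ! j) # nths Xs (- {j})) p)
            - (\<Sum>i<j. (-1) ^ (i + j) * ins X \<omega> (lie_bracket (Xs ! i) (Xs ! j) # nths Xs (- {i, j})) p)"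
          by (simp add: sum.lessThan_Suc_shift nths_omit sum_negf del: sum.lessThan_Suc)
      qed
      then show ?thesis by (simp add: sum_subtractf sum_negf)
    qed
    have "?K \<omega> (X # Xs) = Lie X \<omega> Xs p - ?K (ins X \<omega>) Xs"
      unfolding first second Lie_formula[OF X \<omega> Xs] by simp
    also have "?K (ins X \<omega>) Xs = D (ins X \<omega>) Xs p" by (rule Cons.IH[OF alt_ins[OF \<omega> X] Xs])
    finally show ?case by (simp add: D_Cons fun_apply)
  qed
  from this[OF assms] show ?thesis unfolding koszul_def .
qed

section \<open>The inverse of an invertible field of endomorphisms\<close>

text \<open>
  Gaussian elimination without divisions. If the matrix has trivial kernel at \<open>p\<close>, then in the
  column of \<open>k\<close> some entry does not vanish at \<open>p\<close>; cross-multiplication with this pivot eliminates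
  the unknown \<open>u\<^sub>k\<close>, and the pivot becomes a factor of \<open>s\<close>. The system may have any number of
  equations.
\<close>

lemma solution_of_smooth_linear_system:
  assumes "finite J"
  shows "(\<And>i j. i \<in> K \<Longrightarrow> j \<in> J \<Longrightarrow> a i j \<in> C) \<Longrightarrow> (\<And>i. i \<in> K \<Longrightarrow> b i \<in> C) \<Longrightarrow>
    (\<And>i q. i \<in> K \<Longrightarrow> (\<Sum>j\<in>J. a i j q * u j q) = b i q) \<Longrightarrow>
    (\<And>c :: 'j \<Rightarrow> real. (\<And>i. i \<in> K \<Longrightarrow> (\<Sum>j\<in>J. a i j p * c j) = 0) \<Longrightarrow> \<forall>j\<in>J. c j = 0) \<Longrightarrow>
    \<exists>s\<in>C. s p \<noteq> 0 \<and> (\<forall>j\<in>J. (\<lambda>q. s q * u j q) \<in> C)"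
  using assms
proof (induction J arbitrary: a b)
  case empty
  show ?case using C_const[of 1] by (intro bexI[of _ "\<lambda>q. 1"]) auto
next
  case (insert k J)
  note aC = insert.prems(1) and bC = insert.prems(2) and sys = insert.prems(3) and inj = insert.prems(4)
  have "\<exists>i0\<in>K. a i0 k p \<noteq> 0"
  proof (rule ccontr)
    assume "\<not> ?thesis"
    moreover have "(\<Sum>j\<in>J. a i j p * (if j = k then 1 else 0)) = 0" for i
      using insert.hyps by (intro sum.neutral) auto
    ultimately have "\<forall>j\<in>insert k J. (if j = k then 1 else 0::real) = 0"
      using insert.hyps by (intro inj) simp
    then show False by simp
  qed
  then obtain i0 where i0: "i0 \<in> K" "a i0 k p \<noteq> 0" by blast
  have split: "a i k q * u k q + (\<Sum>j\<in>J. a i j q * u j q) = b i q" if "i \<in> K" for i q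
    using sys[OF that, of q] insert.hyps by simp
  define a' where "a' i j = (\<lambda>q. a i0 k q * a i j q - a i k q * a i0 j q)" for i j
  define b' where "b' i = (\<lambda>q. a i0 k q * b i q - a i k q * b i0 q)" for i
  have elim: "(\<Sum>j\<in>J. a' i j q * w j) = a i0 k q * (\<Sum>j\<in>J. a i j q * w j) - a i k q * (\<Sum>j\<in>J. a i0 j q * w j)" for i q w
    by (simp add: a'_def sum_distrib_left sum_subtractf algebra_simps)
  have "\<exists>s\<in>C. s p \<noteq> 0 \<and> (\<forall>j\<in>J. (\<lambda>q. s q * u j q) \<in> C)"
  proof (rule insert.IH[of a' b'])
    show "a' i j \<in> C" if "i \<in> K" "j \<in> J" for i j
      unfolding a'_def using aC that i0(1) by (intro C_intros) auto
    show "b' i \<in> C" if "i \<in> K" for i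
      unfolding b'_def using aC bC that i0(1) by (intro C_intros) auto
    show "(\<Sum>j\<in>J. a' i j q * u j q) = b' i q" if "i \<in> K" for i q
      unfolding elim b'_def split[OF that, symmetric] split[OF i0(1), symmetric] by (simp add: algebra_simps)
    fix c :: "'j \<Rightarrow> real" assume c: "\<And>i. i \<in> K \<Longrightarrow> (\<Sum>j\<in>J. a' i j p * c j) = 0"
    define c' where "c' j = (if j = k then - (\<Sum>j\<in>J. a i0 j p * c j) / a i0 k p else c j)" for j
    have c'J: "(\<Sum>j\<in>J. a i j p * c' j) = (\<Sum>j\<in>J. a i j p * c j)" for i
      using insert.hyps by (intro sum.cong) (auto simp: c'_def)
    have "(\<Sum>j\<in>insert k J. a i j p * c' j) = 0" if "i \<in> K" for i
    proof -
      have "a i0 k p * (\<Sum>j\<in>insert k J. a i j p * c' j) = (\<Sum>j\<in>J. a' i j p * c j)"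
        using insert.hyps i0(2) unfolding elim by (simp add: c'J) (simp add: c'_def field_simps)
      then show ?thesis using c[OF that] i0(2) by simp
    qed
    then have "\<forall>j\<in>insert k J. c' j = 0" by (rule inj)
    then show "\<forall>j\<in>J. c j = 0" using insert.hyps by (auto simp: c'_def split: if_splits)
  qed
  then obtain s where s: "s \<in> C" "s p \<noteq> 0" "\<And>j. j \<in> J \<Longrightarrow> (\<lambda>q. s q * u j q) \<in> C" by blast
  have ak: "a i0 k \<in> C" using aC i0(1) by simp
  have "(\<lambda>q. s q * a i0 k q * u j q) \<in> C" if "j \<in> insert k J" for j
  proof (cases "j = k")
    case True
    have "(\<lambda>q. a i0 j q * (s q * u j q)) \<in> C" if "j \<in> J" for j
      using aC[OF i0(1), of j] s(3)[OF that] that C_mult[of "a i0 j" "\<lambda>q. s q * u j q"] by auto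
    then have "(\<lambda>q. s q * b i0 q - (\<Sum>j\<in>J. a i0 j q * (s q * u j q))) \<in> C"
      by (intro C_diff C_sum C_mult[OF s(1) bC[OF i0(1)]])
    moreover have "s q * b i0 q - (\<Sum>j\<in>J. a i0 j q * (s q * u j q)) = s q * a i0 k q * u j q" for q
      unfolding split[OF i0(1), symmetric] True by (simp add: sum_distrib_left algebra_simps)
    ultimately show ?thesis by simp
  next
    case False
    then have "(\<lambda>q. a i0 k q * (s q * u j q)) \<in> C" using that s(3) ak C_mult[of "a i0 k" "\<lambda>q. s q * u j q"] by auto
    then show ?thesis by (simp add: mult_ac)
  qed
  with s i0(2) show ?case by (intro bexI[of _ "\<lambda>q. s q * a i0 k q"] C_mult ak) auto
qed

lemma C_if: "f \<in> C \<Longrightarrow> (\<lambda>q. if b then f q else 0) \<in> C"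
  by (cases b) (simp_all add: C_const)

lemma endoD:
  assumes "L \<in> endo_fields M"
  shows "v \<in> T p \<Longrightarrow> L p v \<in> T p" "v \<in> T p \<Longrightarrow> w \<in> T p \<Longrightarrow> L p (v + w) = L p v + L p w"
    "v \<in> T p \<Longrightarrow> L p (\<lambda>f. c * v f) = (\<lambda>f. c * L p v f)" "X \<in> VF \<Longrightarrow> apply_field L X \<in> VF"
  using assms by (auto simp: endo_fields_def)

lemma linear_op_apply_field: "L \<in> endo_fields M \<Longrightarrow> linear_op (apply_field L)"
  unfolding linear_op_def
  by (intro ballI conjI ext) (auto simp: endoD apply_field_def smul_def VF_T fun_apply endoD(4)[unfolded apply_field_def])

lemma endo_zero: "L \<in> endo_fields M \<Longrightarrow> L p (\<lambda>f. 0) = (\<lambda>f. 0)"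
  using endoD(3)[of L "\<lambda>f. 0" p 0] T_0 by simp

lemma T_lincomb: "(\<And>i. i \<in> I \<Longrightarrow> v i \<in> T p) \<Longrightarrow> (\<lambda>f. \<Sum>i\<in>I. c i * v i f) \<in> T p"
proof (induction I rule: infinite_finite_induct)
  case (insert x F)
  then have "(\<lambda>f. c x * v x f) + (\<lambda>f. \<Sum>i\<in>F. c i * v i f) \<in> T p" by (intro T_plus T_scale) auto
  with insert show ?case by (simp add: plus_fun_def)
qed (auto intro: T_0)

lemma endo_lincomb:
  assumes L: "L \<in> endo_fields M"
  shows "(\<And>i. i \<in> I \<Longrightarrow> v i \<in> T p) \<Longrightarrow> L p (\<lambda>f. \<Sum>i\<in>I. c i * v i f) = (\<lambda>f. \<Sum>i\<in>I. c i * L p (v i) f)"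
proof (induction I rule: infinite_finite_induct)
  case (insert x F)
  have "L p ((\<lambda>f. c x * v x f) + (\<lambda>f. \<Sum>i\<in>F. c i * v i f)) = L p (\<lambda>f. c x * v x f) + L p (\<lambda>f. \<Sum>i\<in>F. c i * v i f)"
    using insert.prems by (intro endoD(2)[OF L] T_lincomb T_scale) auto
  also have "\<dots> = (\<lambda>f. c x * L p (v x) f) + (\<lambda>f. \<Sum>i\<in>F. c i * L p (v i) f)"
    using insert.IH insert.prems by (simp add: endoD(3)[OF L])
  finally show ?case using insert.hyps by (simp add: plus_fun_def)
qed (auto simp: endo_zero[OF L])

context
  fixes R :: "'m endo_field"
  assumes R: "R \<in> invertible_endo_fields M"
begin

lemma R_endo: "R \<in> endo_fields M"
  using R by (simp add: invertible_endo_fields_def)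

lemma R_bij: "bij_betw (R p) (T p) (T p)"
  using R by (simp add: invertible_endo_fields_def)

lemma inverse_field_T: "v \<in> T p \<Longrightarrow> inverse_field M R p v \<in> T p"
  using R_bij[of p] unfolding inverse_field_def bij_betw_def by (metis inv_into_into)

lemma R_inverse: "v \<in> T p \<Longrightarrow> R p (inverse_field M R p v) = v"
  using R_bij[of p] unfolding inverse_field_def bij_betw_def by (simp add: f_inv_into_f)

lemma inverse_R: "v \<in> T p \<Longrightarrow> inverse_field M R p (R p v) = v"
  using R_bij[of p] unfolding inverse_field_def bij_betw_def by simp

text \<open>
  For \<open>Z = R\<^sup>-\<^sup>1 X\<close> the functions \<open>u\<^sub>k = Z(g\<^sub>k)\<close> of a local frame solve the system
  \<open>\<Sum>\<^sub>k (R X\<^sub>k)(g\<^sub>i) u\<^sub>k = \<rho> X(g\<^sub>i)\<close>, which is \<open>R\<close> applied to \<open>\<rho> Z = \<Sum>\<^sub>k u\<^sub>k X\<^sub>k\<close>. As the fields of the frame are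
  linearly dependent, this does not determine the \<open>u\<^sub>k\<close>; the equations \<open>\<rho> u\<^sub>i = \<Sum>\<^sub>k u\<^sub>k X\<^sub>k(g\<^sub>i)\<close> are added, which
  express that the \<open>u\<^sub>k\<close> come from a tangent vector. The indices \<open>Inl i\<close> and \<open>Inr i\<close> stand for the two kinds
  of equations, and the fields \<open>X\<^sub>k\<close> of the frame are called \<open>F k\<close>.
\<close>

lemma inverse_field_VF:
  assumes X: "X \<in> VF"
  shows "apply_field (inverse_field M R) X \<in> VF"
proof (rule VFI)
  let ?Z = "apply_field (inverse_field M R) X"
  show Z: "?Z p \<in> T p" for p
    unfolding apply_field_def by (rule inverse_field_T[OF VF_T[OF X]])
  have RZ: "R q (?Z q) = X q" for q
    unfolding apply_field_def by (rule R_inverse[OF VF_T[OF X]])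
  fix f assume f: "f \<in> C"
  show "(\<lambda>p. ?Z p f) \<in> C"
  proof (rule C_local_quotient)
    fix p
    obtain \<rho> and I :: "'b option set" and g F where fr: "\<rho> \<in> C" "\<rho> p \<noteq> 0" "finite I"
      "\<forall>i\<in>I. g i \<in> C \<and> F i \<in> VF" and fr': "\<forall>q f. \<forall>v\<in>T q. \<rho> q * v f = (\<Sum>i\<in>I. v (g i) * F i q f)"
      using local_frame[of p] .
    have F: "F i \<in> VF" if "i \<in> I" for i using fr(4) that by blast
    have FT: "F i q \<in> T q" if "i \<in> I" for i q using VF_T[OF F[OF that]] .
    define u where "u i q = ?Z q (g i)" for i q
    define a where "a t k = (case t of Inl i \<Rightarrow> (\<lambda>q. R q (F k q) (g i))
        | Inr i \<Rightarrow> (\<lambda>q. (if i = k then \<rho> q else 0) - F k q (g i)))" for t k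
    define b where "b t = (case t of Inl i \<Rightarrow> (\<lambda>q. \<rho> q * X q (g i)) | Inr (i :: 'b option) \<Rightarrow> (\<lambda>q. 0))" for t
    have Zf: "\<rho> q * ?Z q h = (\<Sum>k\<in>I. u k q * F k q h)" for q h
      unfolding u_def using fr'[rule_format, OF Z] .
    have Inl: "(\<Sum>k\<in>I. R q (F k q) (g i) * c k) = R q (\<lambda>h. \<Sum>k\<in>I. c k * F k q h) (g i)" for q c i
      using endo_lincomb[OF R_endo, of I "\<lambda>k. F k q" q c] FT by (simp add: mult.commute)
    have Inr: "(\<Sum>k\<in>I. ((if i = k then \<rho> q else 0) - F k q (g i)) * c k) = \<rho> q * c i - (\<Sum>k\<in>I. c k * F k q (g i))"
      if "i \<in> I" for q c i
    proof -
      have "(\<Sum>k\<in>I. ((if i = k then \<rho> q else 0) - F k q (g i)) * c k)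
          = (\<Sum>k\<in>I. (if i = k then \<rho> q * c k else 0) - c k * F k q (g i))"
        by (intro sum.cong refl) (simp add: algebra_simps)
      then show ?thesis using that fr(3) by (simp add: sum_subtractf)
    qed
    have "\<exists>s\<in>C. s p \<noteq> 0 \<and> (\<forall>k\<in>I. (\<lambda>q. s q * u k q) \<in> C)"
    proof (rule solution_of_smooth_linear_system[OF fr(3), where K = "Inl ` I \<union> Inr ` I" and a = a and b = b])
      show "a t k \<in> C" if "t \<in> Inl ` I \<union> Inr ` I" "k \<in> I" for t k
        using that fr(1,4) VF_C[OF endoD(4)[OF R_endo F[OF that(2)]]] VF_C[OF F[OF that(2)]]
        by (auto simp: a_def apply_field_def intro!: C_diff C_const C_if)
      show "b t \<in> C" if "t \<in> Inl ` I \<union> Inr ` I" for t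
        using that fr(1,4) VF_C[OF X] by (auto simp: b_def intro!: C_mult C_const)
      show "(\<Sum>k\<in>I. a t k q * u k q) = b t q" if "t \<in> Inl ` I \<union> Inr ` I" for t q
        using that
      proof
        assume "t \<in> Inl ` I"
        then obtain i where t: "t = Inl i" by auto
        have "(\<lambda>h. \<Sum>k\<in>I. u k q * F k q h) = (\<lambda>h. \<rho> q * ?Z q h)" by (simp add: Zf)
        then show ?thesis
          using endoD(3)[OF R_endo Z] RZ by (simp add: a_def b_def t Inl)
      next
        assume "t \<in> Inr ` I"
        then obtain i where t: "t = Inr i" "i \<in> I" by auto
        then show ?thesis using Zf[of q "g i"] by (simp add: a_def b_def Inr u_def)
      qed
      fix c :: "'b option \<Rightarrow> real"
      assume c: "\<And>t. t \<in> Inl ` I \<union> Inr ` I \<Longrightarrow> (\<Sum>k\<in>I. a t k p * c k) = 0"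
      \<comment> \<open>A solution of the homogeneous system at \<open>p\<close> gives a tangent vector that is killed by \<open>R\<close>, hence
        zero, and by the second kind of equations its coefficients vanish.\<close>
      let ?w = "\<lambda>h. \<Sum>k\<in>I. c k * F k p h"
      have w: "?w \<in> T p" by (intro T_lincomb FT)
      have Rw: "R p ?w \<in> T p" by (rule endoD(1)[OF R_endo w])
      have "R p ?w (g i) = 0" if "i \<in> I" for i
        using c[of "Inl i"] that by (simp add: a_def Inl)
      then have "\<rho> p * R p ?w h = 0" for h using fr'[rule_format, OF Rw] by simp
      then have "R p ?w = (\<lambda>h. 0)" using fr(2) by auto
      then have "R p ?w = R p (\<lambda>h. 0)" by (simp add: endo_zero[OF R_endo])
      then have w0: "?w = (\<lambda>h. 0)"
        using R_bij[of p] w T_0 unfolding bij_betw_def inj_on_def by blast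
      show "\<forall>k\<in>I. c k = 0"
      proof
        fix k assume k: "k \<in> I"
        have "\<rho> p * c k - ?w (g k) = 0"
          using c[of "Inr k"] k by (simp add: a_def Inr)
        then show "c k = 0" using fr(2) fun_cong[OF w0, of "g k"] by simp
      qed
    qed
    then obtain s where s: "s \<in> C" "s p \<noteq> 0" "\<And>k. k \<in> I \<Longrightarrow> (\<lambda>q. s q * u k q) \<in> C" by blast
    have "(\<lambda>q. \<Sum>k\<in>I. (s q * u k q) * F k q f) \<in> C"
      by (intro C_sum C_mult s(3) VF_C F)
    moreover have "(\<Sum>k\<in>I. (s q * u k q) * F k q f) = (s q * \<rho> q) * ?Z q f" for q
      using Zf[of q f] by (simp add: sum_distrib_left[symmetric] mult.assoc)
    ultimately show "\<exists>s\<in>C. s p \<noteq> 0 \<and> (\<lambda>q. s q * ?Z q f) \<in> C"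
      using s fr(1,2) by (intro bexI[of _ "\<lambda>q. s q * \<rho> q"] C_mult) auto
  qed
qed

lemma inverse_field_endo: "inverse_field M R \<in> endo_fields M"
proof -
  let ?Q = "inverse_field M R"
  have "?Q p (v + w) = ?Q p v + ?Q p w" if "v \<in> T p" "w \<in> T p" for p v w
  proof -
    have "R p (?Q p v + ?Q p w) = v + w"
      using that by (simp add: endoD(2)[OF R_endo] inverse_field_T R_inverse)
    then have "?Q p (v + w) = ?Q p (R p (?Q p v + ?Q p w))" by simp
    then show ?thesis using that by (simp add: inverse_R inverse_field_T T_plus)
  qed
  moreover have "?Q p (\<lambda>f. c * v f) = (\<lambda>f. c * ?Q p v f)" if "v \<in> T p" for p v c
  proof -
    have "R p (\<lambda>f. c * ?Q p v f) = (\<lambda>f. c * v f)"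
      using that by (simp add: endoD(3)[OF R_endo] inverse_field_T R_inverse)
    then have "?Q p (\<lambda>f. c * v f) = ?Q p (R p (\<lambda>f. c * ?Q p v f))" by simp
    then show ?thesis using that by (simp add: inverse_R inverse_field_T T_scale)
  qed
  ultimately show ?thesis
    unfolding endo_fields_def using inverse_field_T inverse_field_VF by blast
qed

end


section \<open>Differential forms as alternating multilinear maps\<close>

lemma forms_alt:
  assumes \<alpha>: "\<alpha> \<in> forms M"
  shows "alt (eval_form \<alpha>)"
proof (rule altI)
  fix Ys assume Ys: "Ys \<in> lists VF"
  have set_T: "set (map (\<lambda>X. X p) Xs) \<subseteq> T p" if "Xs \<in> lists VF" for Xs p
    using that VF_T by auto
  have mult: "\<And>p vs i u w. set vs \<subseteq> T p \<Longrightarrow> i < length vs \<Longrightarrow> u \<in> T p \<Longrightarrow> w \<in> T p \<Longrightarrow>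
      \<alpha> p (vs[i := u + w]) = \<alpha> p (vs[i := u]) + \<alpha> p (vs[i := w])"
    "\<And>p vs i u c. set vs \<subseteq> T p \<Longrightarrow> i < length vs \<Longrightarrow> u \<in> T p \<Longrightarrow>
      \<alpha> p (vs[i := (\<lambda>f. c * u f)]) = c * \<alpha> p (vs[i := u])"
    "\<And>p vs i j. set vs \<subseteq> T p \<Longrightarrow> i < j \<Longrightarrow> j < length vs \<Longrightarrow> vs ! i = vs ! j \<Longrightarrow> \<alpha> p vs = 0"
    "\<And>Xs. set Xs \<subseteq> VF \<Longrightarrow> eval_form \<alpha> Xs \<in> C"
    using \<alpha> unfolding forms_def by blast+
  have upd: "(map (\<lambda>X. X p) (Ys @ X # Zs))[length Ys := v] = map (\<lambda>X. X p) Ys @ v # map (\<lambda>X. X p) Zs" for p X Zs v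
    using list_update_length[of "map (\<lambda>X. X p) Ys" "X p" "map (\<lambda>X. X p) Zs" v] by simp
  show "front (\<lambda>Xs. eval_form \<alpha> (Ys @ Xs))"
    unfolding front_def
  proof (intro conjI ballI)
    show "eval_form \<alpha> (Ys @ Xs) \<in> C" if "Xs \<in> lists VF" for Xs
      using mult(4)[of "Ys @ Xs"] Ys that by auto
    fix X Zs assume X: "X \<in> VF" and Zs: "Zs \<in> lists VF"
    have l: "Ys @ X # Zs \<in> lists VF" using Ys X Zs by simp
    show "eval_form \<alpha> (Ys @ (X + Y) # Zs) = eval_form \<alpha> (Ys @ X # Zs) + eval_form \<alpha> (Ys @ Y # Zs)" if Y: "Y \<in> VF" for Y
    proof
      fix p
      show "eval_form \<alpha> (Ys @ (X + Y) # Zs) p = (eval_form \<alpha> (Ys @ X # Zs) + eval_form \<alpha> (Ys @ Y # Zs)) p"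
        using mult(1)[OF set_T[OF l], of "length Ys" p "X p" "Y p"] VF_T[OF X, of p] VF_T[OF Y, of p]
        unfolding upd by (simp add: eval_form_def fun_apply)
    qed
    show "eval_form \<alpha> (Ys @ smul f X # Zs) = f * eval_form \<alpha> (Ys @ X # Zs)" for f
    proof
      fix p
      show "eval_form \<alpha> (Ys @ smul f X # Zs) p = (f * eval_form \<alpha> (Ys @ X # Zs)) p"
        using mult(2)[OF set_T[OF l], of "length Ys" p "X p" "f p"] VF_T[OF X, of p]
        unfolding upd by (simp add: eval_form_def fun_apply smul_def)
    qed
    show "eval_form \<alpha> (Ys @ X # X # Zs) = 0"
    proof
      fix p
      show "eval_form \<alpha> (Ys @ X # X # Zs) p = 0 p"
        unfolding eval_form_def fun_apply
        by (rule mult(3)[OF set_T, of _ "length Ys" "Suc (length Ys)"]) (use Ys X Zs in \<open>auto simp: nth_append\<close>)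
    qed
  qed
qed

text \<open>
  Every list of tangent vectors at a point extends to a list of vector fields.
\<close>

lemma form_eqI:
  assumes "\<And>p vs. \<not> set vs \<subseteq> T p \<Longrightarrow> \<alpha> p vs = \<beta> p vs"
    and "\<And>Xs. Xs \<in> lists VF \<Longrightarrow> eval_form \<alpha> Xs = eval_form \<beta> Xs"
  shows "\<alpha> = \<beta>"
proof (intro ext)
  fix p vs
  show "\<alpha> p vs = \<beta> p vs"
  proof (cases "set vs \<subseteq> T p")
    case True
    then obtain Xs where "Xs \<in> lists VF" "map (\<lambda>X. X p) Xs = vs" using ex_fields_through by blast
    then show ?thesis using fun_cong[OF assms(2), of Xs p] by (simp add: eval_form_def)
  qed (rule assms(1))
qed

text \<open>
  The extensions chosen in \<open>ext_d\<close> may be replaced by \<open>Xs\<close>, since the exterior derivative is itself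
  alternating and multilinear, so that its value at \<open>p\<close> depends only on the values at \<open>p\<close>.
\<close>

lemma eval_ext_d:
  assumes \<alpha>: "alt (eval_form \<alpha>)" and Xs: "Xs \<in> lists VF"
  shows "eval_form (ext_d M \<alpha>) Xs = D (eval_form \<alpha>) Xs"
proof
  fix p
  let ?vs = "map (\<lambda>X. X p) Xs"
  show "eval_form (ext_d M \<alpha>) Xs p = D (eval_form \<alpha>) Xs p"
  proof (cases "Xs = []")
    case True then show ?thesis by (simp add: eval_form_def ext_d_def D_Nil fun_apply)
  next
    case False
    define Ys where "Ys = (SOME Ys. set Ys \<subseteq> VF \<and> map (\<lambda>X. X p) Ys = ?vs)"
    have "\<exists>Ys. set Ys \<subseteq> VF \<and> map (\<lambda>X. X p) Ys = ?vs" using Xs by (intro exI[of _ Xs]) auto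
    then have "set Ys \<subseteq> VF \<and> map (\<lambda>X. X p) Ys = ?vs" unfolding Ys_def by (rule someI_ex)
    then have Ys: "Ys \<in> lists VF" "map (\<lambda>X. X p) Ys = ?vs" by auto
    have "eval_form (ext_d M \<alpha>) Xs p = koszul \<alpha> Ys p"
      using False Xs VF_T unfolding Ys_def by (auto simp: eval_form_def ext_d_def)
    also have "\<dots> = D (eval_form \<alpha>) Ys p" by (rule koszul_eq_D[OF \<alpha> Ys(1)])
    also have "\<dots> = D (eval_form \<alpha>) Xs p" by (rule alt_pointwise[OF alt_D[OF \<alpha>] Ys(1) Xs Ys(2)])
    finally show ?thesis .
  qed
qed

lemma eval_pull_form:
  assumes Xs: "Xs \<in> lists VF"
  shows "eval_form (pull_form M L \<alpha>) Xs = pull (apply_field L) (eval_form \<alpha>) Xs"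
  using Xs VF_T by (auto simp: eval_form_def pull_form_def pull_def apply_field_def fun_eq_iff o_def)

lemma Der_zero_sum: "Der (\<lambda>f. 0) A \<omega> Xs p = (\<Sum>h<length Xs. \<omega> (Xs[h := A (Xs ! h)]) p)"
proof (induction Xs arbitrary: \<omega>)
  case (Cons X Xs)
  have "Der (\<lambda>f. 0) A (ins X \<omega>) Xs p = (\<Sum>h<length Xs. \<omega> (X # Xs[h := A (Xs ! h)]) p)"
    unfolding Cons.IH by (simp add: ins_def)
  then have "Der (\<lambda>f. 0) A \<omega> (X # Xs) p = (\<Sum>h<length Xs. \<omega> (X # Xs[h := A (Xs ! h)]) p) + \<omega> (A X # Xs) p"
    unfolding Der_Cons plus_fun_apply by (rule arg_cong)
  then show "Der (\<lambda>f. 0) A \<omega> (X # Xs) p = (\<Sum>h<length (X # Xs). \<omega> ((X # Xs)[h := A ((X # Xs) ! h)]) p)"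
    unfolding list.size add_0_right add_Suc_right sum.lessThan_Suc_shift by simp
qed (simp add: fun_apply)

lemma eval_tau:
  assumes Xs: "Xs \<in> lists VF"
  shows "eval_form (tau M L \<alpha>) Xs = Der (\<lambda>f. 0) (apply_field L) (eval_form \<alpha>) Xs"
proof
  fix p
  have "set (map (\<lambda>X. X p) Xs) \<subseteq> T p" using Xs VF_T by auto
  then show "eval_form (tau M L \<alpha>) Xs p = Der (\<lambda>f. 0) (apply_field L) (eval_form \<alpha>) Xs p"
    unfolding Der_zero_sum
    by (simp add: eval_form_def tau_def map_update apply_field_def)
qed

lemma D_one: "D \<omega> [X] = act X (\<omega> [])"
  by (simp add: D_Cons D_Nil Lie_Nil)

lemma D_two: "D \<omega> [X, Y] = act X (\<omega> [Y]) + \<omega> [- lie_bracket X Y] - act Y (\<omega> [X])"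
  by (simp add: D_Cons D_Nil Lie_Nil Lie_Cons ins_def)

text \<open>
  A smooth function \<open>f\<close> as a form, and its differential \<open>df\<close>; these are the forms on which the
  operator identities are tested.
\<close>

definition function_form :: "('m \<Rightarrow> real) \<Rightarrow> 'm form" where
  "function_form f = (\<lambda>p vs. if vs = [] then f p else 0)"

definition differential :: "('m \<Rightarrow> real) \<Rightarrow> 'm form" where
  "differential f = (\<lambda>p vs. case vs of [v] \<Rightarrow> if v \<in> T p then v f else 0 | _ \<Rightarrow> 0)"

lemma function_form: "f \<in> C \<Longrightarrow> function_form f \<in> forms M"
  unfolding forms_def function_form_def eval_form_def by (auto intro: C_if)

lemma eval_function_form: "eval_form (function_form f) [] = f"
  by (simp add: function_form_def eval_form_def)

lemma eval_differential: "X \<in> VF \<Longrightarrow> eval_form (differential f) [X] = act X f"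
  using VF_T by (auto simp: differential_def eval_form_def act_def)

lemma differential: "differential f \<in> forms M"
proof -
  have single: "\<exists>v. vs = [v]" if "length vs = Suc 0" for vs :: "'m tangent_vector list"
    using that by (cases vs) auto
  have nz: "differential f p vs = 0" if "length vs \<noteq> Suc 0" for p vs
    using that by (auto simp: differential_def split: list.split)
  have "differential f p (vs[i := u + w]) = differential f p (vs[i := u]) + differential f p (vs[i := w])"
    "differential f p (vs[i := (\<lambda>f. c * u f)]) = c * differential f p (vs[i := u])"
    if "i < length vs" "u \<in> T p" "w \<in> T p" for p vs i u w c
  proof -
    have "(\<exists>v. vs = [v]) \<or> length vs \<noteq> Suc 0" using single by blast
    then show "differential f p (vs[i := u + w]) = differential f p (vs[i := u]) + differential f p (vs[i := w])"
      "differential f p (vs[i := (\<lambda>f. c * u f)]) = c * differential f p (vs[i := u])"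
      using that T_plus[of u p w] T_scale[of u p c] by (auto simp: nz) (auto simp: differential_def fun_apply)
  qed
  moreover have "eval_form (differential f) Xs \<in> C" if "set Xs \<subseteq> VF" for Xs
  proof (cases "length Xs = Suc 0")
    case True
    then obtain X where "Xs = [X]" by (cases Xs) auto
    then show ?thesis using that eval_differential act_C by simp
  next
    case False
    then show ?thesis by (simp add: eval_form_def nz C_const)
  qed
  moreover have "differential f p vs = 0" if "\<not> set vs \<subseteq> T p" for p vs
    using that by (auto simp: differential_def split: list.split)
  ultimately show ?thesis
    unfolding forms_def using T_0 by (auto intro!: nz)
qed

section \<open>The equivalences\<close>

context
  fixes R S :: "'m endo_field"
  assumes R: "R \<in> invertible_endo_fields M" and S: "S = (\<lambda>p v. R p v - v)"
begin

abbreviation "rR \<equiv> apply_field R"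
abbreviation "rR' \<equiv> apply_field (inverse_field M R)"
abbreviation "rS \<equiv> apply_field S"

lemma rS_eq: "rS X = rR X - X"
  unfolding S apply_field_def by (simp add: fun_diff_def)

lemma lin: "linear_op rR" "linear_op rR'" "linear_op rS"
proof -
  show 1: "linear_op rR" by (rule linear_op_apply_field[OF R_endo[OF R]])
  show "linear_op rR'" by (rule linear_op_apply_field[OF inverse_field_endo[OF R]])
  show "linear_op rS"
    unfolding linear_op_def rS_eq using linear_opD[OF 1]
    by (auto simp: VF_closed intro!: field_eqI simp: act_field_diff act_field_plus act_smul algebra_simps)
qed

lemma rR'_rR: "X \<in> VF \<Longrightarrow> rR' (rR X) = X"
  unfolding apply_field_def by (simp add: inverse_R[OF R] VF_T)

lemma rR_rR': "X \<in> VF \<Longrightarrow> rR (rR' X) = X"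
  unfolding apply_field_def by (simp add: R_inverse[OF R] VF_T)

text \<open>
  \<open>N\<^sub>R(X, Y) = R (R\<^sup>-\<^sup>1[RX, RY] + R[X, Y] - [RX, Y] - [X, RY])\<close>.
\<close>

lemma nijenhuis_eq_0_iff:
  assumes X: "X \<in> VF" and Y: "Y \<in> VF"
  shows "nijenhuis R X Y = 0 \<longleftrightarrow>
    rR' (lie_bracket (rR X) (rR Y)) = lie_bracket (rR X) Y + lie_bracket X (rR Y) - rR (lie_bracket X Y)"
proof -
  note l = linear_opD(1)[OF lin(1)] linear_opD(1)[OF lin(2)]
  have V: "lie_bracket (rR X) (rR Y) \<in> VF" "lie_bracket (rR X) Y \<in> VF" "lie_bracket X (rR Y) \<in> VF"
    "lie_bracket X Y \<in> VF" "rR (lie_bracket X Y) \<in> VF" "rR' (lie_bracket (rR X) (rR Y)) \<in> VF"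
    using X Y l by (simp_all add: VF_closed)
  let ?Z = "rR' (lie_bracket (rR X) (rR Y)) - (lie_bracket (rR X) Y + lie_bracket X (rR Y) - rR (lie_bracket X Y))"
  have Z: "?Z \<in> VF" using V by (simp add: VF_closed)
  have "nijenhuis R X Y = rR ?Z"
    using V by (simp add: nijenhuis_def linear_op_diff[OF lin(1)] linear_opD(2)[OF lin(1)] VF_closed rR_rR' algebra_simps)
  moreover have "rR ?Z = 0 \<longleftrightarrow> ?Z = 0"
    using rR'_rR[OF Z] linear_op_diff[OF lin(1) VF_0 VF_0] linear_op_diff[OF lin(2) VF_0 VF_0] by auto
  ultimately show ?thesis by simp
qed

abbreviation "dd \<equiv> ext_d M"
abbreviation "dR \<equiv> d_R M R"

lemma eval_d_R:
  assumes \<alpha>: "alt (eval_form \<alpha>)" and Xs: "Xs \<in> lists VF"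
  shows "eval_form (dR \<alpha>) Xs = pull rR (D (pull rR' (eval_form \<alpha>))) Xs"
proof -
  have RXs: "map rR Xs \<in> lists VF" using Xs linear_opD(1)[OF lin(1)] by auto
  have a: "alt (eval_form (pull_form M (inverse_field M R) \<alpha>))"
    by (rule alt_cong[OF alt_pull[OF lin(2) \<alpha>]]) (simp add: eval_pull_form)
  have "eval_form (dR \<alpha>) Xs = pull rR (eval_form (dd (pull_form M (inverse_field M R) \<alpha>))) Xs"
    unfolding d_R_def o_def by (rule eval_pull_form[OF Xs])
  also have "\<dots> = pull rR (D (eval_form (pull_form M (inverse_field M R) \<alpha>))) Xs"
    unfolding pull_def[of rR] by (rule eval_ext_d[OF a RXs])
  also have "\<dots> = pull rR (D (pull rR' (eval_form \<alpha>))) Xs"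
    unfolding pull_def[of rR] by (rule D_cong[OF _ RXs]) (rule eval_pull_form)
  finally show ?thesis .
qed

lemma alt_eval_ext_d: "alt (eval_form \<alpha>) \<Longrightarrow> alt (eval_form (dd \<alpha>))"
  by (rule alt_cong[OF alt_D]) (simp_all add: eval_ext_d)

lemma alt_eval_tau: "alt (eval_form \<alpha>) \<Longrightarrow> alt (eval_form (tau M S \<alpha>))"
  by (rule alt_cong[OF alt_Der[OF derivation_linear_op[OF lin(3)]]]) (simp_all add: eval_tau)

lemma alt_eval_d_R: "alt (eval_form \<alpha>) \<Longrightarrow> alt (eval_form (dR \<alpha>))"
  by (rule alt_cong[OF alt_pull[OF lin(1) alt_D[OF alt_pull[OF lin(2)]]]]) (simp_all add: eval_d_R)

lemma eval_comm_tau: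
  assumes \<alpha>: "alt (eval_form \<alpha>)" and Xs: "Xs \<in> lists VF"
  shows "eval_form (dd \<alpha> + graded_comm 0 1 (tau M S) dd \<alpha>) Xs
    = D (eval_form \<alpha>) Xs + (Der (\<lambda>f. 0) rS (D (eval_form \<alpha>)) Xs - D (Der (\<lambda>f. 0) rS (eval_form \<alpha>)) Xs)"
proof -
  have 1: "eval_form (tau M S (dd \<alpha>)) Xs = Der (\<lambda>f. 0) rS (D (eval_form \<alpha>)) Xs"
    unfolding eval_tau[OF Xs]
    by (rule Der_cong[OF derivation_linear_op[OF lin(3)] _ Xs]) (rule eval_ext_d[OF \<alpha>])
  have 2: "eval_form (dd (tau M S \<alpha>)) Xs = D (Der (\<lambda>f. 0) rS (eval_form \<alpha>)) Xs"
    unfolding eval_ext_d[OF alt_eval_tau[OF \<alpha>] Xs] by (rule D_cong[OF _ Xs]) (rule eval_tau)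
  have "eval_form (dd \<alpha> + graded_comm 0 1 (tau M S) dd \<alpha>) Xs
    = eval_form (dd \<alpha>) Xs + (eval_form (tau M S (dd \<alpha>)) Xs - eval_form (dd (tau M S \<alpha>)) Xs)"
    by (simp add: eval_form_def graded_comm_def fun_eq_iff fun_apply)
  then show ?thesis unfolding 1 2 eval_ext_d[OF \<alpha> Xs] .
qed

lemma eval_comm_d:
  assumes \<alpha>: "alt (eval_form \<alpha>)" and Xs: "Xs \<in> lists VF"
  shows "eval_form (graded_comm 1 1 dR dd \<alpha>) Xs
    = pull rR (D (pull rR' (D (eval_form \<alpha>)))) Xs + D (pull rR (D (pull rR' (eval_form \<alpha>)))) Xs"
proof -
  have RXs: "map rR Xs \<in> lists VF" using Xs linear_opD(1)[OF lin(1)] by auto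
  have "eval_form (dR (dd \<alpha>)) Xs = pull rR (D (pull rR' (D (eval_form \<alpha>)))) Xs"
    unfolding eval_d_R[OF alt_eval_ext_d[OF \<alpha>] Xs] pull_def[of rR]
  proof (rule D_cong[OF _ RXs])
    fix Ys assume "Ys \<in> lists VF"
    then have "map rR' Ys \<in> lists VF" using linear_opD(1)[OF lin(2)] by auto
    then show "pull rR' (eval_form (dd \<alpha>)) Ys = pull rR' (D (eval_form \<alpha>)) Ys"
      unfolding pull_def by (rule eval_ext_d[OF \<alpha>])
  qed
  moreover have "eval_form (dd (dR \<alpha>)) Xs = D (pull rR (D (pull rR' (eval_form \<alpha>)))) Xs"
    unfolding eval_ext_d[OF alt_eval_d_R[OF \<alpha>] Xs] by (rule D_cong[OF _ Xs]) (rule eval_d_R[OF \<alpha>])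
  moreover have "eval_form (graded_comm 1 1 dR dd \<alpha>) Xs = eval_form (dR (dd \<alpha>)) Xs + eval_form (dd (dR \<alpha>)) Xs"
    by (simp add: eval_form_def graded_comm_def fun_eq_iff fun_apply)
  ultimately show ?thesis by simp
qed

lemma off_tangent:
  assumes "\<not> set vs \<subseteq> T p"
  shows "dR \<alpha> p vs = 0" "dd \<alpha> p vs = 0" "tau M S \<alpha> p vs = 0"
  using assms by (auto simp: d_R_def pull_form_def ext_d_def tau_def)

lemma nijenhuis_imp_d_R:
  assumes N: "\<forall>X\<in>VF. \<forall>Y\<in>VF. nijenhuis R X Y = 0" and \<omega>: "alt \<omega>" and Xs: "Xs \<in> lists VF"
  shows "pull rR (D (pull rR' \<omega>)) Xs = D \<omega> Xs + (Der (\<lambda>f. 0) rS (D \<omega>) Xs - D (Der (\<lambda>f. 0) rS \<omega>) Xs)"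
proof (rule pull_D_pull[OF lin(1,2) rR'_rR lin(3) rS_eq _ \<omega> Xs])
  fix X Y assume XY: "X \<in> VF" "Y \<in> VF"
  then show "rR' (lie_bracket (rR X) (rR Y)) = lie_bracket (rR X) Y + lie_bracket X (rR Y) - rR (lie_bracket X Y)"
    using nijenhuis_eq_0_iff[OF XY] N by blast
qed

lemma nijenhuis_eq_0I:
  assumes X: "X \<in> VF" and Y: "Y \<in> VF"
    and eq: "\<And>f. f \<in> C \<Longrightarrow> act (rR' (lie_bracket (rR X) (rR Y))) f
      = act (lie_bracket (rR X) Y) f + act (lie_bracket X (rR Y)) f - act (rR (lie_bracket X Y)) f"
  shows "nijenhuis R X Y = 0"
  unfolding nijenhuis_eq_0_iff[OF X Y]
proof (rule field_eqI)
  fix f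
  note l = linear_opD(1)[OF lin(1)] linear_opD(1)[OF lin(2)]
  have V: "lie_bracket (rR X) Y + lie_bracket X (rR Y) - rR (lie_bracket X Y) \<in> VF" "rR' (lie_bracket (rR X) (rR Y)) \<in> VF"
    using X Y l by (simp_all add: VF_closed)
  show "act (rR' (lie_bracket (rR X) (rR Y))) f = act (lie_bracket (rR X) Y + lie_bracket X (rR Y) - rR (lie_bracket X Y)) f"
  proof (cases "f \<in> C")
    case True then show ?thesis by (simp add: eq act_field_plus act_field_diff)
  next
    case False
    then show ?thesis using T_zero_outside[OF VF_T[OF V(1)]] T_zero_outside[OF VF_T[OF V(2)]] by (simp add: act_def)
  qed
qed

text \<open>
  From left to right, the anticommutator is evaluated on a function and two vector fields. From
  right to left, \<open>d\<^sub>R = d + [\<tau>(S), d]\<close> and \<open>d \<circ> d = 0\<close> give \<open>d\<^sub>R d = - d \<tau>(S) d\<close> and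
  \<open>d d\<^sub>R = d \<tau>(S) d\<close>.
\<close>

lemma d_R_anticommutes_iff:
  "(\<forall>\<alpha>\<in>forms M. graded_comm 1 1 dR dd \<alpha> = 0) \<longleftrightarrow> (\<forall>X\<in>VF. \<forall>Y\<in>VF. nijenhuis R X Y = 0)"
proof
  assume comm: "\<forall>\<alpha>\<in>forms M. graded_comm 1 1 dR dd \<alpha> = 0"
  show "\<forall>X\<in>VF. \<forall>Y\<in>VF. nijenhuis R X Y = 0"
  proof (intro ballI nijenhuis_eq_0I)
    fix X Y f assume X: "X \<in> VF" and Y: "Y \<in> VF" and f: "f \<in> C"
    note l = linear_opD(1)[OF lin(1)] linear_opD(1)[OF lin(2)]
    define \<omega> where "\<omega> = eval_form (function_form f)"
    have \<omega>: "alt \<omega>" "\<omega> [] = f" unfolding \<omega>_def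
      by (rule forms_alt[OF function_form[OF f]]) (rule eval_function_form)
    have L: "[X, Y] \<in> lists VF" using X Y by simp
    have "eval_form (graded_comm 1 1 dR dd (function_form f)) [X, Y] = 0"
      using comm function_form[OF f] by (simp add: eval_form_def fun_eq_iff fun_apply)
    then have "pull rR (D (pull rR' (D \<omega>))) [X, Y] + D (pull rR (D (pull rR' \<omega>))) [X, Y] = 0"
      unfolding \<omega>_def using eval_comm_d[OF forms_alt[OF function_form[OF f]] L] by simp
    moreover have "pull rR (D (pull rR' (D \<omega>))) [X, Y]
        = act (rR X) (act Y f) - act (rR' (lie_bracket (rR X) (rR Y))) f - act (rR Y) (act X f)"
      using X Y l by (simp add: pull_def D_two D_one \<omega>(2) rR'_rR linear_op_uminus[OF lin(2)] bracket_VF act_field_uminus)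
    moreover have "D (pull rR (D (pull rR' \<omega>))) [X, Y]
        = act X (act (rR Y) f) - act (rR (lie_bracket X Y)) f - act Y (act (rR X) f)"
      using X Y l by (simp add: pull_def D_two D_one \<omega>(2) linear_op_uminus[OF lin(1)] bracket_VF act_field_uminus)
    ultimately show "act (rR' (lie_bracket (rR X) (rR Y))) f
      = act (lie_bracket (rR X) Y) f + act (lie_bracket X (rR Y)) f - act (rR (lie_bracket X Y)) f"
      by (simp add: act_bracket algebra_simps)
  qed
next
  assume N: "\<forall>X\<in>VF. \<forall>Y\<in>VF. nijenhuis R X Y = 0"
  show "\<forall>\<alpha>\<in>forms M. graded_comm 1 1 dR dd \<alpha> = 0"
  proof
    fix \<alpha> assume "\<alpha> \<in> forms M"
    then have \<alpha>: "alt (eval_form \<alpha>)" by (rule forms_alt)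
    show "graded_comm 1 1 dR dd \<alpha> = 0"
    proof (rule form_eqI)
      show "graded_comm 1 1 dR dd \<alpha> p vs = 0 p vs" if "\<not> set vs \<subseteq> T p" for p vs
        using off_tangent[OF that] by (simp add: graded_comm_def fun_apply)
      fix Xs assume Xs: "Xs \<in> lists VF"
      define \<omega> where "\<omega> = eval_form \<alpha>"
      have \<omega>: "alt \<omega>" using \<alpha> by (simp add: \<omega>_def)
      let ?T = "Der (\<lambda>f. 0) rS"
      note dS = derivation_linear_op[OF lin(3)]
      note aD = alt_D[OF \<omega>] and aT = alt_Der[OF dS \<omega>]
      have "?T (D (D \<omega>)) Xs = ?T 0 Xs" by (rule Der_cong[OF dS _ Xs]) (simp add: D_D[OF \<omega>])
      then have TDD: "?T (D (D \<omega>)) Xs = 0" using Der_0[OF dS] by simp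
      have 1: "pull rR (D (pull rR' (D \<omega>))) Xs = - D (?T (D \<omega>)) Xs"
        unfolding nijenhuis_imp_d_R[OF N aD Xs] using TDD D_D[OF \<omega> Xs] by simp
      have "D (pull rR (D (pull rR' \<omega>))) Xs = D (D \<omega> + (?T (D \<omega>) + - D (?T \<omega>))) Xs"
        by (rule D_cong[OF _ Xs]) (simp add: nijenhuis_imp_d_R[OF N \<omega>])
      also have "\<dots> = D (D \<omega>) Xs + (D (?T (D \<omega>)) Xs + D (- D (?T \<omega>)) Xs)"
      proof -
        have "D (D \<omega> + (?T (D \<omega>) + - D (?T \<omega>))) Xs = D (D \<omega>) Xs + D (?T (D \<omega>) + - D (?T \<omega>)) Xs"
          using alt_C[OF aD] alt_C[OF alt_plus[OF alt_Der[OF dS aD] alt_uminus[OF alt_D[OF aT]]]]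
          by (intro D_plus Xs) blast+
        also have "D (?T (D \<omega>) + - D (?T \<omega>)) Xs = D (?T (D \<omega>)) Xs + D (- D (?T \<omega>)) Xs"
          using alt_C[OF alt_Der[OF dS aD]] alt_C[OF alt_uminus[OF alt_D[OF aT]]]
          by (intro D_plus Xs) blast+
        finally show ?thesis .
      qed
      also have "\<dots> = D (?T (D \<omega>)) Xs"
        using D_D[OF \<omega> Xs] D_D[OF aT Xs] D_uminus[of "D (?T \<omega>)" Xs] alt_C[OF alt_D[OF aT]] Xs by simp
      finally have 2: "D (pull rR (D (pull rR' \<omega>))) Xs = D (?T (D \<omega>)) Xs" .
      have "eval_form (graded_comm 1 1 dR dd \<alpha>) Xs = 0"
        using eval_comm_d[OF \<alpha> Xs] 1 2 unfolding \<omega>_def by simp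
      then show "eval_form (graded_comm 1 1 dR dd \<alpha>) Xs = eval_form 0 Xs"
        by (simp add: eval_form_def fun_eq_iff fun_apply)
    qed
  qed
qed

text \<open>
  From right to left, the identity is evaluated on the differential of a function and two vector
  fields; the terms that contain \<open>d(df)\<close> vanish.
\<close>

lemma d_R_eq_iff:
  "(\<forall>X\<in>VF. \<forall>Y\<in>VF. nijenhuis R X Y = 0) \<longleftrightarrow> (\<forall>\<alpha>\<in>forms M. dR \<alpha> = dd \<alpha> + graded_comm 0 1 (tau M S) dd \<alpha>)"
proof
  assume N: "\<forall>X\<in>VF. \<forall>Y\<in>VF. nijenhuis R X Y = 0"
  show "\<forall>\<alpha>\<in>forms M. dR \<alpha> = dd \<alpha> + graded_comm 0 1 (tau M S) dd \<alpha>"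
  proof
    fix \<alpha> assume "\<alpha> \<in> forms M"
    then have \<alpha>: "alt (eval_form \<alpha>)" by (rule forms_alt)
    show "dR \<alpha> = dd \<alpha> + graded_comm 0 1 (tau M S) dd \<alpha>"
    proof (rule form_eqI)
      show "dR \<alpha> p vs = (dd \<alpha> + graded_comm 0 1 (tau M S) dd \<alpha>) p vs" if "\<not> set vs \<subseteq> T p" for p vs
        using off_tangent[OF that] by (simp add: graded_comm_def fun_apply)
      show "eval_form (dR \<alpha>) Xs = eval_form (dd \<alpha> + graded_comm 0 1 (tau M S) dd \<alpha>) Xs" if "Xs \<in> lists VF" for Xs
        unfolding eval_d_R[OF \<alpha> that] eval_comm_tau[OF \<alpha> that] by (rule nijenhuis_imp_d_R[OF N \<alpha> that])
    qed
  qed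
next
  assume eq: "\<forall>\<alpha>\<in>forms M. dR \<alpha> = dd \<alpha> + graded_comm 0 1 (tau M S) dd \<alpha>"
  show "\<forall>X\<in>VF. \<forall>Y\<in>VF. nijenhuis R X Y = 0"
  proof (intro ballI nijenhuis_eq_0I)
    fix X Y f assume X: "X \<in> VF" and Y: "Y \<in> VF" and f: "f \<in> C"
    note l = linear_opD(1)[OF lin(1)] linear_opD(1)[OF lin(2)] linear_opD(1)[OF lin(3)]
    define \<omega> where "\<omega> = eval_form (differential f)"
    have \<omega>: "alt \<omega>" unfolding \<omega>_def by (rule forms_alt[OF differential])
    have ev: "\<omega> [Z] = act Z f" if "Z \<in> VF" for Z
      unfolding \<omega>_def by (rule eval_differential[OF that])
    have L: "[X, Y] \<in> lists VF" using X Y by simp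
    have "eval_form (dR (differential f)) [X, Y] = eval_form (dd (differential f) + graded_comm 0 1 (tau M S) dd (differential f)) [X, Y]"
      using eq differential by simp
    then have main: "pull rR (D (pull rR' \<omega>)) [X, Y]
        = D \<omega> [X, Y] + (Der (\<lambda>f. 0) rS (D \<omega>) [X, Y] - D (Der (\<lambda>f. 0) rS \<omega>) [X, Y])"
      unfolding \<omega>_def eval_d_R[OF forms_alt[OF differential] L] eval_comm_tau[OF forms_alt[OF differential] L] .
    have p: "pull rR (D (pull rR' \<omega>)) [X, Y]
        = act (rR X) (act Y f) - act (rR' (lie_bracket (rR X) (rR Y))) f - act (rR Y) (act X f)"
      using X Y l by (simp add: pull_def D_two ev rR'_rR linear_op_uminus[OF lin(2)] VF_closed act_field_uminus)
    have dd0: "D \<omega> [V, W] = 0" if "V \<in> VF" "W \<in> VF" for V W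
      using that by (simp add: D_two ev VF_closed act_field_uminus act_bracket)
    have TD: "Der (\<lambda>f. 0) rS (D \<omega>) [X, Y] = 0"
      using X Y l by (simp add: ins_def dd0)
    have "Der (\<lambda>f. 0) rS \<omega> [Z] = act (rR Z) f - act Z f" if "Z \<in> VF" for Z
      using that l by (simp add: ev rS_eq act_field_diff)
    then have DT: "D (Der (\<lambda>f. 0) rS \<omega>) [X, Y]
        = act X (act (rR Y) f - act Y f) - (act (rR (lie_bracket X Y)) f - act (lie_bracket X Y) f) - act Y (act (rR X) f - act X f)"
      using X Y by (simp add: D_two VF_closed linear_op_uminus[OF lin(1)] act_field_uminus)
    show "act (rR' (lie_bracket (rR X) (rR Y))) f
      = act (lie_bracket (rR X) Y) f + act (lie_bracket X (rR Y)) f - act (rR (lie_bracket X Y)) f"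
      using main unfolding p dd0[OF X Y] TD DT using X Y l
      by (simp add: act_bracket act_subtract act_C algebra_simps)
  qed
qed

end

end

theorem lemma2p4:
  fixes M :: "('m::{t2_space,second_countable_topology}, 'b::euclidean_space) smooth_structure"
    and R S :: "'m endo_field"
  assumes "smooth_manifold M"
    and "R \<in> invertible_endo_fields M"
    and "S = (\<lambda>p v. R p v - v)"
  shows "((\<forall>\<alpha>\<in>forms M. graded_comm 1 1 (d_R M R) (ext_d M) \<alpha> = 0)
            \<longleftrightarrow> (\<forall>X\<in>vector_fields M. \<forall>Y\<in>vector_fields M. nijenhuis R X Y = 0))
       \<and> ((\<forall>X\<in>vector_fields M. \<forall>Y\<in>vector_fields M. nijenhuis R X Y = 0)
            \<longleftrightarrow> (\<forall>\<alpha>\<in>forms M. d_R M R \<alpha> = ext_d M \<alpha> + graded_comm 0 1 (tau M S) (ext_d M) \<alpha>))"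
proof -
  interpret manifold M by (rule manifold.intro) (rule assms(1))
  show ?thesis
    using d_R_anticommutes_iff[OF assms(2,3)] d_R_eq_iff[OF assms(2,3)] by (rule conjI)
qed

end
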